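(* Let $AG_n$ be the alternating group graph, i.e. the Cayley graph of the alternating group $A_n$ with generating set $\{(1,i,2),(1,2,i):3\le i\le n\}$. For $\lambda\in \mathrm{NCPar}(n)\cup \mathrm{CPar}(n)$, the eigenvalues of the adjacency matrix of $AG_n$ are indexed by the set $\mathrm{UStd}(\lambda)\cup \mathrm{UStd}(\lambda')$. For non-self-conjugate $\lambda\vdash n$, each eigenvalue repeats $d_\lambda$ many times. For self-conjugate $\lambda\vdash n$, each eigenvalue repeats $\frac{d_\lambda}{2}$ many times. Let $\mathcal E'_T$ denote the eigenvalue indexed by $T\in \mathrm{UStd}(\lambda)\cup \mathrm{UStd}(\lambda')$. Then: - if $n-1$ and $n$ appear in the same row of $T$, then $\mathcal E'_T=c(b_T(n))+c(b_T(n-1))-1$; - if $n-1$ and $n$ appear in the same column of $T$, then $\mathcal E'_T=-c(b_T(n))-c(b_T(n-1))-1$; - if $n-1$ and $n$ appear neither in the same row nor in the same column of $T$, then $\mathcal E'_T=c(b_T(n))+c(b_T(n-1))-1$ and $\mathcal E'_S=-c(b_T(n))-c(b_T(n-1))-1$, where $S$ is the upper standard Young tableau obtained from $T$ by interchanging the positions of $n$ and $n-1$ (in each such pair, one member is called $T$ and the other $S$).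
   Context: For a partition $\lambda\vdash n$ (identified with its Young diagram): $\lambda'$ is the conjugate partition; $\lambda$ is self-conjugate if $\lambda=\lambda'$; $d_\lambda$ is the number of standard Young tableaux of shape $\lambda$. The content of the box in row $u$ and column $v$ is $v-u$. For a standard Young tableau $T$, $b_T(i)$ is the box of $T$ containing $i$ and $c(b_T(i))$ is its content. A standard Young tableau $T$ is upper standard if $c(b_T(2))=1$ (i.e. $2$ is immediately to the right of $1$); $\mathrm{UStd}(\lambda)$ is the set of upper standard Young tableaux of shape $\lambda$. $\mathrm{CPar}(n)$ is the set of self-conjugate partitions of $n$, and $\mathrm{NCPar}(n)$ is the set of $\lambda\vdash n$ with $\lambda\ne\lambda'$ and $\lambda_i>\lambda'_i$ for the smallest index $i$ with $\lambda_i\ne\lambda'_i$. The generating set is closed under inverses, so $AG_n$ is an undirected graph on the $n!/2$ elements of $A_n$.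
   Formalization: For self-conjugate λ the index set UStd(λ) ∪ UStd(λ') is taken as a disjoint union (two copies of UStd(λ)), each index with multiplicity d_λ/2; with the plain set union the count fails, e.g. for n = 3, where −1 must occur twice. The statement is for n ≥ 2. *)

theory Defs
  imports
    "HOL-Algebra.Sym_Groups"
    "Graph_Theory.Pair_Digraph"
    "Jordan_Normal_Form.Char_Poly"
begin

text \<open>Partitions are weakly decreasing lists of positive parts. All row, column and part indices
  are 0-based; contents, which are differences of indices, are not affected by this.\<close>

definition partitions :: "nat \<Rightarrow> nat list set" where
  "partitions n = {\<mu>. sorted_wrt (\<ge>) \<mu> \<and> 0 \<notin> set \<mu> \<and> sum_list \<mu> = n}"

definition part :: "nat list \<Rightarrow> nat \<Rightarrow> nat" where
  "part \<mu> i = (if i < length \<mu> then \<mu> ! i else 0)"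

definition young_diagram :: "nat list \<Rightarrow> (nat \<times> nat) set" where
  "young_diagram \<mu> = {(u, v). u < length \<mu> \<and> v < \<mu> ! u}"

text \<open>The parts of the conjugate are the column lengths; \<^term>\<open>part \<mu> 0\<close> is the number of
  columns.\<close>

definition conj_partition :: "nat list \<Rightarrow> nat list" where
  "conj_partition \<mu> = map (\<lambda>v. card {u. (u, v) \<in> young_diagram \<mu>}) [0..<part \<mu> 0]"

definition CPar :: "nat \<Rightarrow> nat list set" where
  "CPar n = {\<mu> \<in> partitions n. \<mu> = conj_partition \<mu>}"

definition NCPar :: "nat \<Rightarrow> nat list set" where
  "NCPar n = {\<mu> \<in> partitions n. \<mu> \<noteq> conj_partition \<mu> \<and>
     (let i = (LEAST i. part \<mu> i \<noteq> part (conj_partition \<mu>) i)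
      in part \<mu> i > part (conj_partition \<mu>) i)}"

text \<open>A tableau assigns to each box (row, column) its entry. Fillings are required to be 0 outside
  the diagram, so that a tableau determines its shape and there are finitely many tableaux of
  each shape.\<close>

type_synonym tableau = "nat \<times> nat \<Rightarrow> nat"

definition SYT :: "nat list \<Rightarrow> tableau set" where
  "SYT \<mu> = {T. bij_betw T (young_diagram \<mu>) {1..sum_list \<mu>} \<and>
     (\<forall>b. b \<notin> young_diagram \<mu> \<longrightarrow> T b = 0) \<and>
     (\<forall>u v w. v < w \<and> (u, w) \<in> young_diagram \<mu> \<longrightarrow> T (u, v) < T (u, w)) \<and>
     (\<forall>u v w. u < w \<and> (w, v) \<in> young_diagram \<mu> \<longrightarrow> T (u, v) < T (w, v))}"

definition box_of :: "tableau \<Rightarrow> nat \<Rightarrow> nat \<times> nat" where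
  "box_of T i = (THE b. T b = i)"

definition box_content :: "nat \<times> nat \<Rightarrow> int" where
  "box_content b = int (snd b) - int (fst b)"

definition UStd :: "nat list \<Rightarrow> tableau set" where
  "UStd \<mu> = {T \<in> SYT \<mu>. box_content (box_of T 2) = 1}"

definition same_row :: "tableau \<Rightarrow> nat \<Rightarrow> nat \<Rightarrow> bool" where
  "same_row T i j \<longleftrightarrow> fst (box_of T i) = fst (box_of T j)"

definition same_column :: "tableau \<Rightarrow> nat \<Rightarrow> nat \<Rightarrow> bool" where
  "same_column T i j \<longleftrightarrow> snd (box_of T i) = snd (box_of T j)"

definition swap_entries :: "nat \<Rightarrow> nat \<Rightarrow> tableau \<Rightarrow> tableau" where
  "swap_entries i j T = Transposition.transpose i j \<circ> T"

text \<open>For self-conjugate shapes of size at least 2 the number of tableaux is even, so the integer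
  division is exact.\<close>

definition eigenvalue_multiplicity :: "nat list \<Rightarrow> nat" where
  "eigenvalue_multiplicity \<mu> =
     (if \<mu> = conj_partition \<mu> then card (SYT \<mu>) div 2 else card (SYT \<mu>))"

definition cayley_graph :: "('a, 'b) monoid_scheme \<Rightarrow> 'a set \<Rightarrow> 'a pair_pre_digraph" where
  "cayley_graph G S =
     \<lparr>pverts = carrier G, parcs = {(g, g \<otimes>\<^bsub>G\<^esub> s) | g s. g \<in> carrier G \<and> s \<in> S}\<rparr>"

definition AG :: "nat \<Rightarrow> (nat \<Rightarrow> nat) pair_pre_digraph" where
  "AG n = cayley_graph (alt_group n)
     ({cycle_of_list [1, i, 2] | i. 3 \<le> i \<and> i \<le> n} \<union>
      {cycle_of_list [1, 2, i] | i. 3 \<le> i \<and> i \<le> n})"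

text \<open>The list fixes an enumeration of the vertices.\<close>

definition adjacency_matrix :: "'a pair_pre_digraph \<Rightarrow> 'a list \<Rightarrow> real mat" where
  "adjacency_matrix G vs =
     mat (length vs) (length vs) (\<lambda>(i, j). if (vs ! i, vs ! j) \<in> parcs G then 1 else 0)"

end

theory Submission
  imports Defs
begin

text \<open>Right multiplication by the sum of the generators acts on functions on the alternating group by
the adjacency matrix. Reverse the labels, \<open>i \<mapsto> n + 1 - i\<close>, so that \<open>{1, 2}\<close> becomes
\<open>{n - 1, n}\<close>. With \<open>s = (n - 1, n)\<close> and the Jucys-Murphy elements \<open>X\<^sub>i = \<Sum>j<i. (j, i)\<close>, the sum
of the generators is then \<open>s (X\<^sub>n\<^sub>-\<^sub>1 + X\<^sub>n) - 1\<close>, and \<open>s\<close> commutes with \<open>X\<^sub>n\<^sub>-\<^sub>1 + X\<^sub>n\<close>. The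
Jucys-Murphy elements act on the vector of a standard tableau by the contents of its entries, and
\<open>s\<close> has eigenvalues \<open>1\<close> and \<open>-1\<close>. So every eigenvalue is \<open>\<epsilon> (c\<^sub>n\<^sub>-\<^sub>1 + c\<^sub>n) - 1\<close> with a sign
\<open>\<epsilon>\<close>. One can take \<open>\<epsilon>\<close> to be the sign of \<open>c\<^sub>n - c\<^sub>n\<^sub>-\<^sub>1\<close>: it is \<open>1\<close> if \<open>n - 1\<close> and \<open>n\<close>
share a row, \<open>-1\<close> if they share a column, and it takes both values on \<open>T\<close> and the tableau
obtained by exchanging \<open>n - 1\<close> and \<open>n\<close>.

The multiplicities come from an explicit eigenbasis of the functions on the symmetric group. For
two standard tableaux \<open>S\<close>, \<open>T\<close> of one shape there is a nonzero function on which the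
Jucys-Murphy elements act from the left by the contents of \<open>S\<close> and from the right by those of
\<open>T\<close> (\<open>jm_eigen_exists\<close>). For one pair of each shape it is a relabelled Young symmetrizer, by the Garnir
relations (\<open>garnir\<close>); the others follow from it by exchanging consecutive entries, which connects
all tableaux of a shape (\<open>entry_swap_connected\<close>). Contents determine a tableau, so these functions
have distinct joint eigenvalues and are linearly independent; by the identity
\<open>\<Sum>\<lambda>. d\<^sub>\<lambda>\<^sup>2 = n!\<close> (\<open>sum_card_tableaux_squares\<close>) they form a basis. Multiplying each of them by
\<open>1 + \<epsilon> s\<close> gives the eigenbasis for the sum of the generators (\<open>ag_eigenbasis\<close>).

The symmetric group consists of two cosets of the alternating group, on which right multiplication
looks the same, so the result is the square of the wanted characteristic polynomial
(\<open>char_poly_AG_squared\<close>). Transposing a tableau negates its contents and \<open>\<epsilon>\<close> and therefore keeps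
the eigenvalue. Hence conjugate shapes contribute equal factors, and the upper standard tableaux of
\<open>\<lambda>\<close> together with those of \<open>\<lambda>'\<close> give the same eigenvalues as all standard tableaux of \<open>\<lambda>\<close>. Taking
the square root, which is unique among monic polynomials, gives the theorem.\<close>

section \<open>Young diagrams and standard tableaux\<close>

text \<open>Order ideals of \<open>\<nat> \<times> \<nat>\<close> in place of partitions: they make removing and adding boxes,
intersections and transposition plain set operations.\<close>

definition diagram :: "(nat \<times> nat) set \<Rightarrow> bool" where
  "diagram D \<longleftrightarrow> finite D \<and> (\<forall>u v u' v'. (u, v) \<in> D \<and> u' \<le> u \<and> v' \<le> v \<longrightarrow> (u', v') \<in> D)"

definition tableaux :: "(nat \<times> nat) set \<Rightarrow> tableau set" where
  "tableaux D = {T. bij_betw T D {1..card D} \<and> (\<forall>b. b \<notin> D \<longrightarrow> T b = 0) \<and>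
     (\<forall>u v w. v < w \<and> (u, w) \<in> D \<longrightarrow> T (u, v) < T (u, w)) \<and>
     (\<forall>u v w. u < w \<and> (w, v) \<in> D \<longrightarrow> T (u, v) < T (w, v))}"

lemma diagramD: "diagram D \<Longrightarrow> (u, v) \<in> D \<Longrightarrow> u' \<le> u \<Longrightarrow> v' \<le> v \<Longrightarrow> (u', v') \<in> D"
  unfolding diagram_def by blast

lemma finite_diagram: "diagram D \<Longrightarrow> finite D"
  unfolding diagram_def by blast

lemma diagram_Int: "diagram D \<Longrightarrow> diagram D' \<Longrightarrow> diagram (D \<inter> D')"
  unfolding diagram_def by (simp, blast)

lemma diagram_Un: "diagram D \<Longrightarrow> diagram D' \<Longrightarrow> diagram (D \<union> D')"
  unfolding diagram_def by (simp, blast)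

lemma diagram_bounded:
  assumes "diagram D" "(u, v) \<in> D" shows "u < card D" "v < card D"
proof -
  have "(\<lambda>i. (i, v)) ` {..u} \<subseteq> D" using assms diagramD by auto
  then have "card ((\<lambda>i. (i, v)) ` {..u}) \<le> card D"
    using finite_diagram[OF assms(1)] card_mono by blast
  then show "u < card D" by (subst (asm) card_image) (auto simp: inj_on_def)
  have "(\<lambda>i. (u, i)) ` {..v} \<subseteq> D" using assms diagramD by auto
  then have "card ((\<lambda>i. (u, i)) ` {..v}) \<le> card D"
    using finite_diagram[OF assms(1)] card_mono by blast
  then show "v < card D" by (subst (asm) card_image) (auto simp: inj_on_def)
qed

lemma finite_diagrams: "finite {D. diagram D \<and> card D = n}"
proof (rule finite_subset)
  show "{D. diagram D \<and> card D = n} \<subseteq> Pow ({..<n} \<times> {..<n})"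
    by (auto dest: diagram_bounded)
qed simp

lemma finite_tableaux: "finite D \<Longrightarrow> finite (tableaux D)"
  by (rule finite_subset[OF _ finite_set_of_finite_funs[of D "{1..card D}" 0]])
    (auto simp: tableaux_def bij_betw_def)

lemma tableaux_bij: "T \<in> tableaux D \<Longrightarrow> bij_betw T D {1..card D}"
  unfolding tableaux_def by blast

lemma tableaux_zero: "T \<in> tableaux D \<Longrightarrow> b \<notin> D \<Longrightarrow> T b = 0"
  unfolding tableaux_def by blast

lemma tableaux_row: "T \<in> tableaux D \<Longrightarrow> v < w \<Longrightarrow> (u, w) \<in> D \<Longrightarrow> T (u, v) < T (u, w)"
  unfolding tableaux_def by blast

lemma tableaux_col: "T \<in> tableaux D \<Longrightarrow> u < w \<Longrightarrow> (w, v) \<in> D \<Longrightarrow> T (u, v) < T (w, v)"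
  unfolding tableaux_def by blast

lemma tableaux_range: "T \<in> tableaux D \<Longrightarrow> b \<in> D \<Longrightarrow> 1 \<le> T b \<and> T b \<le> card D"
  using tableaux_bij[of T D] unfolding bij_betw_def by auto

lemma tableaux_support: "T \<in> tableaux D \<Longrightarrow> D = {b. T b \<noteq> 0}"
  using tableaux_range[of T D] tableaux_zero[of T D] by fastforce

lemma box_of_entry:
  assumes T: "T \<in> tableaux D" and i: "1 \<le> i" "i \<le> card D"
  shows "box_of T i \<in> D" "T (box_of T i) = i"
proof -
  have "\<exists>!b. T b = i"
  proof -
    from i obtain b where b: "b \<in> D" "T b = i"
      using tableaux_bij[OF T] unfolding bij_betw_def by (metis atLeastAtMost_iff imageE)
    moreover have "b' = b" if "T b' = i" for b'
    proof -
      have "b' \<in> D" using tableaux_zero[OF T, of b'] that i by (cases "b' \<in> D") auto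
      then show ?thesis using b that tableaux_bij[OF T] unfolding bij_betw_def inj_on_def by blast
    qed
    ultimately show ?thesis by blast
  qed
  then have *: "T (box_of T i) = i" unfolding box_of_def by (rule theI')
  then show "T (box_of T i) = i" .
  then show "box_of T i \<in> D" using tableaux_zero[OF T, of "box_of T i"] i by (cases "box_of T i \<in> D") auto
qed

lemma box_of_eq:
  assumes T: "T \<in> tableaux D" and b: "b \<in> D"
  shows "box_of T (T b) = b"
proof -
  have "1 \<le> T b" "T b \<le> card D" using tableaux_range[OF T b] by auto
  from box_of_entry[OF T this] b show ?thesis
    using tableaux_bij[OF T] unfolding bij_betw_def inj_on_def by blast
qed

lemma box_of_inj:
  assumes "T \<in> tableaux D" "1 \<le> i" "i \<le> card D" "1 \<le> j" "j \<le> card D" "box_of T i = box_of T j"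
  shows "i = j"
  using box_of_entry(2)[OF assms(1-3)] box_of_entry(2)[OF assms(1) assms(4,5)] assms(6) by metis

lemma tableaux_mono:
  assumes D: "diagram D" and T: "T \<in> tableaux D" and b: "(u, v) \<in> D" "u' \<le> u" "v' \<le> v"
  shows "T (u', v') \<le> T (u, v)"
proof -
  have 1: "(u', v) \<in> D" using diagramD[OF D b(1) b(2)] by simp
  have "T (u', v') \<le> T (u', v)" using tableaux_row[OF T _ 1, of v'] b(3) by (cases "v' = v") auto
  also have "\<dots> \<le> T (u, v)" using tableaux_col[OF T _ b(1), of u'] b(2) by (cases "u' = u") auto
  finally show ?thesis .
qed

lemma tableaux_eqI:
  assumes T: "T \<in> tableaux D" and T': "T' \<in> tableaux D'" and c: "card D = card D'"
    and eq: "\<And>i. 1 \<le> i \<Longrightarrow> i \<le> card D \<Longrightarrow> box_of T i = box_of T' i"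
  shows "T = T'"
proof
  have *: "T b = T' b" if T: "T \<in> tableaux D" and T': "T' \<in> tableaux D'" and c: "card D = card D'"
    and eq: "\<And>i. 1 \<le> i \<Longrightarrow> i \<le> card D \<Longrightarrow> box_of T i = box_of T' i" and b: "b \<in> D" for T T' D D' b
  proof -
    have r: "1 \<le> T b" "T b \<le> card D" using tableaux_range[OF T b] by auto
    have "b = box_of T' (T b)" using box_of_eq[OF T b] eq[OF r] by simp
    with box_of_entry(2)[OF T'] r c show ?thesis by metis
  qed
  fix b
  have 1: "b \<in> D \<Longrightarrow> T b = T' b" using *[OF T T' c eq] by blast
  have "b \<in> D' \<Longrightarrow> T' b = T b" using *[OF T' T c[symmetric] eq[symmetric]] c by metis
  then show "T b = T' b"
    using 1 tableaux_zero[OF T, of b] tableaux_zero[OF T', of b] by metis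
qed

text \<open>Boxes of equal content lie on one diagonal and are therefore comparable. At the first entry on
which two tableaux disagree, the upper left one of the two boxes would already be filled by a
smaller entry in the tableau that contains the other one, and smaller entries agree.\<close>

lemma contents_determine_boxes:
  assumes D: "diagram D" and D': "diagram D'" and T: "T \<in> tableaux D" and T': "T' \<in> tableaux D'"
    and k: "k \<le> card D" "k \<le> card D'"
    and eq: "\<And>i. 1 \<le> i \<Longrightarrow> i \<le> k \<Longrightarrow> box_content (box_of T i) = box_content (box_of T' i)"
    and i: "1 \<le> i" "i \<le> k"
  shows "box_of T i = box_of T' i"
  using i
proof (induction i rule: less_induct)
  case (less i)
  have key: False
    if D': "diagram D'" and T: "T \<in> tableaux D" and T': "T' \<in> tableaux D'"
      and k: "k \<le> card D" "k \<le> card D'"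
      and IH: "\<And>j. 1 \<le> j \<Longrightarrow> j < i \<Longrightarrow> box_of T j = box_of T' j"
      and b: "fst (box_of T i) < fst (box_of T' i)" "snd (box_of T i) < snd (box_of T' i)"
    for D D' T T'
  proof -
    obtain u v u' v' where uv: "box_of T i = (u, v)" "box_of T' i = (u', v')" by (metis surj_pair)
    have in': "(u', v') \<in> D'" "T' (u', v') = i"
      using box_of_entry[OF T', of i] less.prems k uv by auto
    have in1: "(u, v') \<in> D'" using diagramD[OF D' in'(1)] b uv by auto
    then have in2: "(u, v) \<in> D'" using diagramD[OF D' in1] b uv by auto
    have "T' (u, v) < T' (u, v')" using tableaux_row[OF T' _ in1] b uv by auto
    also have "\<dots> < i" using tableaux_col[OF T' _ in'(1)] b uv in'(2) by auto
    finally have lt: "T' (u, v) < i" .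
    have "1 \<le> T' (u, v)" using tableaux_range[OF T' in2] by auto
    then have "box_of T (T' (u, v)) = box_of T' (T' (u, v))" using IH lt by blast
    then have "box_of T (T' (u, v)) = box_of T i" using box_of_eq[OF T' in2] uv by simp
    then show False
      using box_of_inj[OF T, of "T' (u, v)" i] \<open>1 \<le> T' (u, v)\<close> lt k less.prems by auto
  qed
  have IH: "box_of T j = box_of T' j" if "1 \<le> j" "j < i" for j
    using less.IH[of j] that less.prems by simp
  have e: "box_content (box_of T i) = box_content (box_of T' i)" using eq less.prems by blast
  have 1: "\<not> (fst (box_of T i) < fst (box_of T' i) \<and> snd (box_of T i) < snd (box_of T' i))"
    using key[OF D' T T' k IH] by blast
  have 2: "\<not> (fst (box_of T' i) < fst (box_of T i) \<and> snd (box_of T' i) < snd (box_of T i))"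
    using key[OF D T' T k(2,1) IH[symmetric]] by blast
  have "fst (box_of T i) = fst (box_of T' i) \<and> snd (box_of T i) = snd (box_of T' i)"
    using 1 2 e unfolding box_content_def by linarith
  then show ?case by (simp add: prod_eq_iff)
qed

text \<open>The box of \<open>i + 1\<close> is not weakly up and to the left of that of \<open>i\<close>. If it lay strictly below and strictly to the right,
a third box would have an entry strictly between \<open>i\<close> and \<open>i + 1\<close>.\<close>

lemma consecutive_boxes:
  assumes D: "diagram D" and T: "T \<in> tableaux D" and i: "1 \<le> i" "Suc i \<le> card D"
  defines "b \<equiv> box_of T i" and "b' \<equiv> box_of T (Suc i)"
  shows "fst b = fst b' \<and> snd b < snd b' \<or> snd b = snd b' \<and> fst b < fst b' \<or>
    fst b < fst b' \<and> snd b' < snd b \<or> fst b' < fst b \<and> snd b < snd b'"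
proof -
  obtain u v u' v' where uv: "b = (u, v)" "b' = (u', v')" by (metis surj_pair)
  have b: "(u, v) \<in> D" "T (u, v) = i" "(u', v') \<in> D" "T (u', v') = Suc i"
    using box_of_entry[OF T, of i] box_of_entry[OF T, of "Suc i"] i uv
    unfolding b_def b'_def by auto
  have 1: "\<not> (u' \<le> u \<and> v' \<le> v)" using tableaux_mono[OF D T b(1), of u' v'] b by auto
  have 2: "\<not> (u < u' \<and> v < v')"
  proof
    assume *: "u < u' \<and> v < v'"
    then have "(u, v') \<in> D" using diagramD[OF D b(3)] by auto
    then have "T (u, v) < T (u, v')" using tableaux_row[OF T] * by blast
    moreover have "T (u, v') < T (u', v')" using tableaux_col[OF T _ b(3)] * by blast
    ultimately show False using b by simp
  qed
  show ?thesis using 1 2 unfolding uv fst_conv snd_conv by linarith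
qed

lemma box_of_swap_entries: "box_of (swap_entries i j T) k = box_of T (Transposition.transpose i j k)"
proof -
  have "Transposition.transpose i j (T b) = k \<longleftrightarrow> T b = Transposition.transpose i j k" for b
    by (metis transpose_involutory)
  then show ?thesis unfolding box_of_def swap_entries_def comp_apply by presburger
qed

section \<open>The sum of the squares of the numbers of standard tableaux\<close>

definition removable :: "(nat \<times> nat) set \<Rightarrow> (nat \<times> nat) set" where
  "removable D = {b \<in> D. diagram (D - {b})}"

definition addable :: "(nat \<times> nat) set \<Rightarrow> (nat \<times> nat) set" where
  "addable D = {b. b \<notin> D \<and> diagram (insert b D)}"

lemma card_removable: "b \<in> removable D \<Longrightarrow> diagram D \<Longrightarrow> card D = Suc (card (D - {b}))"
  using card.remove[of D b] finite_diagram[of D] by (simp add: removable_def)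

lemma finite_addable: "finite (addable D)"
proof (rule finite_subset)
  show "addable D \<subseteq> {..<Suc (card D)} \<times> {..<Suc (card D)}"
  proof
    fix b assume b: "b \<in> addable D"
    obtain u v where uv: "b = (u, v)" by force
    have i: "diagram (insert b D)" using b by (simp add: addable_def)
    then have "finite D" using finite_diagram[OF i] by simp
    then have "card (insert b D) = Suc (card D)" using b by (simp add: addable_def)
    then show "b \<in> {..<Suc (card D)} \<times> {..<Suc (card D)}"
      using diagram_bounded[OF i, of u v] uv by auto
  qed
qed simp

lemma finite_removable: "diagram D \<Longrightarrow> finite (removable D)"
  unfolding removable_def by (simp add: finite_diagram)

text \<open>Together with \<open>extend_tableau\<close>: tableaux of shape \<open>D\<close> correspond to a removable box and a tableau
of the remaining shape.\<close>

lemma largest_entry: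
  assumes D: "diagram D" and T: "T \<in> tableaux D" and ne: "D \<noteq> {}"
  defines "b \<equiv> box_of T (card D)"
  shows "b \<in> removable D" "T(b := 0) \<in> tableaux (D - {b})" "T b = card D"
proof -
  have fin: "finite D" by (rule finite_diagram[OF D])
  have c: "1 \<le> card D" using ne fin by (simp add: Suc_leI card_gt_0_iff)
  have b: "b \<in> D" and Tb: "T b = card D" using box_of_entry[OF T c] unfolding b_def by auto
  show "T b = card D" by (rule Tb)
  have max: "b = b'" if "b' \<in> D" "T b \<le> T b'" for b'
    using that b Tb tableaux_range[OF T that(1)] tableaux_bij[OF T]
    unfolding bij_betw_def inj_on_def by (metis le_antisym)
  have "diagram (D - {b})"
    unfolding diagram_def
  proof (intro conjI allI impI)
    fix u v u' v' assume *: "(u, v) \<in> D - {b} \<and> u' \<le> u \<and> v' \<le> v"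
    then have "T (u', v') \<le> T (u, v)" "(u', v') \<in> D"
      using tableaux_mono[OF D T] diagramD[OF D] by blast+
    then show "(u', v') \<in> D - {b}" using max[of "(u, v)"] * by auto
  qed (use fin in simp)
  then show "b \<in> removable D" using b by (simp add: removable_def)
  have c': "card (D - {b}) = card D - 1" using b fin by simp
  have "bij_betw T (D - {b}) ({1..card D} - {T b})"
    using bij_betw_subset[OF tableaux_bij[OF T], of "D - {b}" "{1..card D} - {T b}"]
      tableaux_bij[OF T] b by (auto simp: bij_betw_def inj_on_image_set_diff[of T D])
  moreover have "{1..card D} - {T b} = {1..card D - 1}" using Tb by auto
  ultimately have bij: "bij_betw (T(b := 0)) (D - {b}) {1..card (D - {b})}"
    unfolding c' by (subst bij_betw_cong[of _ _ T]) auto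
  have "(T(b := 0)) (u, v) < (T(b := 0)) (u, w)" if "v < w" "(u, w) \<in> D - {b}" for u v w
    using tableaux_row[OF T, of v w u] that by auto
  moreover have "(T(b := 0)) (u, v) < (T(b := 0)) (w, v)" if "u < w" "(w, v) \<in> D - {b}" for u v w
    using tableaux_col[OF T, of u w v] that by auto
  ultimately show "T(b := 0) \<in> tableaux (D - {b})"
    unfolding tableaux_def using bij tableaux_zero[OF T] by (intro CollectI conjI) auto
qed

lemma extend_tableau:
  assumes D: "diagram D" and b: "b \<in> removable D" and T: "T \<in> tableaux (D - {b})"
  shows "T(b := card D) \<in> tableaux D" "box_of (T(b := card D)) (card D) = b"
proof -
  have D': "diagram (D - {b})" and bD: "b \<in> D" using b by (auto simp: removable_def)
  let ?n = "card D" let ?T = "T(b := card D)"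
  obtain m where n: "?n = Suc m" and m: "card (D - {b}) = m"
    using card_removable[OF b D] by blast
  have "bij_betw ?T (D - {b}) {1..m}"
    using tableaux_bij[OF T] unfolding m by (subst bij_betw_cong[of _ _ T]) auto
  then have "bij_betw ?T ((D - {b}) \<union> {b}) ({1..m} \<union> {?T b})"
    by (intro notIn_Un_bij_betw) (auto simp: n)
  moreover have "(D - {b}) \<union> {b} = D" "{1..m} \<union> {?T b} = {1..?n}"
    using bD n by auto
  ultimately have bij: "bij_betw ?T D {1..?n}" by simp
  have small: "T b' < ?n" if "b' \<noteq> b" "b' \<in> D" for b'
    using tableaux_range[OF T, of b'] that n m by auto
  have "?T (u, v) < ?T (u, w)" if vw: "v < w" and D1: "(u, w) \<in> D" for u v w
  proof (cases "(u, w) = b")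
    case True
    then show ?thesis using small[of "(u, v)"] vw diagramD[OF D D1, of u v] by auto
  next
    case False
    then have "(u, w) \<in> D - {b}" using D1 by simp
    moreover from this have "(u, v) \<in> D - {b}" using diagramD[OF D', of u w u v] vw by auto
    ultimately show ?thesis using tableaux_row[OF T vw] by auto
  qed
  moreover have "?T (u, v) < ?T (w, v)" if vw: "u < w" and D1: "(w, v) \<in> D" for u v w
  proof (cases "(w, v) = b")
    case True
    then show ?thesis using small[of "(u, v)"] vw diagramD[OF D D1, of u v] by auto
  next
    case False
    then have "(w, v) \<in> D - {b}" using D1 by simp
    moreover from this have "(u, v) \<in> D - {b}" using diagramD[OF D', of w v u v] vw by auto
    ultimately show ?thesis using tableaux_col[OF T vw] by auto
  qed
  ultimately show *: "?T \<in> tableaux D"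
    unfolding tableaux_def using bij tableaux_zero[OF T] bD by (intro CollectI conjI) auto
  show "box_of ?T ?n = b" using box_of_eq[OF * bD] by simp
qed

lemma card_tableaux_removable:
  assumes D: "diagram D" and ne: "D \<noteq> {}"
  shows "card (tableaux D) = (\<Sum>b\<in>removable D. card (tableaux (D - {b})))"
proof -
  let ?e = "\<lambda>b T. T(b := card D)"
  have fin: "finite D" by (rule finite_diagram[OF D])
  have eq: "tableaux D = (\<Union>b\<in>removable D. ?e b ` tableaux (D - {b}))"
  proof (intro equalityI subsetI)
    fix T assume T: "T \<in> tableaux D"
    note l = largest_entry[OF D T ne]
    let ?b = "box_of T (card D)"
    have "T = ?e ?b (T(?b := 0))" using l(3) by auto
    then show "T \<in> (\<Union>b\<in>removable D. ?e b ` tableaux (D - {b}))" using l(1,2) by blast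
  qed (use extend_tableau[OF D] in blast)
  have "card (tableaux D) = (\<Sum>b\<in>removable D. card (?e b ` tableaux (D - {b})))"
    unfolding eq
  proof (rule card_UN_disjoint)
    show "\<forall>i\<in>removable D. \<forall>j\<in>removable D. i \<noteq> j \<longrightarrow>
      ?e i ` tableaux (D - {i}) \<inter> ?e j ` tableaux (D - {j}) = {}"
    proof (intro ballI impI equals0I)
      fix i j T assume ij: "i \<in> removable D" "j \<in> removable D" "i \<noteq> j"
        and T: "T \<in> ?e i ` tableaux (D - {i}) \<inter> ?e j ` tableaux (D - {j})"
      have *: "box_of T (card D) = k" if "T \<in> ?e k ` tableaux (D - {k})" "k \<in> removable D" for k
        using that extend_tableau(2)[OF D that(2)] by force
      have "box_of T (card D) = i" "box_of T (card D) = j" using *[of i] *[of j] T ij by auto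
      then show False using ij by simp
    qed
  qed (auto simp: finite_removable[OF D] intro!: finite_imageI finite_tableaux fin)
  also have "card (?e b ` tableaux (D - {b})) = card (tableaux (D - {b}))"
    if "b \<in> removable D" for b
  proof (rule card_image, rule inj_onI)
    fix T T' assume T: "T \<in> tableaux (D - {b})" "T' \<in> tableaux (D - {b})" "?e b T = ?e b T'"
    show "T = T'"
    proof
      fix x show "T x = T' x"
        using fun_cong[OF T(3), of x] tableaux_zero[OF T(1), of x] tableaux_zero[OF T(2), of x]
        by (cases "x = b") auto
    qed
  qed
  ultimately show ?thesis by simp
qed

lemma finite_initial_segment:
  fixes S :: "nat set"
  assumes "finite S" "\<And>i j. i \<in> S \<Longrightarrow> j \<le> i \<Longrightarrow> j \<in> S"
  shows "S = {..<card S}"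
proof (cases "S = {}")
  case False
  have "S = {..Max S}"
    using assms(2)[OF Max_in[OF assms(1) False]] Max_ge[OF assms(1)] by (intro equalityI subsetI) simp_all
  then show ?thesis by (metis card_atMost lessThan_Suc_atMost)
qed simp

text \<open>Row \<open>u + 1\<close> can be extended exactly when the last box of row \<open>u\<close> is removable, and row \<open>0\<close> can
always be extended.\<close>

lemma card_addable:
  assumes D: "diagram D"
  shows "card (addable D) = Suc (card (removable D))"
proof -
  define r where "r u = card {v. (u, v) \<in> D}" for u
  have fin: "finite D" by (rule finite_diagram[OF D])
  have mem: "(u, v) \<in> D \<longleftrightarrow> v < r u" for u v
  proof -
    have "finite {v. (u, v) \<in> D}"
      by (rule finite_subset[of _ "snd ` D"]) (use fin in force)+
    then have "{v. (u, v) \<in> D} = {..<r u}"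
      unfolding r_def by (rule finite_initial_segment) (use diagramD[OF D] in blast)
    then show ?thesis by blast
  qed
  have anti: "r u' \<le> r u" if "u \<le> u'" for u u'
    using diagramD[OF D, of u' _ u] that mem by (metis le_refl not_le)
  let ?f = "\<lambda>(u, v). (Suc u, r (Suc u))"
  have rem: "(u, v) \<in> removable D \<longleftrightarrow> r u = Suc v \<and> r (Suc u) < r u" for u v
  proof
    assume "(u, v) \<in> removable D"
    then have *: "(u, v) \<in> D" "diagram (D - {(u, v)})" by (auto simp: removable_def)
    have "(u, Suc v) \<notin> D" using diagramD[OF *(2), of u "Suc v" u v] by auto
    moreover have "(Suc u, v) \<notin> D" using diagramD[OF *(2), of "Suc u" v u v] by auto
    ultimately show "r u = Suc v \<and> r (Suc u) < r u" using * mem by auto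
  next
    assume *: "r u = Suc v \<and> r (Suc u) < r u"
    have "diagram (D - {(u, v)})" unfolding diagram_def
    proof (intro conjI allI impI)
      fix x y x' y' assume **: "(x, y) \<in> D - {(u, v)} \<and> x' \<le> x \<and> y' \<le> y"
      then have "(x', y') \<in> D" using diagramD[OF D] by blast
      moreover have "(x', y') \<noteq> (u, v)"
      proof
        assume e: "(x', y') = (u, v)"
        show False
        proof (cases "x = u")
          case True then show False using ** e mem[of x y] * by auto
        next
          case False
          then have "r x \<le> r (Suc u)" using anti ** e by auto
          then show False using ** e mem[of x y] * by auto
        qed
      qed
      ultimately show "(x', y') \<in> D - {(u, v)}" by simp
    qed (use fin in simp)
    then show "(u, v) \<in> removable D" using * mem by (auto simp: removable_def)
  qed
  have add: "(u, v) \<in> addable D \<longleftrightarrow> v = r u \<and> (u = 0 \<or> r u < r (u - 1))" for u v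
  proof
    assume "(u, v) \<in> addable D"
    then have *: "(u, v) \<notin> D" "diagram (insert (u, v) D)" by (auto simp: addable_def)
    have "\<not> r u < v" using diagramD[OF *(2), of u v u "r u"] mem[of u "r u"] by auto
    moreover have "u = 0 \<or> v < r (u - 1)"
      using diagramD[OF *(2), of u v "u - 1" v] mem[of "u - 1" v] by auto
    ultimately show "v = r u \<and> (u = 0 \<or> r u < r (u - 1))" using * mem[of u v] by auto
  next
    assume *: "v = r u \<and> (u = 0 \<or> r u < r (u - 1))"
    have "diagram (insert (u, v) D)" unfolding diagram_def
    proof (intro conjI allI impI)
      fix x y x' y' assume **: "(x, y) \<in> insert (u, v) D \<and> x' \<le> x \<and> y' \<le> y"
      show "(x', y') \<in> insert (u, v) D"
      proof (cases "(x, y) \<in> D")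
        case True then show ?thesis using ** diagramD[OF D True] by auto
      next
        case False
        then have e: "x = u" "y = r u" using ** * by auto
        show ?thesis
        proof (cases "x' = u")
          case True then show ?thesis using ** e * mem[of u y'] by auto
        next
          case False
          then have "u \<noteq> 0" "x' \<le> u - 1" using ** e by auto
          then have "y' < r x'" using anti[of x' "u - 1"] * ** e by auto
          then show ?thesis using mem by auto
        qed
      qed
    qed (use fin in simp)
    then show "(u, v) \<in> addable D" using * mem by (auto simp: addable_def)
  qed
  have eq: "addable D = insert (0, r 0) (?f ` removable D)"
  proof (intro equalityI subsetI)
    fix b assume b: "b \<in> addable D"
    obtain u v where uv: "b = (u, v)" by force
    show "b \<in> insert (0, r 0) (?f ` removable D)"
    proof (cases u)
      case 0 then show ?thesis using b uv add[of u v] by auto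
    next
      case (Suc w)
      then have "(w, r w - 1) \<in> removable D" "?f (w, r w - 1) = b"
        using b uv add[of u v] rem[of w "r w - 1"] by auto
      from imageI[OF this(1), of ?f] this(2) show ?thesis by simp
    qed
  next
    fix b assume "b \<in> insert (0, r 0) (?f ` removable D)"
    then consider "b = (0, r 0)" | u v where "(u, v) \<in> removable D" "b = (Suc u, r (Suc u))"
      by auto
    then show "b \<in> addable D" by cases (simp_all add: rem add)
  qed
  have "inj_on ?f (removable D)" using rem by (auto simp: inj_on_def)
  then show ?thesis unfolding eq
    by (subst card_insert_disjoint) (auto simp: finite_removable[OF D] card_image)
qed

lemma sum_swap_guarded:
  assumes "finite A" "finite B" "\<And>a. a \<in> A \<Longrightarrow> finite (P a)" "\<And>b. b \<in> B \<Longrightarrow> finite (Q b)"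
    and "\<And>a b. a \<in> A \<and> b \<in> P a \<longleftrightarrow> b \<in> B \<and> a \<in> Q b"
  shows "(\<Sum>a\<in>A. \<Sum>b\<in>P a. f a b) = (\<Sum>b\<in>B. \<Sum>a\<in>Q b. f a b)"
proof -
  have "(\<Sum>a\<in>A. \<Sum>b\<in>P a. f a b) = (\<Sum>(a, b)\<in>(SIGMA a:A. P a). f a b)"
    by (rule sum.Sigma) (use assms in auto)
  also have "\<dots> = (\<Sum>(b, a)\<in>(SIGMA b:B. Q b). f a b)"
    by (rule sum.reindex_bij_witness[of _ "\<lambda>(b, a). (a, b)" "\<lambda>(a, b). (b, a)"])
      (use assms(5) in auto)
  also have "\<dots> = (\<Sum>b\<in>B. \<Sum>a\<in>Q b. f a b)"
    by (rule sum.Sigma[symmetric]) (use assms in auto)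
  finally show ?thesis .
qed

lemma finite_insert_diagram: "b \<in> addable D \<Longrightarrow> diagram (insert b D)"
  by (simp add: addable_def)

text \<open>Expand each summand by removing a box. Adding \<open>b\<close> and removing \<open>c \<noteq> b\<close> commute, so these terms
are those of the expansion of \<open>card D * d\<^sub>D\<close>, which the induction hypothesis provides. The terms with
\<open>b = c\<close> number one more on the side of addition, by \<open>card_addable\<close>.\<close>

lemma sum_addable:
  assumes "diagram D"
  shows "(\<Sum>b\<in>addable D. card (tableaux (insert b D))) = Suc (card D) * card (tableaux D)"
  using assms
proof (induction "card D" arbitrary: D rule: less_induct)
  case less
  note D = \<open>diagram D\<close>
  let ?d = "\<lambda>D. card (tableaux D)"
  let ?A = "addable D" and ?R = "removable D"
  have fin: "finite D" by (rule finite_diagram[OF D])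
  have "(\<Sum>b\<in>?A. ?d (insert b D)) = (\<Sum>b\<in>?A. ?d D + (\<Sum>c\<in>removable (insert b D) - {b}. ?d (insert b D - {c})))"
  proof (rule sum.cong[OF refl])
    fix b assume b: "b \<in> ?A"
    then have D': "diagram (insert b D)" and nb: "b \<notin> D" by (auto simp: addable_def)
    have "b \<in> removable (insert b D)" using nb D by (simp add: removable_def)
    then show "?d (insert b D) = ?d D + (\<Sum>c\<in>removable (insert b D) - {b}. ?d (insert b D - {c}))"
      by (subst card_tableaux_removable[OF D'])
        (use nb in \<open>auto simp: sum.remove[OF finite_removable[OF D'], of b]\<close>)
  qed
  also have "\<dots> = card ?A * ?d D + (\<Sum>b\<in>?A. \<Sum>c\<in>removable (insert b D) - {b}. ?d (insert b D - {c}))"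
    by (simp add: sum.distrib)
  also have "(\<Sum>b\<in>?A. \<Sum>c\<in>removable (insert b D) - {b}. ?d (insert b D - {c})) =
    (\<Sum>c\<in>?R. \<Sum>b\<in>addable (D - {c}) - {c}. ?d (insert b D - {c}))"
  proof (rule sum_swap_guarded)
    fix b c
    show "b \<in> ?A \<and> c \<in> removable (insert b D) - {b} \<longleftrightarrow> c \<in> ?R \<and> b \<in> addable (D - {c}) - {c}"
    proof
      assume *: "b \<in> ?A \<and> c \<in> removable (insert b D) - {b}"
      then have 1: "b \<notin> D" "c \<in> D" "b \<noteq> c" "diagram (insert b D - {c})"
        by (auto simp: addable_def removable_def)
      then have "D - {c} = D \<inter> (insert b D - {c})" "insert b (D - {c}) = insert b D - {c}" by auto
      then show "c \<in> ?R \<and> b \<in> addable (D - {c}) - {c}"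
        using 1 diagram_Int[OF D 1(4)] by (simp add: addable_def removable_def)
    next
      assume *: "c \<in> ?R \<and> b \<in> addable (D - {c}) - {c}"
      then have 1: "b \<notin> D" "c \<in> D" "b \<noteq> c" "diagram (insert b (D - {c}))"
        by (auto simp: addable_def removable_def)
      then have "insert b D = D \<union> insert b (D - {c})" "insert b D - {c} = insert b (D - {c})" by auto
      then show "b \<in> ?A \<and> c \<in> removable (insert b D) - {b}"
        using 1 diagram_Un[OF D 1(4)] by (simp add: addable_def removable_def)
    qed
  qed (simp_all add: finite_addable finite_removable[OF D] finite_removable[OF finite_insert_diagram])
  also have "card ?A * ?d D + (\<Sum>c\<in>?R. \<Sum>b\<in>addable (D - {c}) - {c}. ?d (insert b D - {c})) =
    ?d D + (\<Sum>c\<in>?R. ?d D + (\<Sum>b\<in>addable (D - {c}) - {c}. ?d (insert b D - {c})))"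
    by (simp add: card_addable[OF D] sum.distrib)
  also have "(\<Sum>c\<in>?R. ?d D + (\<Sum>b\<in>addable (D - {c}) - {c}. ?d (insert b D - {c}))) =
    (\<Sum>c\<in>?R. \<Sum>b\<in>addable (D - {c}). ?d (insert b (D - {c})))"
  proof (rule sum.cong[OF refl])
    fix c assume c: "c \<in> ?R"
    then have cD: "c \<in> D" by (simp add: removable_def)
    have "c \<in> addable (D - {c})" using cD D by (simp add: addable_def insert_absorb)
    then have "(\<Sum>b\<in>addable (D - {c}). ?d (insert b (D - {c}))) =
      ?d (insert c (D - {c})) + (\<Sum>b\<in>addable (D - {c}) - {c}. ?d (insert b (D - {c})))"
      by (rule sum.remove[OF finite_addable])
    moreover have "insert c (D - {c}) = D" using cD by auto
    moreover have "(\<Sum>b\<in>addable (D - {c}) - {c}. ?d (insert b (D - {c}))) =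
      (\<Sum>b\<in>addable (D - {c}) - {c}. ?d (insert b D - {c}))"
      by (rule sum.cong[OF refl]) (auto intro!: arg_cong[of _ _ "\<lambda>D. card (tableaux D)"])
    ultimately show "?d D + (\<Sum>b\<in>addable (D - {c}) - {c}. ?d (insert b D - {c})) =
      (\<Sum>b\<in>addable (D - {c}). ?d (insert b (D - {c})))" by simp
  qed
  also have "\<dots> = (\<Sum>c\<in>?R. card D * ?d (D - {c}))"
  proof (rule sum.cong[OF refl])
    fix c assume c: "c \<in> ?R"
    then have "card D = Suc (card (D - {c}))" "diagram (D - {c})"
      using card_removable D by (auto simp: removable_def)
    then show "(\<Sum>b\<in>addable (D - {c}). ?d (insert b (D - {c}))) = card D * ?d (D - {c})"
      using less(1) by simp
  qed
  also have "\<dots> = card D * ?d D"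
  proof (cases "D = {}")
    case False
    then show ?thesis by (simp add: card_tableaux_removable[OF D] sum_distrib_left)
  qed (simp add: removable_def)
  finally show ?case by simp
qed

lemma tableaux_empty: "tableaux {} = {\<lambda>_. 0}"
  by (auto simp: tableaux_def bij_betw_def)

theorem sum_card_tableaux_squares:
  "(\<Sum>D | diagram D \<and> card D = n. (card (tableaux D))\<^sup>2) = fact n"
proof (induction n)
  case 0
  have "{D. diagram D \<and> card D = 0} = {{}}"
    using finite_diagram by (auto simp: diagram_def)
  then show ?case by (simp add: tableaux_empty)
next
  case (Suc n)
  let ?d = "\<lambda>D. card (tableaux D)"
  have "(\<Sum>D | diagram D \<and> card D = Suc n. (?d D)\<^sup>2) =
    (\<Sum>D | diagram D \<and> card D = Suc n. \<Sum>b\<in>removable D. ?d D * ?d (D - {b}))"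
  proof (rule sum.cong[OF refl], clarify)
    fix D :: "(nat \<times> nat) set" assume D: "diagram D" "card D = Suc n"
    then have "D \<noteq> {}" by auto
    then have "?d D = (\<Sum>b\<in>removable D. ?d (D - {b}))" by (rule card_tableaux_removable[OF D(1)])
    then show "(?d D)\<^sup>2 = (\<Sum>b\<in>removable D. ?d D * ?d (D - {b}))"
      by (simp add: power2_eq_square sum_distrib_left)
  qed
  also have "\<dots> = (\<Sum>(D, b)\<in>(SIGMA D:{D. diagram D \<and> card D = Suc n}. removable D).
      ?d D * ?d (D - {b}))"
    by (rule sum.Sigma) (auto simp: finite_diagrams finite_removable)
  also have "\<dots> = (\<Sum>(D, b)\<in>(SIGMA D:{D. diagram D \<and> card D = n}. addable D).
      ?d (insert b D) * ?d D)"
  proof (rule sum.reindex_bij_witness[of _ "\<lambda>(D, b). (insert b D, b)" "\<lambda>(D, b). (D - {b}, b)"], goal_cases)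
    case (2 a)
    then show ?case by (auto simp: removable_def addable_def insert_absorb finite_diagram)
  next
    case (4 b)
    then show ?case by (auto simp: removable_def addable_def insert_absorb finite_diagram)
  qed (auto simp: removable_def addable_def insert_absorb)
  also have "\<dots> = (\<Sum>D | diagram D \<and> card D = n. \<Sum>b\<in>addable D. ?d (insert b D) * ?d D)"
    by (rule sum.Sigma[symmetric]) (auto simp: finite_diagrams finite_addable)
  also have "\<dots> = (\<Sum>D | diagram D \<and> card D = n. Suc n * (?d D)\<^sup>2)"
  proof (rule sum.cong[OF refl], clarify)
    fix D :: "(nat \<times> nat) set" assume D: "diagram D" "n = card D"
    have "(\<Sum>b\<in>addable D. ?d (insert b D) * ?d D) = (\<Sum>b\<in>addable D. ?d (insert b D)) * ?d D"
      by (simp add: sum_distrib_right)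
    then show "(\<Sum>b\<in>addable D. ?d (insert b D) * ?d D) = Suc (card D) * (?d D)\<^sup>2"
      by (simp only: sum_addable[OF D(1)] power2_eq_square mult.assoc)
  qed
  also have "\<dots> = Suc n * fact n" unfolding sum_distrib_left[symmetric] Suc by simp
  also have "\<dots> = fact (Suc n)" by simp
  finally show ?case .
qed

section \<open>Reading tableaux and connectivity under exchanges of consecutive entries\<close>

text \<open>Numbers the boxes of \<open>D\<close> in the order of an injective key.\<close>

definition rank_tableau :: "(nat \<times> nat \<Rightarrow> nat) \<Rightarrow> (nat \<times> nat) set \<Rightarrow> tableau" where
  "rank_tableau key D b = (if b \<in> D then card {b' \<in> D. key b' \<le> key b} else 0)"

lemma rank_less:
  fixes key :: "'a \<Rightarrow> nat"
  assumes D: "finite D" and b: "b \<in> D" "b' \<in> D"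
  shows "card {x \<in> D. key x \<le> key b'} < card {x \<in> D. key x \<le> key b} \<longleftrightarrow> key b' < key b"
proof -
  have *: "card {x \<in> D. key x \<le> key c'} < card {x \<in> D. key x \<le> key c}"
    if "key c' < key c" "c \<in> D" for c c'
  proof (rule psubset_card_mono)
    have "c \<in> {x \<in> D. key x \<le> key c}" "c \<notin> {x \<in> D. key x \<le> key c'}" using that by auto
    moreover have "{x \<in> D. key x \<le> key c'} \<subseteq> {x \<in> D. key x \<le> key c}" using that by auto
    ultimately show "{x \<in> D. key x \<le> key c'} \<subset> {x \<in> D. key x \<le> key c}" by blast
  qed (use D in simp)
  show ?thesis
  proof
    assume l: "card {x \<in> D. key x \<le> key b'} < card {x \<in> D. key x \<le> key b}"
    show "key b' < key b"
    proof (rule ccontr)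
      assume "\<not> key b' < key b"
      then have "key b < key b' \<or> key b = key b'" by linarith
      then show False using *[of b b'] l b by auto
    qed
  qed (use * b in simp)
qed

lemma rank_tableau_standard:
  assumes D: "diagram D" and inj: "inj_on key D"
    and row: "\<And>u v w. v < w \<Longrightarrow> (u, w) \<in> D \<Longrightarrow> key (u, v) < key (u, w)"
    and col: "\<And>u v w. u < w \<Longrightarrow> (w, v) \<in> D \<Longrightarrow> key (u, v) < key (w, v)"
  shows "rank_tableau key D \<in> tableaux D"
    and "b \<in> D \<Longrightarrow> b' \<in> D \<Longrightarrow> rank_tableau key D b' < rank_tableau key D b \<longleftrightarrow> key b' < key b"
proof -
  let ?T = "rank_tableau key D"
  have fin: "finite D" by (rule finite_diagram[OF D])
  have less: "?T b' < ?T b \<longleftrightarrow> key b' < key b" if "b \<in> D" "b' \<in> D" for b b'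
    using rank_less[OF fin that] that by (simp add: rank_tableau_def)
  then show "b \<in> D \<Longrightarrow> b' \<in> D \<Longrightarrow> ?T b' < ?T b \<longleftrightarrow> key b' < key b" by blast
  have "inj_on ?T D"
  proof (rule inj_onI)
    fix b b' assume *: "b \<in> D" "b' \<in> D" "?T b = ?T b'"
    then have "\<not> key b < key b'" "\<not> key b' < key b" using less by (metis less_irrefl)+
    then have "key b = key b'" by linarith
    then show "b = b'" using inj_onD[OF inj _ *(1,2)] by blast
  qed
  moreover have "?T ` D \<subseteq> {1..card D}"
  proof
    fix i assume "i \<in> ?T ` D"
    then obtain b where b: "b \<in> D" "i = card {b' \<in> D. key b' \<le> key b}"
      by (auto simp: rank_tableau_def)
    have "card {b} \<le> i" unfolding b(2) by (rule card_mono) (use fin b in auto)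
    moreover have "i \<le> card D" unfolding b(2) by (rule card_mono) (use fin in auto)
    ultimately show "i \<in> {1..card D}" by simp
  qed
  ultimately have "bij_betw ?T D {1..card D}"
    by (simp add: bij_betw_def card_image card_subset_eq)
  moreover have "?T (u, v) < ?T (u, w)" if "v < w" "(u, w) \<in> D" for u v w
    using less[of "(u, w)" "(u, v)"] row[OF that] diagramD[OF D that(2), of u v] that by simp
  moreover have "?T (u, v) < ?T (w, v)" if "u < w" "(w, v) \<in> D" for u v w
    using less[of "(w, v)" "(u, v)"] col[OF that] diagramD[OF D that(2), of u v] that by simp
  ultimately show "?T \<in> tableaux D"
    unfolding tableaux_def by (intro CollectI conjI) (auto simp: rank_tableau_def)
qed

lemma lex_key_less:
  fixes N :: nat
  assumes "v < N" "v' < N"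
  shows "u * N + v < u' * N + v' \<longleftrightarrow> u < u' \<or> u = u' \<and> v < v'"
proof -
  have *: "a * N + x < a' * N + x'" if "a < a'" "x < N" for a a' x x'
  proof -
    have "a * N + x < Suc a * N" using that by simp
    also have "\<dots> \<le> a' * N" using that by (intro mult_le_mono1) simp
    finally show ?thesis by simp
  qed
  show ?thesis using *[of u u' v v'] *[of u' u v' v] assms by (cases u u' rule: linorder_cases) auto
qed

lemma row_reading_tableau:
  assumes D: "diagram D"
  obtains T where "T \<in> tableaux D"
    "\<And>u v u' v'. (u, v) \<in> D \<Longrightarrow> (u', v') \<in> D \<Longrightarrow>
      T (u', v') < T (u, v) \<longleftrightarrow> u' < u \<or> u' = u \<and> v' < v"
proof -
  define key where "key b = fst b * card D + snd b" for b :: "nat \<times> nat"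
  have less: "key (u', v') < key (u, v) \<longleftrightarrow> u' < u \<or> u' = u \<and> v' < v"
    if "(u, v) \<in> D" "(u', v') \<in> D" for u v u' v'
    using lex_key_less[of v' "card D" v u' u] diagram_bounded[OF D that(1)]
      diagram_bounded[OF D that(2)] by (simp add: key_def)
  have inj: "inj_on key D"
  proof (rule inj_onI)
    fix b b' assume *: "b \<in> D" "b' \<in> D" "key b = key b'"
    obtain u v u' v' where uv: "b = (u, v)" "b' = (u', v')" by (metis surj_pair)
    show "b = b'" using less[of u v u' v'] less[of u' v' u v] * uv by auto
  qed
  have 1: "key (u, v) < key (u, w)" if "v < w" "(u, w) \<in> D" for u v w
    using that by (simp add: key_def)
  have 2: "key (u, v) < key (w, v)" if "u < w" "(w, v) \<in> D" for u v w
    using less[of w v u v] diagramD[OF D that(2), of u v] that by simp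
  note rank = rank_tableau_standard[OF D inj 1 2]
  show ?thesis using that[of "rank_tableau key D"] rank less by auto
qed

lemma col_reading_tableau:
  assumes D: "diagram D"
  obtains T where "T \<in> tableaux D"
    "\<And>u v u' v'. (u, v) \<in> D \<Longrightarrow> (u', v') \<in> D \<Longrightarrow>
      T (u', v') < T (u, v) \<longleftrightarrow> v' < v \<or> v' = v \<and> u' < u"
proof -
  define key where "key b = snd b * card D + fst b" for b :: "nat \<times> nat"
  have less: "key (u', v') < key (u, v) \<longleftrightarrow> v' < v \<or> v' = v \<and> u' < u"
    if "(u, v) \<in> D" "(u', v') \<in> D" for u v u' v'
    using lex_key_less[of u' "card D" u v' v] diagram_bounded[OF D that(1)]
      diagram_bounded[OF D that(2)] by (simp add: key_def)
  have inj: "inj_on key D"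
  proof (rule inj_onI)
    fix b b' assume *: "b \<in> D" "b' \<in> D" "key b = key b'"
    obtain u v u' v' where uv: "b = (u, v)" "b' = (u', v')" by (metis surj_pair)
    show "b = b'" using less[of u v u' v'] less[of u' v' u v] * uv by auto
  qed
  have 1: "key (u, v) < key (u, w)" if "v < w" "(u, w) \<in> D" for u v w
    using less[of u w u v] diagramD[OF D that(2), of u v] that by simp
  have 2: "key (u, v) < key (w, v)" if "u < w" "(w, v) \<in> D" for u v w
    using that by (simp add: key_def)
  note rank = rank_tableau_standard[OF D inj 1 2]
  show ?thesis using that[of "rank_tableau key D"] rank less by auto
qed

lemma tableaux_nonempty: "diagram D \<Longrightarrow> tableaux D \<noteq> {}"
  by (metis row_reading_tableau empty_iff)

definition entry_swap :: "(nat \<times> nat) set \<Rightarrow> tableau \<Rightarrow> tableau \<Rightarrow> bool" where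
  "entry_swap D T T' \<longleftrightarrow> T \<in> tableaux D \<and> T' \<in> tableaux D \<and>
     (\<exists>i. 1 \<le> i \<and> Suc i \<le> card D \<and> T' = swap_entries i (Suc i) T)"

lemma entry_swap_extend:
  assumes D: "diagram D" and b: "b \<in> removable D" and s: "entry_swap (D - {b}) T T'"
  shows "entry_swap D (T(b := card D)) (T'(b := card D))"
proof -
  obtain i where i: "1 \<le> i" "Suc i \<le> card (D - {b})" "T' = swap_entries i (Suc i) T"
    and T: "T \<in> tableaux (D - {b})" "T' \<in> tableaux (D - {b})"
    using s by (auto simp: entry_swap_def)
  have c: "Suc i < card D" using i card_removable[OF b D] by simp
  then have "T'(b := card D) = swap_entries i (Suc i) (T(b := card D))"
    unfolding i(3) swap_entries_def by (auto simp: fun_eq_iff)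
  then show ?thesis
    unfolding entry_swap_def using extend_tableau(1)[OF D b] T i(1) c by (meson less_imp_le)
qed

text \<open>Let the largest entry \<open>n\<close> lie in \<open>b\<close> for one tableau and in \<open>b'\<close> for the other. If \<open>b = b'\<close>, delete
it and use induction. Otherwise pass through a tableau with \<open>n\<close> in \<open>b\<close> and \<open>n - 1\<close> in \<open>b'\<close>, exchange
the two, and use the first case on both sides.\<close>

lemma entry_swap_connected:
  assumes "diagram D" "T \<in> tableaux D" "T' \<in> tableaux D"
  shows "(entry_swap D)\<^sup>*\<^sup>* T T'"
  using assms
proof (induction "card D" arbitrary: D T T' rule: less_induct)
  case less
  note D = \<open>diagram D\<close>
  have lift: "(entry_swap D)\<^sup>*\<^sup>* U U'"
    if U: "U \<in> tableaux D" "U' \<in> tableaux D" and ne: "D \<noteq> {}"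
      and eq: "box_of U (card D) = box_of U' (card D)" for U U'
  proof -
    define b where "b = box_of U (card D)"
    note l = largest_entry[OF D U(1) ne, folded b_def]
    note l' = largest_entry[OF D U(2) ne, folded eq, folded b_def]
    have D': "diagram (D - {b})" using l(1) by (simp add: removable_def)
    have "card (D - {b}) < card D" using card_removable[OF l(1) D] by simp
    from less(1)[OF this D' l(2) l'(2)]
    have "(entry_swap D)\<^sup>*\<^sup>* ((U(b := 0))(b := card D)) ((U'(b := 0))(b := card D))"
    proof (induction rule: rtranclp_induct)
      case (step y z)
      from this(3) entry_swap_extend[OF D l(1) this(2)] show ?case by (meson rtranclp.rtrancl_into_rtrancl)
    qed simp
    moreover have "(U(b := 0))(b := card D) = U" "(U'(b := 0))(b := card D) = U'"
      using l(3) l'(3) by auto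
    ultimately show ?thesis by simp
  qed
  show ?case
  proof (cases "D = {}")
    case True
    then show ?thesis using less.prems by (simp add: tableaux_empty)
  next
    case ne: False
    define b b' where "b = box_of T (card D)" and "b' = box_of T' (card D)"
    note l = largest_entry[OF D less.prems(2) ne, folded b_def]
    note l' = largest_entry[OF D less.prems(3) ne, folded b'_def]
    show ?thesis
    proof (cases "b = b'")
      case True
      then show ?thesis using lift[OF less.prems(2,3) ne] by (simp add: b_def b'_def)
    next
      case False
      have Db: "diagram (D - {b})" "diagram (D - {b'})" "b \<in> D" "b' \<in> D"
        using l(1) l'(1) by (auto simp: removable_def)
      have e: "D - {b} - {b'} = (D - {b}) \<inter> (D - {b'})" "D - {b'} - {b} = D - {b} - {b'}" by auto
      then have D0: "diagram (D - {b} - {b'})" using diagram_Int[OF Db(1,2)] by simp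
      have r: "b' \<in> removable (D - {b})" "b \<in> removable (D - {b'})"
        using D0 Db False e by (auto simp: removable_def)
      obtain U where U: "U \<in> tableaux (D - {b} - {b'})" using tableaux_nonempty[OF D0] by blast
      define m where "m = card (D - {b})"
      have m: "card D = Suc m" "card (D - {b}) = m" "card (D - {b'}) = m"
        using card_removable[OF l(1) D] card_removable[OF l'(1) D] by (simp_all add: m_def)
      have m1: "1 \<le> m" using card_removable[OF r(1) Db(1)] m by simp
      \<comment> \<open>Both agree with \<open>U\<close> elsewhere and differ by exchanging the two largest entries.\<close>
      let ?U1 = "(U(b' := m))(b := Suc m)" and ?U2 = "(U(b := m))(b' := Suc m)"
      have U1: "?U1 \<in> tableaux D" "box_of ?U1 (card D) = b"
        using extend_tableau[OF D l(1) extend_tableau(1)[OF Db(1) r(1) U]] m by simp_all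
      have U2: "?U2 \<in> tableaux D" "box_of ?U2 (card D) = b'"
        using extend_tableau[OF D l'(1) extend_tableau(1)[OF Db(2) r(2)]] U e(2) m by simp_all
      have small: "U x < m" for x
        using tableaux_range[OF U, of x] tableaux_zero[OF U, of x] m1
          card_removable[OF r(1) Db(1)] m(2) by (cases "x \<in> D - {b} - {b'}") auto
      have "?U2 = swap_entries m (Suc m) ?U1"
      proof
        fix x
        show "?U2 x = swap_entries m (Suc m) ?U1 x"
          using small[of x] False by (auto simp: swap_entries_def)
      qed
      then have "entry_swap D ?U1 ?U2" unfolding entry_swap_def using U1(1) U2(1) m m1 by auto
      moreover have "(entry_swap D)\<^sup>*\<^sup>* T ?U1"
        using lift[OF less.prems(2) U1(1) ne] U1(2) by (simp add: b_def)
      moreover have "(entry_swap D)\<^sup>*\<^sup>* ?U2 T'"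
        using lift[OF U2(1) less.prems(3) ne] U2(2) by (simp add: b'_def)
      ultimately show ?thesis by (meson rtranclp.rtrancl_into_rtrancl rtranclp_trans)
    qed
  qed
qed

section \<open>Young symmetrizers as functions on the symmetric group\<close>

text \<open>For the row (column) numbers of a labelled diagram this is the group of row (column)
permutations.\<close>

definition stab :: "'a set \<Rightarrow> ('a \<Rightarrow> nat) \<Rightarrow> ('a \<Rightarrow> 'a) set" where
  "stab A f = {p. p permutes A \<and> (\<forall>x. f (p x) = f x)}"

text \<open>The coefficient of \<open>g\<close> in the group algebra element \<open>(\<Sum>p. p) (\<Sum>q. sign q * q)\<close>, with \<open>p\<close> a row and
\<open>q\<close> a column permutation.\<close>

definition young_symmetrizer :: "'a set \<Rightarrow> ('a \<Rightarrow> nat) \<Rightarrow> ('a \<Rightarrow> nat) \<Rightarrow> ('a \<Rightarrow> 'a) \<Rightarrow> real" where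
  "young_symmetrizer A r c g =
     (\<Sum>p\<in>stab A r. \<Sum>q\<in>stab A c. if g = p \<circ> q then of_int (sign q) else 0)"

lemma stab_permutes: "p \<in> stab A f \<Longrightarrow> p permutes A"
  by (simp add: stab_def)

lemma stab_id: "id \<in> stab A f"
  by (simp add: stab_def permutes_id)

lemma stab_comp: "p \<in> stab A f \<Longrightarrow> q \<in> stab A f \<Longrightarrow> p \<circ> q \<in> stab A f"
  by (simp add: stab_def permutes_compose)

lemma stab_inv: "p \<in> stab A f \<Longrightarrow> inv' p \<in> stab A f"
proof -
  assume p: "p \<in> stab A f"
  then have pp: "p permutes A" and f: "f (p x) = f x" for x by (simp_all add: stab_def)
  have "f (inv' p x) = f x" for x
    using f[of "inv' p x"] permutes_inverses(1)[OF pp, of x] by simp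
  then show ?thesis using permutes_inv[OF pp] by (simp add: stab_def)
qed

lemma stab_transpose: "x \<in> A \<Longrightarrow> y \<in> A \<Longrightarrow> f x = f y \<Longrightarrow> Transposition.transpose x y \<in> stab A f"
  by (auto simp: stab_def permutes_swap_id Transposition.transpose_def)

lemma finite_stab: "finite A \<Longrightarrow> finite (stab A f)"
  by (rule finite_subset[OF _ finite_permutations[of A]]) (auto simp: stab_def)

lemma comp_transpose:
  assumes "inj g"
  shows "g \<circ> Transposition.transpose x y = Transposition.transpose (g x) (g y) \<circ> g"
  using assms by (auto simp: fun_eq_iff Transposition.transpose_def inj_eq)

lemma permutes_transpose_comp:
  "g permutes A \<Longrightarrow> x \<in> A \<Longrightarrow> y \<in> A \<Longrightarrow> Transposition.transpose x y \<circ> g permutes A"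
  "g permutes A \<Longrightarrow> x \<in> A \<Longrightarrow> y \<in> A \<Longrightarrow> g \<circ> Transposition.transpose x y permutes A"
  by (simp_all add: permutes_compose permutes_swap_id)

text \<open>Labels placed in row \<open>r\<close> and column \<open>c\<close>. The axioms are symmetric in \<open>r\<close> and \<open>c\<close>, so that
transposing a diagram is exchanging the two parameters.\<close>

locale labelled_diagram =
  fixes A :: "'a set" and r c :: "'a \<Rightarrow> nat"
  assumes finite: "finite A"
    and inj: "\<And>x y. x \<in> A \<Longrightarrow> y \<in> A \<Longrightarrow> r x = r y \<Longrightarrow> c x = c y \<Longrightarrow> x = y"
    and row_closed: "\<And>x w. x \<in> A \<Longrightarrow> w < c x \<Longrightarrow> \<exists>y\<in>A. r y = r x \<and> c y = w"
    and col_closed: "\<And>x w. x \<in> A \<Longrightarrow> w < r x \<Longrightarrow> \<exists>y\<in>A. c y = c x \<and> r y = w"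
begin

abbreviation "ys \<equiv> young_symmetrizer A r c"

lemma permutation: "p permutes A \<Longrightarrow> permutation p"
  using finite permutation_permutes by blast

lemma transposed: "labelled_diagram A c r"
  by unfold_locales (use finite inj row_closed col_closed in \<open>simp_all\<close>)

lemma ys_row_invariant:
  assumes p: "p \<in> stab A r"
  shows "ys (p \<circ> g) = ys g"
proof -
  have i: "inv' p \<circ> p = id" "p \<circ> inv' p = id" using stab_permutes[OF p] permutes_inv_o by blast+
  have i2: "inv' p \<circ> (p \<circ> k) = k" "p \<circ> (inv' p \<circ> k) = k" for k
    using i by (simp_all add: comp_assoc[symmetric])
  show ?thesis unfolding young_symmetrizer_def
  proof (rule sum.reindex_bij_witness[of _ "\<lambda>k. p \<circ> k" "\<lambda>k. inv' p \<circ> k"])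
    fix a assume "a \<in> stab A r"
    have "p \<circ> g = a \<circ> q \<longleftrightarrow> g = (inv' p \<circ> a) \<circ> q" for q
      using i2 by (metis comp_assoc)
    then show "(\<Sum>q\<in>stab A c. if g = (inv' p \<circ> a) \<circ> q then real_of_int (sign q) else 0) =
      (\<Sum>q\<in>stab A c. if p \<circ> g = a \<circ> q then real_of_int (sign q) else 0)" by simp
  qed (use stab_comp[OF p] stab_comp[OF stab_inv[OF p]] i2 in auto)
qed

lemma ys_column_sign:
  assumes q: "q \<in> stab A c"
  shows "ys (g \<circ> q) = of_int (sign q) * ys g"
proof -
  have i: "inv' q \<circ> q = id" "q \<circ> inv' q = id" using stab_permutes[OF q] permutes_inv_o by blast+
  have i2: "(k \<circ> q) \<circ> inv' q = k" "(k \<circ> inv' q) \<circ> q = k" for k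
    using i by (simp_all add: comp_assoc)
  have "(\<Sum>q'\<in>stab A c. if g \<circ> q = p \<circ> q' then real_of_int (sign q') else 0) =
    (\<Sum>q'\<in>stab A c. if g = p \<circ> q' then of_int (sign q) * of_int (sign q') else 0)" for p
  proof (rule sum.reindex_bij_witness[of _ "\<lambda>k. k \<circ> q" "\<lambda>k. k \<circ> inv' q"])
    fix a assume a: "a \<in> stab A c"
    have "g \<circ> q = p \<circ> a \<longleftrightarrow> g = p \<circ> (a \<circ> inv' q)"
      using i2 by (metis comp_assoc)
    moreover have "sign (a \<circ> inv' q) = sign a * sign q"
      using sign_compose[OF permutation permutation, of a "inv' q"] sign_inverse[OF permutation, of q]
        stab_permutes[OF a] stab_permutes[OF q] stab_permutes[OF stab_inv[OF q]] by simp
    moreover have "sign q * (sign a * sign q) = sign a"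
      using sign_idempotent[of q] by (simp add: mult.left_commute)
    then have "real_of_int (sign q) * (of_int (sign a) * of_int (sign q)) = of_int (sign a)"
      by (metis of_int_mult)
    ultimately show "(if g = p \<circ> (a \<circ> inv' q) then real_of_int (sign q) * of_int (sign (a \<circ> inv' q)) else 0) =
      (if g \<circ> q = p \<circ> a then of_int (sign a) else 0)" by simp
  qed (use stab_comp[OF _ q] stab_comp[OF _ stab_inv[OF q]] i2 in auto)
  then show ?thesis unfolding young_symmetrizer_def
    by (simp add: sum_distrib_left if_distrib cong: if_cong)
qed

text \<open>Inversion exchanges the two factors of the symmetrizer, hence the roles of rows and columns, up to
the sign.\<close>

lemma ys_transposed:
  assumes g: "g permutes A"
  shows "ys g = of_int (sign g) * young_symmetrizer A c r (inv' g)"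
proof -
  have bij: "bij_betw inv' (stab A f) (stab A f)" for f
    by (rule bij_betw_byWitness[of _ inv'])
      (auto simp: image_subset_iff stab_inv permutes_inv_inv[OF stab_permutes])
  have iv: "inv' g = inv' q \<circ> inv' p \<longleftrightarrow> g = p \<circ> q" if "p permutes A" "q permutes A" for p q
  proof -
    have "inv' q \<circ> inv' p = inv' (p \<circ> q)"
      using that permutes_bij o_inv_distrib by metis
    then show ?thesis using that g permutes_inv_inv permutes_compose by metis
  qed
  have "young_symmetrizer A c r (inv' g) =
    (\<Sum>q\<in>stab A c. \<Sum>p\<in>stab A r. if inv' g = inv' q \<circ> inv' p then of_int (sign (inv' p)) else 0)"
    unfolding young_symmetrizer_def
    by (subst sum.reindex_bij_betw[OF bij, symmetric], rule sum.cong[OF refl],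
        subst sum.reindex_bij_betw[OF bij, symmetric], rule refl)
  also have "\<dots> = (\<Sum>q\<in>stab A c. \<Sum>p\<in>stab A r. if g = p \<circ> q then of_int (sign p) else 0)"
    by (intro sum.cong[OF refl]) (simp add: iv stab_permutes sign_inverse permutation)
  finally have "of_int (sign g) * young_symmetrizer A c r (inv' g) =
    (\<Sum>q\<in>stab A c. \<Sum>p\<in>stab A r. of_int (sign g) * (if g = p \<circ> q then of_int (sign p) else 0))"
    by (simp add: sum_distrib_left)
  also have "\<dots> = (\<Sum>q\<in>stab A c. \<Sum>p\<in>stab A r. if g = p \<circ> q then of_int (sign q) else 0)"
  proof (intro sum.cong[OF refl])
    fix q p assume pq: "q \<in> stab A c" "p \<in> stab A r"
    have "sign (p \<circ> q) = sign p * sign q"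
      using sign_compose[OF permutation[OF stab_permutes[OF pq(2)]] permutation[OF stab_permutes[OF pq(1)]]] .
    then have "sign (p \<circ> q) * sign p = (sign p * sign p) * sign q" by simp
    then have "sign (p \<circ> q) * sign p = sign q" by (simp only: sign_idempotent mult_1)
    then show "real_of_int (sign g) * (if g = p \<circ> q then of_int (sign p) else 0) =
      (if g = p \<circ> q then of_int (sign q) else 0)"
      by (cases "g = p \<circ> q") (simp_all flip: of_int_mult)
  qed
  finally show ?thesis unfolding young_symmetrizer_def by (subst sum.swap) simp
qed

lemma ys_id: "ys id = 1"
proof -
  have only: "q = id" if "p \<in> stab A r" "q \<in> stab A c" "id = p \<circ> q" for p q
  proof
    fix x
    have "p (q x) = x" using that(3) by (metis comp_apply id_apply)
    then have "r (q x) = r x" using that(1) by (metis (mono_tags, lifting) mem_Collect_eq stab_def)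
    moreover have "c (q x) = c x" using that(2) by (simp add: stab_def)
    ultimately show "q x = id x"
      using inj[of "q x" x] stab_permutes[OF that(2)] permutes_in_image permutes_not_in
      by (metis id_apply)
  qed
  have "ys id = (\<Sum>p\<in>stab A r. \<Sum>q\<in>stab A c. if p = id \<and> q = id then 1 else 0)"
    unfolding young_symmetrizer_def
  proof (intro sum.cong[OF refl])
    fix p q assume pq: "p \<in> stab A r" "q \<in> stab A c"
    show "(if id = p \<circ> q then real_of_int (sign q) else 0) = (if p = id \<and> q = id then 1 else 0)"
    proof (cases "id = p \<circ> q")
      case True
      then have "q = id" using only pq by blast
      moreover from this have "p = id" using True by simp
      ultimately show ?thesis by (simp add: sign_id)
    qed auto
  qed
  also have "\<dots> = (\<Sum>p\<in>stab A r. if p = id then 1 else 0)"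
    by (rule sum.cong[OF refl]) (simp add: sum.delta finite_stab[OF finite] stab_id)
  also have "\<dots> = 1" by (simp add: finite_stab[OF finite] stab_id)
  finally show ?thesis .
qed

lemma ys_support:
  assumes "ys g \<noteq> 0"
  obtains p q where "p \<in> stab A r" "q \<in> stab A c" "g = p \<circ> q"
proof -
  from assms obtain p where p: "p \<in> stab A r"
      "(\<Sum>q\<in>stab A c. if g = p \<circ> q then real_of_int (sign q) else 0) \<noteq> 0"
    unfolding young_symmetrizer_def using sum.not_neutral_contains_not_neutral by blast
  from p(2) obtain q where "q \<in> stab A c" "(if g = p \<circ> q then real_of_int (sign q) else 0) \<noteq> 0"
    using sum.not_neutral_contains_not_neutral by blast
  then show ?thesis using that p(1) by metis
qed

text \<open>The transposition of \<open>x\<close> and \<open>y\<close> on the right changes the sign, but it equals a row permutation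
applied on the left, which changes nothing.\<close>

lemma ys_zero:
  assumes g: "g permutes A" and xy: "x \<in> A" "y \<in> A" "x \<noteq> y" "c x = c y" "r (g x) = r (g y)"
  shows "ys g = 0"
proof -
  have "ys g = ys (Transposition.transpose (g x) (g y) \<circ> g)"
    using ys_row_invariant[OF stab_transpose[of "g x" A "g y" r]] xy permutes_in_image[OF g] by simp
  also have "\<dots> = ys (g \<circ> Transposition.transpose x y)"
    by (simp add: comp_transpose[OF permutes_inj[OF g]])
  also have "\<dots> = - ys g"
    using ys_column_sign[OF stab_transpose[of x A y c]] xy by (simp add: sign_swap_id)
  finally show ?thesis by simp
qed

lemma ys_row_swap:
  assumes g: "g permutes A" and xy: "x \<in> A" "y \<in> A" "r (g x) = r (g y)"
  shows "ys (g \<circ> Transposition.transpose x y) = ys g"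
  using ys_row_invariant[OF stab_transpose[of "g x" A "g y" r]] xy permutes_in_image[OF g]
  by (simp add: comp_transpose[OF permutes_inj[OF g]])

text \<open>In the support \<open>g = p \<circ> q\<close>, the rows of the values of \<open>g\<close> on a column are a permutation of the rows
of that column, and a column has every row that occurs in the columns to its right.\<close>

lemma ys_partner:
  assumes "ys g \<noteq> 0" and x: "x \<in> A" "w < c x"
  obtains y where "y \<in> A" "c y = w" "r (g y) = r (g x)"
proof -
  obtain p q where pq: "p \<in> stab A r" "q \<in> stab A c" "g = p \<circ> q" using ys_support[OF assms(1)] .
  have qx: "q x \<in> A" "c (q x) = c x"
    using pq(2) x permutes_in_image by (fastforce simp: stab_def)+
  then obtain m where m: "m \<in> A" "r m = r (q x)" "c m = w" using row_closed x by metis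
  have i: "q (inv' q m) = m" using permutes_inverses(1)[OF stab_permutes[OF pq(2)]] .
  have "inv' q m \<in> A" using m permutes_in_image[OF permutes_inv[OF stab_permutes[OF pq(2)]]] by simp
  moreover have "c (inv' q m) = w" using stab_inv[OF pq(2)] m(3) by (simp add: stab_def)
  moreover have "r (g (inv' q m)) = r (g x)" using pq(1) m(2) i by (simp add: pq(3) stab_def)
  ultimately show ?thesis using that by blast
qed

text \<open>In the support of the symmetrizer exactly one \<open>y\<close> in column \<open>w\<close> has its value in the same row as that
of \<open>x\<close>. Exchanging these two values is a row permutation, and every other exchange puts two values of
one row into column \<open>w\<close>. Outside the support at most two summands survive, and they cancel.\<close>

lemma garnir:
  assumes g: "g permutes A" and x: "x \<in> A" "w < c x"
  shows "(\<Sum>y | y \<in> A \<and> c y = w. ys (g \<circ> Transposition.transpose y x)) = ys g"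
proof -
  let ?C = "{y. y \<in> A \<and> c y = w}"
  have fin: "finite ?C" using finite by simp
  have xC: "x \<notin> ?C" using x by simp
  have perm: "g \<circ> Transposition.transpose z x permutes A" if "z \<in> ?C" for z
    using permutes_transpose_comp(2)[OF g] that x by simp
  show ?thesis
  proof (cases "ys g = 0")
    case False
    \<comment> \<open>\<open>y\<close> is the only label of column \<open>w\<close> whose summand survives.\<close>
    then obtain y where y: "y \<in> A" "c y = w" "r (g y) = r (g x)" using ys_partner[OF _ x] by metis
    have "ys (g \<circ> Transposition.transpose z x) = 0" if z: "z \<in> ?C - {y}" for z
      by (rule ys_zero[OF perm, of z z y]) (use z y xC in \<open>auto simp: Transposition.transpose_def\<close>)
    then have "(\<Sum>z\<in>?C. ys (g \<circ> Transposition.transpose z x)) = ys (g \<circ> Transposition.transpose y x)"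
      by (subst sum.remove[OF fin, of y]) (use y in auto)
    then show ?thesis using ys_row_swap[OF g y(1) x(1) y(3)] by simp
  next
    case True
    show ?thesis
    proof (cases "\<forall>y\<in>?C. ys (g \<circ> Transposition.transpose y x) = 0")
      case all: True
      then show ?thesis using True by simp
    next
      case False
      then obtain y where y: "y \<in> A" "c y = w" "ys (g \<circ> Transposition.transpose y x) \<noteq> 0" by auto
      \<comment> \<open>The summands of \<open>y\<close> and of the partner \<open>y'\<close> of \<open>x\<close> with respect to \<open>h\<close> are the two that cancel.\<close>
      define h where "h = g \<circ> Transposition.transpose y x"
      have h: "h permutes A" unfolding h_def using perm y by simp
      have gh: "g = h \<circ> Transposition.transpose y x" unfolding h_def by (simp add: comp_assoc)
      obtain y' where y': "y' \<in> A" "c y' = w" "r (h y') = r (h x)"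
        using ys_partner[OF y(3) x] unfolding h_def by metis
      have ne: "y \<noteq> y'"
        using ys_row_swap[OF h y'(1) x(1) y'(3)] True y(3) unfolding gh[symmetric] h_def[symmetric]
        by (auto simp: gh)
      have nx: "y \<noteq> x" "y' \<noteq> x" using y y' x by auto
      have "ys (g \<circ> Transposition.transpose z x) = 0" if z: "z \<in> ?C - {y} - {y'}" for z
        by (rule ys_zero[OF perm, of z y y'])
          (use z y y' xC ne nx in \<open>auto simp: Transposition.transpose_def gh\<close>)
      then have "(\<Sum>z\<in>?C. ys (g \<circ> Transposition.transpose z x)) =
        ys h + ys (g \<circ> Transposition.transpose y' x)"
        by (subst sum.remove[OF fin, of y], use y in simp,
            subst sum.remove[of _ y'], use fin y' ne in \<open>auto simp: h_def\<close>)
      moreover have "g \<circ> Transposition.transpose y' x =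
          (h \<circ> Transposition.transpose y' x) \<circ> Transposition.transpose y y'"
        unfolding gh using ne nx by (auto simp: fun_eq_iff Transposition.transpose_def)
      then have "ys (g \<circ> Transposition.transpose y' x) = - ys h"
        using ys_column_sign[OF stab_transpose[of y A y' c], of "h \<circ> Transposition.transpose y' x"]
          ys_row_swap[OF h y'(1) x(1) y'(3)] y y' ne by (simp add: sign_swap_id)
      ultimately show ?thesis using True by simp
    qed
  qed
qed

text \<open>In the order that reads the diagram column by column, the predecessors of \<open>x\<close> are the \<open>c x\<close> columns
to its left, each contributing \<open>1\<close> by \<open>garnir\<close>, and the \<open>r x\<close> boxes above it, each contributing
\<open>- 1\<close> by antisymmetry.\<close>

lemma jucys_murphy_right:
  assumes g: "g permutes A" and x: "x \<in> A"
  shows "(\<Sum>y | y \<in> A \<and> (c y < c x \<or> c y = c x \<and> r y < r x). ys (g \<circ> Transposition.transpose y x)) =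
    (real (c x) - real (r x)) * ys g"
proof -
  let ?f = "\<lambda>y. ys (g \<circ> Transposition.transpose y x)"
  let ?B = "{y. y \<in> A \<and> c y = c x \<and> r y < r x}"
  have e: "{y. y \<in> A \<and> (c y < c x \<or> c y = c x \<and> r y < r x)} =
    (\<Union>w\<in>{..<c x}. {y. y \<in> A \<and> c y = w}) \<union> ?B" by auto
  have "(\<Sum>y\<in>(\<Union>w\<in>{..<c x}. {y. y \<in> A \<and> c y = w}). ?f y) =
    (\<Sum>w<c x. \<Sum>y | y \<in> A \<and> c y = w. ?f y)"
    by (rule sum.UNION_disjoint) (use finite in auto)
  also have "\<dots> = real (c x) * ys g" using garnir[OF g x] by simp
  finally have 1: "(\<Sum>y\<in>(\<Union>w\<in>{..<c x}. {y. y \<in> A \<and> c y = w}). ?f y) = real (c x) * ys g" .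
  have "?f y = - ys g" if "y \<in> ?B" for y
    using ys_column_sign[OF stab_transpose[of y A x c], of g] that x by (auto simp: sign_swap_id)
  then have "sum ?f ?B = - real (card ?B) * ys g" by simp
  moreover have "bij_betw r ?B {..<r x}"
    unfolding bij_betw_def
  proof
    show "inj_on r ?B" using inj by (auto simp: inj_on_def)
    show "r ` ?B = {..<r x}"
    proof (intro equalityI subsetI)
      fix w assume "w \<in> {..<r x}"
      then obtain y where "y \<in> A" "c y = c x" "r y = w" using col_closed[OF x, of w] by auto
      then show "w \<in> r ` ?B" using \<open>w \<in> {..<r x}\<close> by (intro image_eqI[of _ _ y]) auto
    qed auto
  qed
  then have "card ?B = r x" using bij_betw_same_card by fastforce
  ultimately have 2: "sum ?f ?B = - real (r x) * ys g" by simp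
  show ?thesis unfolding e
    by (subst sum.union_disjoint) (use finite 1 2 in \<open>auto simp: algebra_simps\<close>)
qed

text \<open>The mirror image of \<open>jucys_murphy_right\<close>, reading row by row.\<close>

lemma jucys_murphy_left:
  assumes g: "g permutes A" and x: "x \<in> A"
  shows "(\<Sum>y | y \<in> A \<and> (r y < r x \<or> r y = r x \<and> c y < c x). ys (Transposition.transpose y x \<circ> g)) =
    (real (c x) - real (r x)) * ys g"
proof -
  interpret t: labelled_diagram A c r by (rule transposed)
  have "ys (Transposition.transpose y x \<circ> g) =
    - of_int (sign g) * t.ys (inv' g \<circ> Transposition.transpose y x)" if y: "y \<in> A" "y \<noteq> x" for y
  proof -
    have "sign (Transposition.transpose y x \<circ> g) = - sign g"
      using sign_compose[OF permutation_swap_id permutation[OF g], of y x] y by (simp add: sign_swap_id)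
    moreover have "inv' (Transposition.transpose y x \<circ> g) = inv' g \<circ> Transposition.transpose y x"
      using o_inv_distrib[OF bij_transpose permutes_bij[OF g]] by simp
    ultimately show ?thesis
      using ys_transposed[OF permutes_transpose_comp(1)[OF g y(1) x]] by simp
  qed
  then have "(\<Sum>y | y \<in> A \<and> (r y < r x \<or> r y = r x \<and> c y < c x). ys (Transposition.transpose y x \<circ> g)) =
    - of_int (sign g) * (\<Sum>y | y \<in> A \<and> (r y < r x \<or> r y = r x \<and> c y < c x). t.ys (inv' g \<circ> Transposition.transpose y x))"
    by (subst sum_distrib_left, intro sum.cong[OF refl]) auto
  also have "\<dots> = - of_int (sign g) * ((real (r x) - real (c x)) * t.ys (inv' g))"
    using t.jucys_murphy_right[OF permutes_inv[OF g] x] by simp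
  also have "\<dots> = (real (c x) - real (r x)) * ys g"
    by (simp add: ys_transposed[OF g] algebra_simps)
  finally show ?thesis .
qed

end

section \<open>Joint eigenfunctions of the Jucys-Murphy elements\<close>

definition content_vector :: "tableau \<Rightarrow> nat \<Rightarrow> real" where
  "content_vector T i = real_of_int (box_content (box_of T i))"

text \<open>Joint eigenfunctions of the left and the right multiplications by the Jucys-Murphy elements
\<open>\<Sum>j<i. (j, i)\<close>, with eigenvalues \<open>a i\<close> and \<open>b i\<close>. Only the values on the symmetric group matter.\<close>

definition jm_eigen :: "nat \<Rightarrow> ((nat \<Rightarrow> nat) \<Rightarrow> real) \<Rightarrow> (nat \<Rightarrow> real) \<Rightarrow> (nat \<Rightarrow> real) \<Rightarrow> bool" where
  "jm_eigen n f a b \<longleftrightarrow> (\<exists>g. g permutes {1..n} \<and> f g \<noteq> 0) \<and>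
     (\<forall>g i. g permutes {1..n} \<and> i \<in> {1..n} \<longrightarrow>
       (\<Sum>j\<in>{1..<i}. f (Transposition.transpose j i \<circ> g)) = a i * f g \<and>
       (\<Sum>j\<in>{1..<i}. f (g \<circ> Transposition.transpose j i)) = b i * f g)"

lemma jm_eigenD:
  assumes "jm_eigen n f a b" "g permutes {1..n}" "i \<in> {1..n}"
  shows "(\<Sum>j\<in>{1..<i}. f (Transposition.transpose j i \<circ> g)) = a i * f g"
    "(\<Sum>j\<in>{1..<i}. f (g \<circ> Transposition.transpose j i)) = b i * f g"
  using assms by (simp_all add: jm_eigen_def)

lemma jm_commute:
  assumes i: "1 \<le> i" and k: "k \<noteq> i" "k \<noteq> Suc i"
  shows "(\<Sum>j\<in>{1..<k}. F (g \<circ> Transposition.transpose i (Suc i) \<circ> Transposition.transpose j k)) =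
    (\<Sum>j\<in>{1..<k}. F (g \<circ> Transposition.transpose j k \<circ> Transposition.transpose i (Suc i)))"
proof -
  let ?s = "Transposition.transpose i (Suc i)"
  have bij: "bij_betw ?s {1..<k} {1..<k}" using i k by (intro bij_betw_transpose_iff) auto
  have "g \<circ> ?s \<circ> Transposition.transpose j k = g \<circ> Transposition.transpose (?s j) k \<circ> ?s" for j
    using comp_transpose[OF inj_transpose[of i "Suc i"], of j k] k by (simp add: comp_assoc)
  then have "(\<Sum>j\<in>{1..<k}. F (g \<circ> ?s \<circ> Transposition.transpose j k)) =
    (\<Sum>j\<in>{1..<k}. F (g \<circ> Transposition.transpose (?s j) k \<circ> ?s))" by simp
  also have "\<dots> = (\<Sum>j\<in>{1..<k}. F (g \<circ> Transposition.transpose j k \<circ> ?s))"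
    by (rule sum.reindex_bij_betw[OF bij])
  finally show ?thesis .
qed

text \<open>The relations \<open>s X\<^sub>i\<^sub>+\<^sub>1 = X\<^sub>i s + 1\<close> and \<open>s X\<^sub>i = X\<^sub>i\<^sub>+\<^sub>1 s - 1\<close> for \<open>s = (i, i + 1)\<close>.\<close>

lemma jm_exchange:
  fixes F :: "(nat \<Rightarrow> nat) \<Rightarrow> real"
  assumes i: "1 \<le> i"
  shows "(\<Sum>j\<in>{1..<Suc i}. F (g \<circ> Transposition.transpose i (Suc i) \<circ> Transposition.transpose j (Suc i))) =
      (\<Sum>j\<in>{1..<i}. F (g \<circ> Transposition.transpose j i \<circ> Transposition.transpose i (Suc i))) + F g"
    and "(\<Sum>j\<in>{1..<i}. F (g \<circ> Transposition.transpose i (Suc i) \<circ> Transposition.transpose j i)) =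
      (\<Sum>j\<in>{1..<Suc i}. F (g \<circ> Transposition.transpose j (Suc i) \<circ> Transposition.transpose i (Suc i))) - F g"
proof -
  let ?s = "Transposition.transpose i (Suc i)"
  have 1: "g \<circ> ?s \<circ> Transposition.transpose j (Suc i) = g \<circ> Transposition.transpose j i \<circ> ?s"
    "g \<circ> ?s \<circ> Transposition.transpose j i = g \<circ> Transposition.transpose j (Suc i) \<circ> ?s"
    if "j \<in> {1..<i}" for j
    using comp_transpose[OF inj_transpose[of i "Suc i"], of j i]
      comp_transpose[OF inj_transpose[of i "Suc i"], of j "Suc i"] that by (simp_all add: comp_assoc)
  have 2: "g \<circ> ?s \<circ> ?s = g" by (simp add: comp_assoc)
  have set: "{1..<Suc i} = insert i {1..<i}" using i by auto
  show "(\<Sum>j\<in>{1..<Suc i}. F (g \<circ> ?s \<circ> Transposition.transpose j (Suc i))) =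
      (\<Sum>j\<in>{1..<i}. F (g \<circ> Transposition.transpose j i \<circ> ?s)) + F g"
    unfolding set using 1 2 by (simp add: add.commute)
  show "(\<Sum>j\<in>{1..<i}. F (g \<circ> ?s \<circ> Transposition.transpose j i)) =
      (\<Sum>j\<in>{1..<Suc i}. F (g \<circ> Transposition.transpose j (Suc i) \<circ> ?s)) - F g"
    unfolding set using 1 2 by (simp add: algebra_simps)
qed

text \<open>This is the step of Young's seminormal form. With \<open>d = b (i + 1) - b i\<close>, the relations
\<open>jm_exchange\<close> show that multiplication by \<open>s - 1 / d\<close> exchanges the eigenvalues \<open>b i\<close> and
\<open>b (i + 1)\<close>. The result is nonzero because \<open>(s + 1 / d) (s - 1 / d) = 1 - 1 / d\<^sup>2\<close>.\<close>

lemma jm_eigen_swap_right: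
  assumes f: "jm_eigen n f a b" and i: "1 \<le> i" "Suc i \<le> n"
    and d: "\<bar>b (Suc i) - b i\<bar> > 1"
  shows "jm_eigen n (\<lambda>g. f (g \<circ> Transposition.transpose i (Suc i)) - f g / (b (Suc i) - b i))
    a (b \<circ> Transposition.transpose i (Suc i))"
proof -
  let ?s = "Transposition.transpose i (Suc i)"
  define d where "d = b (Suc i) - b i"
  have d1: "\<bar>d\<bar> > 1" and d0: "d \<noteq> 0" using d by (auto simp: d_def)
  have bd: "b (Suc i) = b i + d" by (simp add: d_def)
  have perm: "g \<circ> ?s permutes {1..n}" if "g permutes {1..n}" for g
    using permutes_transpose_comp(2)[OF that] i by simp
  have left: "(\<Sum>j\<in>{1..<k}. f (Transposition.transpose j k \<circ> g \<circ> ?s) - f (Transposition.transpose j k \<circ> g) / d) =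
      a k * (f (g \<circ> ?s) - f g / d)" if g: "g permutes {1..n}" and k: "k \<in> {1..n}" for g k
  proof -
    have "(\<Sum>j\<in>{1..<k}. f (Transposition.transpose j k \<circ> g \<circ> ?s) - f (Transposition.transpose j k \<circ> g) / d) =
      (\<Sum>j\<in>{1..<k}. f (Transposition.transpose j k \<circ> (g \<circ> ?s))) - (\<Sum>j\<in>{1..<k}. f (Transposition.transpose j k \<circ> g)) / d"
      by (simp add: sum_subtractf sum_divide_distrib comp_assoc)
    also have "\<dots> = a k * f (g \<circ> ?s) - a k * f g / d"
      using jm_eigenD(1)[OF f perm[OF g] k] jm_eigenD(1)[OF f g k] by simp
    finally show ?thesis by (simp add: algebra_simps)
  qed
  have right: "(\<Sum>j\<in>{1..<k}. f (g \<circ> Transposition.transpose j k \<circ> ?s) - f (g \<circ> Transposition.transpose j k) / d) =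
      b (?s k) * (f (g \<circ> ?s) - f g / d)" if g: "g permutes {1..n}" and k: "k \<in> {1..n}" for g k
  proof -
    have D: "(\<Sum>j\<in>{1..<l}. f (g \<circ> Transposition.transpose j l)) = b l * f g"
      "(\<Sum>j\<in>{1..<l}. f (g \<circ> ?s \<circ> Transposition.transpose j l)) = b l * f (g \<circ> ?s)" if "l \<in> {1..n}" for l
      using jm_eigenD(2)[OF f g that] jm_eigenD(2)[OF f perm[OF g] that] by simp_all
    have si: "Suc i \<in> {1..n}" "i \<in> {1..n}" using i by auto
    have "(\<Sum>j\<in>{1..<k}. f (g \<circ> Transposition.transpose j k \<circ> ?s) - f (g \<circ> Transposition.transpose j k) / d) =
      (\<Sum>j\<in>{1..<k}. f (g \<circ> Transposition.transpose j k \<circ> ?s)) - b k * f g / d"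
      using D(1)[OF k] by (simp add: sum_subtractf sum_divide_distrib[symmetric])
    also have "\<dots> = b (?s k) * (f (g \<circ> ?s) - f g / d)"
    proof -
      consider "k = i" | "k = Suc i" | "k \<noteq> i" "k \<noteq> Suc i" by blast
      then show ?thesis
      proof cases
        case 1
        have "(\<Sum>j\<in>{1..<i}. f (g \<circ> Transposition.transpose j i \<circ> ?s)) = b (Suc i) * f (g \<circ> ?s) - f g"
          using jm_exchange(1)[OF i(1), of f g] D(2)[OF si(1)] by simp
        then show ?thesis unfolding 1 using d0 by (simp only:) (simp add: bd field_simps)
      next
        case 2
        have "(\<Sum>j\<in>{1..<Suc i}. f (g \<circ> Transposition.transpose j (Suc i) \<circ> ?s)) = b i * f (g \<circ> ?s) + f g"
          using jm_exchange(2)[OF i(1), of f g] D(2)[OF si(2)] by simp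
        then show ?thesis unfolding 2 using d0 by (simp only:) (simp add: bd field_simps)
      next
        case 3
        then show ?thesis
          using jm_commute[OF i(1) 3, of f g] D(2)[OF k] by (simp add: algebra_simps)
      qed
    qed
    finally show ?thesis .
  qed
  have "\<exists>g. g permutes {1..n} \<and> f (g \<circ> ?s) - f g / d \<noteq> 0"
  proof (rule ccontr)
    assume "\<not> ?thesis"
    then have z: "f (g \<circ> ?s) = f g / d" if "g permutes {1..n}" for g using that by auto
    obtain g where g: "g permutes {1..n}" "f g \<noteq> 0" using f by (auto simp: jm_eigen_def)
    have "f g = f (g \<circ> ?s \<circ> ?s)" by (simp add: comp_assoc)
    also have "\<dots> = f g / d / d" using z[OF perm[OF g(1)]] z[OF g(1)] by simp
    finally have "d * d = 1" using g(2) d0 by (simp add: field_simps)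
    then have "\<bar>d\<bar> * \<bar>d\<bar> = 1" by (simp add: abs_mult_self_eq)
    moreover have "1 * 1 < \<bar>d\<bar> * \<bar>d\<bar>" using d1 by (intro mult_strict_mono) auto
    ultimately show False by simp
  qed
  then show ?thesis unfolding jm_eigen_def d_def[symmetric] using left right by simp
qed

lemma jm_eigen_inverse:
  assumes f: "jm_eigen n f a b"
  shows "jm_eigen n (\<lambda>g. f (inv' g)) b a"
proof -
  have e: "f (inv' (Transposition.transpose j k \<circ> g)) = f (inv' g \<circ> Transposition.transpose j k)"
    "f (inv' (g \<circ> Transposition.transpose j k)) = f (Transposition.transpose j k \<circ> inv' g)"
    if "g permutes {1..n}" for g j k
    using o_inv_distrib[OF bij_transpose permutes_bij[OF that]]
      o_inv_distrib[OF permutes_bij[OF that] bij_transpose] by simp_all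
  obtain g where g: "g permutes {1..n}" "f g \<noteq> 0" using f by (auto simp: jm_eigen_def)
  then have nz: "inv' g permutes {1..n}" "f (inv' (inv' g)) \<noteq> 0"
    using permutes_inv[OF g(1)] permutes_inv_inv[OF g(1)] by simp_all
  show ?thesis
    unfolding jm_eigen_def
  proof (intro conjI allI impI)
    fix g i assume "g permutes {1..n} \<and> i \<in> {1..n}"
    then have g: "g permutes {1..n}" and i: "i \<in> {1..n}" by auto
    note D = jm_eigenD[OF f permutes_inv[OF g] i]
    show "(\<Sum>j\<in>{1..<i}. f (inv' (Transposition.transpose j i \<circ> g))) = b i * f (inv' g)"
      using D(2) e(1)[OF g] by simp
    show "(\<Sum>j\<in>{1..<i}. f (inv' (g \<circ> Transposition.transpose j i))) = a i * f (inv' g)"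
      using D(1) e(2)[OF g] by simp
  qed (use nz in blast)
qed

lemma jm_eigen_swap_left:
  assumes f: "jm_eigen n f a b" and i: "1 \<le> i" "Suc i \<le> n"
    and d: "\<bar>a (Suc i) - a i\<bar> > 1"
  shows "\<exists>f'. jm_eigen n f' (a \<circ> Transposition.transpose i (Suc i)) b"
  using jm_eigen_inverse[OF jm_eigen_swap_right[OF jm_eigen_inverse[OF f] i d]] by blast

text \<open>If \<open>i\<close> and \<open>i + 1\<close> can be exchanged, neither of their boxes is weakly up and to the left of the
other, so their contents differ by at least \<open>2\<close>.\<close>

lemma entry_swap_contents:
  assumes D: "diagram D" and s: "entry_swap D T T'"
  obtains i where "1 \<le> i" "Suc i \<le> card D" "\<bar>content_vector T (Suc i) - content_vector T i\<bar> > 1"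
    "content_vector T' = content_vector T \<circ> Transposition.transpose i (Suc i)"
proof -
  obtain i where i: "1 \<le> i" "Suc i \<le> card D" and T': "T' = swap_entries i (Suc i) T"
    and T: "T \<in> tableaux D" "T' \<in> tableaux D" using s by (auto simp: entry_swap_def)
  have b: "box_of T' i = box_of T (Suc i)" "box_of T' (Suc i) = box_of T i"
    unfolding T' box_of_swap_entries by simp_all
  have "\<bar>box_content (box_of T (Suc i)) - box_content (box_of T i)\<bar> > 1"
    using consecutive_boxes[OF D T(1) i] consecutive_boxes[OF D T(2) i] unfolding b box_content_def
    by linarith
  then have "\<bar>content_vector T (Suc i) - content_vector T i\<bar> > 1"
    unfolding content_vector_def by linarith
  moreover have "content_vector T' = content_vector T \<circ> Transposition.transpose i (Suc i)"
    unfolding T' by (auto simp: content_vector_def box_of_swap_entries)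
  ultimately show ?thesis using that i by blast
qed

text \<open>The Young symmetrizer of the column reading tableau \<open>T\<close>. From the right the Jucys-Murphy elements act
on it by the contents of \<open>T\<close>. From the left they act by contents if the labels are ordered row by
row, so \<open>\<sigma>\<close> renames the labels of the row reading tableau \<open>S\<close> to those of \<open>T\<close>.\<close>

lemma jm_eigen_initial:
  assumes D: "diagram D"
  obtains S T f where "S \<in> tableaux D" "T \<in> tableaux D"
    "jm_eigen (card D) f (content_vector S) (content_vector T)"
proof -
  define n where "n = card D"
  let ?A = "{1..n}"
  obtain S where S: "S \<in> tableaux D" and Sl: "\<And>u v u' v'. (u, v) \<in> D \<Longrightarrow> (u', v') \<in> D \<Longrightarrow>
      S (u', v') < S (u, v) \<longleftrightarrow> u' < u \<or> u' = u \<and> v' < v" using row_reading_tableau[OF D] by metis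
  obtain T where T: "T \<in> tableaux D" and Tl: "\<And>u v u' v'. (u, v) \<in> D \<Longrightarrow> (u', v') \<in> D \<Longrightarrow>
      T (u', v') < T (u, v) \<longleftrightarrow> v' < v \<or> v' = v \<and> u' < u" using col_reading_tableau[OF D] by metis
  define r c where "r i = fst (box_of T i)" and "c i = snd (box_of T i)" for i
  define \<sigma> where "\<sigma> i = (if i \<in> ?A then T (box_of S i) else i)" for i
  have rc: "(r i, c i) \<in> D" "T (r i, c i) = i" if "i \<in> ?A" for i
    using box_of_entry[OF T, of i] that by (auto simp: r_def c_def n_def)
  have rcT: "r (T (u, v)) = u" "c (T (u, v)) = v" "T (u, v) \<in> ?A" if "(u, v) \<in> D" for u v
    using box_of_eq[OF T that] tableaux_range[OF T that] by (auto simp: r_def c_def n_def)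
  interpret labelled_diagram ?A r c
  proof
    fix x y assume "x \<in> ?A" "y \<in> ?A" "r x = r y" "c x = c y"
    then show "x = y" using rc(2) by metis
  next
    fix x w assume x: "x \<in> ?A" "w < c x"
    have "(r x, w) \<in> D" using diagramD[OF D rc(1)[OF x(1)]] x(2) by simp
    then show "\<exists>y\<in>?A. r y = r x \<and> c y = w" using rcT by blast
  next
    fix x w assume x: "x \<in> ?A" "w < r x"
    have "(w, c x) \<in> D" using diagramD[OF D rc(1)[OF x(1)]] x(2) by simp
    then show "\<exists>y\<in>?A. c y = c x \<and> r y = w" using rcT by blast
  qed simp
  have Sbox: "box_of S i \<in> D" "S (box_of S i) = i" if "i \<in> ?A" for i
    using box_of_entry[OF S, of i] that by (auto simp: n_def)
  have \<sigma>b: "box_of T (\<sigma> i) = box_of S i" if "i \<in> ?A" for i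
    using box_of_eq[OF T Sbox(1)[OF that]] that by (simp add: \<sigma>_def)
  have \<sigma>A: "\<sigma> i \<in> ?A" if "i \<in> ?A" for i
    using tableaux_range[OF T Sbox(1)[OF that]] that by (simp add: \<sigma>_def n_def)
  have S\<sigma>: "S (box_of T y) \<in> ?A" "\<sigma> (S (box_of T y)) = y" if y: "y \<in> ?A" for y
  proof -
    have b: "box_of T y \<in> D" "T (box_of T y) = y" using box_of_entry[OF T, of y] y by (auto simp: n_def)
    show "S (box_of T y) \<in> ?A" using tableaux_range[OF S b(1)] by (simp add: n_def)
    then show "\<sigma> (S (box_of T y)) = y" using box_of_eq[OF S b(1)] b(2) by (simp add: \<sigma>_def)
  qed
  have "bij_betw \<sigma> ?A ?A"
  proof (rule bij_betw_byWitness[of _ "\<lambda>y. S (box_of T y)"])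
    show "\<forall>a\<in>?A. S (box_of T (\<sigma> a)) = a" using \<sigma>b Sbox(2) by simp
    show "\<forall>y\<in>?A. \<sigma> (S (box_of T y)) = y" using S\<sigma>(2) by blast
    show "\<sigma> ` ?A \<subseteq> ?A" using \<sigma>A by blast
    show "(\<lambda>y. S (box_of T y)) ` ?A \<subseteq> ?A" using S\<sigma>(1) by blast
  qed
  then have \<sigma>: "\<sigma> permutes ?A" by (rule bij_imp_permutes) (simp add: \<sigma>_def del: atLeastAtMost_iff)
  define f where "f g = ys (\<sigma> \<circ> g)" for g
  have "jm_eigen n f (content_vector S) (content_vector T)"
    unfolding jm_eigen_def
  proof (intro conjI exI[of _ "inv' \<sigma>"] allI impI)
    show "inv' \<sigma> permutes ?A" by (rule permutes_inv[OF \<sigma>])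
    show "f (inv' \<sigma>) \<noteq> 0" unfolding f_def permutes_inv_o(1)[OF \<sigma>] ys_id by (rule one_neq_zero)
  next
    fix g i assume gi: "g permutes ?A \<and> i \<in> ?A"
    then have g: "\<sigma> \<circ> g permutes ?A" and i: "i \<in> ?A" using permutes_compose[OF _ \<sigma>] by auto
    have less: "y < i \<longleftrightarrow> c y < c i \<or> c y = c i \<and> r y < r i" if y: "y \<in> ?A" for y
      using Tl[OF rc(1)[OF i] rc(1)[OF y]] unfolding rc(2)[OF i] rc(2)[OF y] .
    have "{1..<i} = {y. y \<in> ?A \<and> y < i}" using i by auto
    also have "\<dots> = {y. y \<in> ?A \<and> (c y < c i \<or> c y = c i \<and> r y < r i)}"
      using less by blast
    finally show "(\<Sum>j\<in>{1..<i}. f (g \<circ> Transposition.transpose j i)) = content_vector T i * f g"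
      using jucys_murphy_right[OF g i] unfolding f_def comp_assoc
      by (simp add: content_vector_def box_content_def r_def c_def)
    have "(\<Sum>j\<in>{1..<i}. f (Transposition.transpose j i \<circ> g)) =
      (\<Sum>j\<in>{1..<i}. ys (Transposition.transpose (\<sigma> j) (\<sigma> i) \<circ> (\<sigma> \<circ> g)))"
      unfolding f_def comp_assoc[symmetric] comp_transpose[OF permutes_inj[OF \<sigma>]] by simp
    also have "\<dots> = (\<Sum>y | y \<in> ?A \<and> (r y < r (\<sigma> i) \<or> r y = r (\<sigma> i) \<and> c y < c (\<sigma> i)).
        ys (Transposition.transpose y (\<sigma> i) \<circ> (\<sigma> \<circ> g)))"
    proof (rule sum.reindex_bij_witness[of _ "\<lambda>y. S (box_of T y)" \<sigma>])
      have less: "j < i \<longleftrightarrow> r (\<sigma> j) < r (\<sigma> i) \<or> r (\<sigma> j) = r (\<sigma> i) \<and> c (\<sigma> j) < c (\<sigma> i)"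
        if j: "j \<in> ?A" for j
        using Sl[of "fst (box_of S i)" "snd (box_of S i)" "fst (box_of S j)" "snd (box_of S j)"]
          Sbox[OF i] Sbox[OF j] by (simp add: r_def c_def \<sigma>b[OF i] \<sigma>b[OF j])
      fix j assume "j \<in> {1..<i}"
      then have j: "j \<in> ?A" "j < i" using i by auto
      show "S (box_of T (\<sigma> j)) = j" using \<sigma>b[OF j(1)] Sbox(2)[OF j(1)] by simp
      show "\<sigma> j \<in> {y. y \<in> ?A \<and> (r y < r (\<sigma> i) \<or> r y = r (\<sigma> i) \<and> c y < c (\<sigma> i))}"
        using \<sigma>A[OF j(1)] less[OF j(1)] j(2) by simp
    next
      fix y assume "y \<in> {y. y \<in> ?A \<and> (r y < r (\<sigma> i) \<or> r y = r (\<sigma> i) \<and> c y < c (\<sigma> i))}"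
      then have y: "y \<in> ?A" "r y < r (\<sigma> i) \<or> r y = r (\<sigma> i) \<and> c y < c (\<sigma> i)" by auto
      have "S (r y, c y) < S (r (\<sigma> i), c (\<sigma> i))"
        using Sl[OF rc(1)[OF \<sigma>A[OF i]] rc(1)[OF y(1)]] y(2) by simp
      then have "S (box_of T y) < i" using \<sigma>b[OF i] Sbox(2)[OF i] by (simp add: r_def c_def)
      then show "S (box_of T y) \<in> {1..<i}" using S\<sigma>(1)[OF y(1)] by simp
      show "\<sigma> (S (box_of T y)) = y" by (rule S\<sigma>(2)[OF y(1)])
    qed simp
    also have "\<dots> = (real (c (\<sigma> i)) - real (r (\<sigma> i))) * ys (\<sigma> \<circ> g)" by (rule jucys_murphy_left[OF g \<sigma>A[OF i]])
    also have "\<dots> = content_vector S i * f g"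
      by (simp add: f_def content_vector_def box_content_def r_def c_def \<sigma>b[OF i])
    finally show "(\<Sum>j\<in>{1..<i}. f (Transposition.transpose j i \<circ> g)) = content_vector S i * f g" .
  qed
  then show ?thesis using that S T unfolding n_def by blast
qed

theorem jm_eigen_exists:
  assumes D: "diagram D" and S: "S \<in> tableaux D" and T: "T \<in> tableaux D"
  shows "\<exists>f. jm_eigen (card D) f (content_vector S) (content_vector T)"
proof -
  obtain S0 T0 f0 where 0: "S0 \<in> tableaux D" "T0 \<in> tableaux D"
    "jm_eigen (card D) f0 (content_vector S0) (content_vector T0)" using jm_eigen_initial[OF D] .
  have 1: "\<exists>f. jm_eigen (card D) f (content_vector S0) (content_vector T)"
    using entry_swap_connected[OF D 0(2) T]
  proof (induction rule: rtranclp_induct)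
    case base
    show ?case using 0(3) by blast
  next
    case (step T1 T2)
    from step.IH obtain f where f: "jm_eigen (card D) f (content_vector S0) (content_vector T1)" ..
    obtain i where i: "1 \<le> i" "Suc i \<le> card D" "\<bar>content_vector T1 (Suc i) - content_vector T1 i\<bar> > 1"
      "content_vector T2 = content_vector T1 \<circ> Transposition.transpose i (Suc i)"
      using entry_swap_contents[OF D step.hyps(2)] .
    show ?case unfolding i(4) using jm_eigen_swap_right[OF f i(1-3)] by blast
  qed
  show ?thesis
    using entry_swap_connected[OF D 0(1) S]
  proof (induction rule: rtranclp_induct)
    case base
    show ?case using 1 .
  next
    case (step S1 S2)
    from step.IH obtain f where f: "jm_eigen (card D) f (content_vector S1) (content_vector T)" ..
    obtain i where i: "1 \<le> i" "Suc i \<le> card D" "\<bar>content_vector S1 (Suc i) - content_vector S1 i\<bar> > 1"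
      "content_vector S2 = content_vector S1 \<circ> Transposition.transpose i (Suc i)"
      using entry_swap_contents[OF D step.hyps(2)] .
    show ?case unfolding i(4) by (rule jm_eigen_swap_left[OF f i(1-3)])
  qed
qed

section \<open>Eigenfunctions of the last transposition\<close>

text \<open>The function \<open>f\<close> multiplied by \<open>1 + e s\<close>, where \<open>e\<close> is the sign of \<open>b (m + 1) - b m\<close>. Since \<open>s\<close>
commutes with \<open>X\<^sub>1, \<dots>, X\<^sub>m\<^sub>-\<^sub>1\<close> and with \<open>X\<^sub>m + X\<^sub>m\<^sub>+\<^sub>1\<close>, all these eigenvalues are inherited. The
product is nonzero for this choice of \<open>e\<close>: otherwise \<open>s\<close> would act on \<open>f\<close> by \<open>- e\<close>, and
\<open>jm_exchange\<close> would give \<open>e (b (m + 1) - b m) = - 1\<close>.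

The last property is the eigenvalue of the sum over \<open>j < m\<close> of the \<open>3\<close>-cycles \<open>s (j, m + 1)\<close> and
\<open>s (j, m)\<close>, that is, of \<open>s (X\<^sub>m + X\<^sub>m\<^sub>+\<^sub>1) - 1\<close>.\<close>

lemma sign_eigenfunction:
  assumes f: "jm_eigen (Suc m) f a b" and m: "1 \<le> m" and ne: "b m \<noteq> b (Suc m)"
  defines "e \<equiv> if b m < b (Suc m) then 1 else - 1 :: real" and "s \<equiv> Transposition.transpose m (Suc m)"
  obtains h where
    "\<exists>g. g permutes {1..Suc m} \<and> h g \<noteq> 0"
    "\<And>g i. g permutes {1..Suc m} \<Longrightarrow> i \<in> {1..Suc m} \<Longrightarrow>
      (\<Sum>j\<in>{1..<i}. h (Transposition.transpose j i \<circ> g)) = a i * h g"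
    "\<And>g i. g permutes {1..Suc m} \<Longrightarrow> i \<in> {1..<m} \<Longrightarrow>
      (\<Sum>j\<in>{1..<i}. h (g \<circ> Transposition.transpose j i)) = b i * h g"
    "\<And>g. g permutes {1..Suc m} \<Longrightarrow> h (g \<circ> s) = e * h g"
    "\<And>g. g permutes {1..Suc m} \<Longrightarrow>
      (\<Sum>j\<in>{1..<m}. h (g \<circ> s \<circ> Transposition.transpose j (Suc m)) + h (g \<circ> s \<circ> Transposition.transpose j m))
      = (e * (b m + b (Suc m)) - 1) * h g"
proof
  let ?A = "{1..Suc m}"
  define h where "h g = f g + e * f (g \<circ> s)" for g
  have mA: "m \<in> ?A" "Suc m \<in> ?A" using m by auto
  have ss: "g \<circ> s \<circ> s = g" for g :: "nat \<Rightarrow> nat" by (simp add: s_def comp_assoc)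
  have ee: "e * e = 1" by (simp add: e_def)
  have perm: "g \<circ> s permutes ?A" if "g permutes ?A" for g
    using permutes_transpose_comp(2)[OF that mA] by (simp add: s_def)
  note L = jm_eigenD(1)[OF f] and R = jm_eigenD(2)[OF f]
  note X = jm_exchange[OF m, folded s_def]
  show hs: "h (g \<circ> s) = e * h g" if "g permutes ?A" for g
    using ee by (simp add: h_def ss algebra_simps)
  show "\<exists>g. g permutes ?A \<and> h g \<noteq> 0"
  proof (rule ccontr)
    assume "\<not> ?thesis"
    then have "f g + e * f (g \<circ> s) = 0" if "g permutes ?A" for g using that by (auto simp: h_def)
    then have "e * (f g + e * f (g \<circ> s)) = 0" if "g permutes ?A" for g using that by simp
    then have z: "f (g \<circ> s) = - e * f g" if "g permutes ?A" for g
      using that ee by (simp add: algebra_simps eq_neg_iff_add_eq_0 mult.assoc[symmetric])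
    obtain g where g: "g permutes ?A" "f g \<noteq> 0" using f by (auto simp: jm_eigen_def)
    have "(\<Sum>j\<in>{1..<m}. f (g \<circ> s \<circ> Transposition.transpose j m)) = b m * (- e * f g)"
      using R[OF perm[OF g(1)] mA(1)] z[OF g(1)] by simp
    moreover have "(\<Sum>j\<in>{1..<Suc m}. f (g \<circ> Transposition.transpose j (Suc m) \<circ> s)) =
      (\<Sum>j\<in>{1..<Suc m}. - e * f (g \<circ> Transposition.transpose j (Suc m)))"
      using z[OF permutes_transpose_comp(2)[OF g(1)]] mA by (intro sum.cong[OF refl]) auto
    then have "(\<Sum>j\<in>{1..<Suc m}. f (g \<circ> Transposition.transpose j (Suc m) \<circ> s)) = - e * (b (Suc m) * f g)"
      using R[OF g(1) mA(2)] by (simp only: sum_distrib_left[symmetric])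
    ultimately have "b m * (- e * f g) = - e * (b (Suc m) * f g) - f g" using X(2)[of f g] by simp
    then have "(e * (b (Suc m) - b m) + 1) * f g = 0" by (simp add: algebra_simps)
    then show False using g(2) by (auto simp: e_def split: if_splits)
  qed
  fix g assume g: "g permutes ?A"
  show "(\<Sum>j\<in>{1..<i}. h (Transposition.transpose j i \<circ> g)) = a i * h g" if i: "i \<in> ?A" for i
  proof -
    have "(\<Sum>j\<in>{1..<i}. h (Transposition.transpose j i \<circ> g)) =
      (\<Sum>j\<in>{1..<i}. f (Transposition.transpose j i \<circ> g)) +
      e * (\<Sum>j\<in>{1..<i}. f (Transposition.transpose j i \<circ> (g \<circ> s)))"
      by (simp add: h_def sum.distrib sum_distrib_left comp_assoc)
    then show ?thesis unfolding L[OF g i] L[OF perm[OF g] i] by (simp add: h_def algebra_simps)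
  qed
  show "(\<Sum>j\<in>{1..<i}. h (g \<circ> Transposition.transpose j i)) = b i * h g" if i: "i \<in> {1..<m}" for i
  proof -
    have iA: "i \<in> ?A" and im: "i \<noteq> m" "i \<noteq> Suc m" using i by auto
    have "(\<Sum>j\<in>{1..<i}. h (g \<circ> Transposition.transpose j i)) =
      (\<Sum>j\<in>{1..<i}. f (g \<circ> Transposition.transpose j i)) +
      e * (\<Sum>j\<in>{1..<i}. f (g \<circ> Transposition.transpose j i \<circ> s))"
      by (simp add: h_def sum.distrib sum_distrib_left)
    then show ?thesis
      unfolding R[OF g iA] jm_commute[OF m im, of f g, folded s_def, symmetric] R[OF perm[OF g] iA]
      by (simp add: h_def algebra_simps)
  qed
  have sum_h: "(\<Sum>j\<in>{1..<Suc m}. h (k \<circ> Transposition.transpose j (Suc m))) +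
      (\<Sum>j\<in>{1..<m}. h (k \<circ> Transposition.transpose j m)) = (b m + b (Suc m)) * h k"
    if k: "k permutes ?A" for k
  proof -
    have 1: "(\<Sum>j\<in>{1..<Suc m}. h (k \<circ> Transposition.transpose j (Suc m))) =
      (\<Sum>j\<in>{1..<Suc m}. f (k \<circ> Transposition.transpose j (Suc m))) +
      e * (\<Sum>j\<in>{1..<Suc m}. f (k \<circ> Transposition.transpose j (Suc m) \<circ> s))"
      unfolding h_def sum.distrib sum_distrib_left ..
    have 2: "(\<Sum>j\<in>{1..<m}. h (k \<circ> Transposition.transpose j m)) =
      (\<Sum>j\<in>{1..<m}. f (k \<circ> Transposition.transpose j m)) +
      e * (\<Sum>j\<in>{1..<m}. f (k \<circ> Transposition.transpose j m \<circ> s))"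
      unfolding h_def sum.distrib sum_distrib_left ..
    have 3: "(\<Sum>j\<in>{1..<Suc m}. f (k \<circ> Transposition.transpose j (Suc m) \<circ> s)) = b m * f (k \<circ> s) + f k"
      using X(2)[of f k] R[OF perm[OF k] mA(1)] by linarith
    have 4: "(\<Sum>j\<in>{1..<m}. f (k \<circ> Transposition.transpose j m \<circ> s)) = b (Suc m) * f (k \<circ> s) - f k"
      using X(1)[of f k] R[OF perm[OF k] mA(2)] by linarith
    show ?thesis unfolding 1 2 3 4 R[OF k mA(1)] R[OF k mA(2)] by (simp add: h_def algebra_simps)
  qed
  have "{1..<Suc m} = insert m {1..<m}" using m by auto
  then have "(\<Sum>j\<in>{1..<Suc m}. h (g \<circ> s \<circ> Transposition.transpose j (Suc m))) =
    h (g \<circ> s \<circ> s) + (\<Sum>j\<in>{1..<m}. h (g \<circ> s \<circ> Transposition.transpose j (Suc m)))"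
    by (simp add: s_def)
  then show "(\<Sum>j\<in>{1..<m}. h (g \<circ> s \<circ> Transposition.transpose j (Suc m)) + h (g \<circ> s \<circ> Transposition.transpose j m))
      = (e * (b m + b (Suc m)) - 1) * h g"
    using sum_h[OF perm[OF g]] unfolding ss hs[OF g] sum.distrib by (simp add: algebra_simps)
qed

section \<open>Independence and characteristic polynomials\<close>

text \<open>The operators sum a function over finitely many moves of its argument. In a shortest nontrivial
relation, subtract from the image under a separating operator the multiple that cancels one term;
the relation that remains is shorter and still nontrivial.\<close>

lemma joint_eigenfunctions_independent:
  fixes f :: "'k \<Rightarrow> 'x \<Rightarrow> real" and act :: "'j \<Rightarrow> 't \<Rightarrow> 'x \<Rightarrow> 'x"
  assumes K: "finite K"
    and act: "\<And>j t x. j \<in> J \<Longrightarrow> t \<in> N j \<Longrightarrow> x \<in> X \<Longrightarrow> act j t x \<in> X"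
    and eig: "\<And>k j x. k \<in> K \<Longrightarrow> j \<in> J \<Longrightarrow> x \<in> X \<Longrightarrow> (\<Sum>t\<in>N j. f k (act j t x)) = c k j * f k x"
    and nz: "\<And>k. k \<in> K \<Longrightarrow> \<exists>x\<in>X. f k x \<noteq> 0"
    and sep: "\<And>k l. k \<in> K \<Longrightarrow> l \<in> K \<Longrightarrow> k \<noteq> l \<Longrightarrow> \<exists>j\<in>J. c k j \<noteq> c l j"
    and "\<And>x. x \<in> X \<Longrightarrow> (\<Sum>k\<in>K. a k * f k x) = 0" and "k \<in> K"
  shows "a k = 0"
  using assms(6,7)
proof (induction "card {k \<in> K. a k \<noteq> 0}" arbitrary: a k rule: less_induct)
  case less
  show ?case
  proof (rule ccontr)
    assume ak: "a k \<noteq> 0"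
    show False
    proof (cases "\<exists>l\<in>K. l \<noteq> k \<and> a l \<noteq> 0")
      case False
      obtain x where x: "x \<in> X" "f k x \<noteq> 0" using nz[OF less.prems(2)] by blast
      have "(\<Sum>l\<in>K. a l * f l x) = a k * f k x"
        by (subst sum.remove[OF K less.prems(2)]) (use False in \<open>auto intro!: sum.neutral\<close>)
      then show False using less.prems(1)[OF x(1)] x(2) ak by simp
    next
      case True
      then obtain l where l: "l \<in> K" "l \<noteq> k" "a l \<noteq> 0" by blast
      obtain j where j: "j \<in> J" "c l j \<noteq> c k j" using sep[OF l(1) less.prems(2) l(2)] by blast
      define a' where "a' i = a i * (c i j - c k j)" for i
      have "{i \<in> K. a' i \<noteq> 0} \<subset> {i \<in> K. a i \<noteq> 0}"
        using ak less.prems(2) by (auto simp: a'_def)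
      then have card: "card {i \<in> K. a' i \<noteq> 0} < card {i \<in> K. a i \<noteq> 0}"
        by (intro psubset_card_mono) (use K in auto)
      have "(\<Sum>i\<in>K. a' i * f i x) = 0" if x: "x \<in> X" for x
      proof -
        have "(\<Sum>i\<in>K. a i * (c i j * f i x)) = (\<Sum>i\<in>K. \<Sum>t\<in>N j. a i * f i (act j t x))"
          by (rule sum.cong[OF refl]) (simp add: eig[OF _ j(1) x, symmetric] sum_distrib_left)
        also have "\<dots> = (\<Sum>t\<in>N j. \<Sum>i\<in>K. a i * f i (act j t x))" by (rule sum.swap)
        also have "\<dots> = 0" by (rule sum.neutral) (use less.prems(1)[OF act[OF j(1) _ x]] in blast)
        finally have 1: "(\<Sum>i\<in>K. a i * (c i j * f i x)) = 0" .
        have "(\<Sum>i\<in>K. a' i * f i x) = (\<Sum>i\<in>K. a i * (c i j * f i x)) - c k j * (\<Sum>i\<in>K. a i * f i x)"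
          unfolding a'_def sum_distrib_left sum_subtractf[symmetric]
          by (rule sum.cong[OF refl]) (simp add: algebra_simps)
        then show ?thesis using 1 less.prems(1)[OF x] by simp
      qed
      from less.hyps[OF card this l(1)] show False using l(3) j(2) by (simp add: a'_def)
    qed
  qed
qed

lemma char_poly_eigenbasis:
  fixes \<alpha> :: "'x \<Rightarrow> 'x \<Rightarrow> real" and f :: "'k \<Rightarrow> 'x \<Rightarrow> real"
  assumes ws: "distinct ws" and K: "finite K" "card K = length ws"
    and eig: "\<And>k x. k \<in> K \<Longrightarrow> x \<in> set ws \<Longrightarrow> (\<Sum>y\<in>set ws. \<alpha> x y * f k y) = e k * f k x"
    and ind: "\<And>a k. (\<And>x. x \<in> set ws \<Longrightarrow> (\<Sum>k\<in>K. a k * f k x) = 0) \<Longrightarrow> k \<in> K \<Longrightarrow> a k = 0"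
  shows "char_poly (mat (length ws) (length ws) (\<lambda>(i, j). \<alpha> (ws ! i) (ws ! j))) = (\<Prod>k\<in>K. [:- e k, 1:])"
proof -
  obtain ks where ks: "set ks = K" "distinct ks" using finite_distinct_list[OF K(1)] by blast
  define N where "N = length ws"
  have lk: "length ks = N" using distinct_card[OF ks(2)] ks(1) K(2) by (simp add: N_def)
  have bw: "bij_betw ((!) ws) {0..<N} (set ws)"
    using bij_betw_nth[OF ws, of "{0..<N}" "set ws"] by (simp add: N_def lessThan_atLeast0)
  have bk: "bij_betw ((!) ks) {0..<N} K"
    using bij_betw_nth[OF ks(2), of "{0..<N}" K] lk ks(1) by (simp add: lessThan_atLeast0)
  have kK: "ks ! i \<in> K" if "i < N" for i using that lk ks(1) nth_mem by blast
  have wW: "ws ! i \<in> set ws" if "i < N" for i using that by (simp add: N_def)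
  define M where "M = mat N N (\<lambda>(i, j). \<alpha> (ws ! i) (ws ! j))"
  define P where "P = mat N N (\<lambda>(i, j). f (ks ! j) (ws ! i))"
  define D where "D = mat N N (\<lambda>(i, j). if i = j then e (ks ! i) else 0)"
  have car: "M \<in> carrier_mat N N" "P \<in> carrier_mat N N" "D \<in> carrier_mat N N"
    by (simp_all add: M_def P_def D_def)
  have MP: "M * P = P * D"
  proof (rule eq_matI)
    fix i j assume "i < dim_row (P * D)" "j < dim_col (P * D)"
    then have ij: "i < N" "j < N" using car by auto
    have "(M * P) $$ (i, j) = (\<Sum>l\<in>{0..<N}. \<alpha> (ws ! i) (ws ! l) * f (ks ! j) (ws ! l))"
      using ij by (simp add: M_def P_def scalar_prod_def)
    also have "\<dots> = (\<Sum>y\<in>set ws. \<alpha> (ws ! i) y * f (ks ! j) y)"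
      by (rule sum.reindex_bij_betw[OF bw])
    also have "\<dots> = e (ks ! j) * f (ks ! j) (ws ! i)" by (rule eig[OF kK[OF ij(2)] wW[OF ij(1)]])
    also have "\<dots> = (\<Sum>l\<in>{0..<N}. f (ks ! l) (ws ! i) * (if l = j then e (ks ! l) else 0))"
      using ij by (simp add: if_distrib cong: if_cong)
    also have "\<dots> = (P * D) $$ (i, j)" using ij by (simp add: D_def P_def scalar_prod_def)
    finally show "(M * P) $$ (i, j) = (P * D) $$ (i, j)" .
  qed (use car in auto)
  have "det P \<noteq> 0"
  proof
    assume "det P = 0"
    then obtain v where v: "v \<in> carrier_vec N" "v \<noteq> 0\<^sub>v N" "P *\<^sub>v v = 0\<^sub>v N"
      using det_0_iff_vec_prod_zero_field[OF car(2)] by blast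
    define a where "a k = v $ inv_into {0..<N} ((!) ks) k" for k
    have av: "a (ks ! i) = v $ i" if "i < N" for i
      using bij_betw_inv_into_left[OF bk, of i] that by (simp add: a_def)
    have "(\<Sum>k\<in>K. a k * f k x) = 0" if x: "x \<in> set ws" for x
    proof -
      obtain i where i: "i < N" "x = ws ! i" using x by (metis in_set_conv_nth N_def)
      have "(\<Sum>k\<in>K. a k * f k x) = (\<Sum>l\<in>{0..<N}. a (ks ! l) * f (ks ! l) x)"
        by (rule sum.reindex_bij_betw[OF bk, symmetric])
      also have "\<dots> = (\<Sum>l\<in>{0..<N}. f (ks ! l) x * v $ l)"
        by (rule sum.cong[OF refl]) (simp add: av)
      also have "\<dots> = (P *\<^sub>v v) $ i" using i v(1) by (simp add: P_def scalar_prod_def)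
      also have "\<dots> = 0" using v(3) i by simp
      finally show ?thesis .
    qed
    then have "v $ i = 0" if "i < N" for i using ind[of a, OF _ kK[OF that]] av[OF that] by simp
    then show False using v(1,2) by (auto intro: eq_vecI)
  qed
  from det_non_zero_imp_unit[OF car(2) this, of "()"]
  obtain Q where Q: "Q * P = 1\<^sub>m N" "P * Q = 1\<^sub>m N" "Q \<in> carrier_mat N N"
    unfolding Units_def ring_mat_def by auto
  have "M = M * (P * Q)" using Q car by simp
  also have "\<dots> = (M * P) * Q" using Q car by (simp add: assoc_mult_mat[of _ N N _ N _ N])
  also have "\<dots> = P * D * Q" by (simp add: MP)
  finally have "similar_mat M D" using Q car by (intro similar_matI[of _ _ _ _ N]) auto
  then have "char_poly M = char_poly D" by (rule char_poly_similar)
  also have "\<dots> = (\<Prod>a\<leftarrow>diag_mat D. [:- a, 1:])"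
    by (rule char_poly_upper_triangular[OF car(3)]) (simp add: upper_triangular_def D_def)
  also have "diag_mat D = map e ks"
    by (rule nth_equalityI) (simp_all add: diag_mat_def D_def lk)
  also have "(\<Prod>a\<leftarrow>map e ks. [:- a, 1:]) = (\<Prod>k\<in>K. [:- e k, 1:])"
    using prod.distinct_set_conv_list[OF ks(2), of "\<lambda>k. [:- e k, 1:]"] ks(1) by (simp add: comp_def)
  finally show ?thesis by (simp add: M_def N_def)
qed

lemma char_poly_block_diag:
  fixes M :: "'a :: idom mat"
  assumes M: "M \<in> carrier_mat n n"
  shows "char_poly (four_block_mat M (0\<^sub>m n n) (0\<^sub>m n n) M) = (char_poly M)\<^sup>2"
proof -
  have "char_poly_matrix (four_block_mat M (0\<^sub>m n n) (0\<^sub>m n n) M) =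
    four_block_mat (char_poly_matrix M) (0\<^sub>m n n) (0\<^sub>m n n) (char_poly_matrix M)"
    using M by (intro eq_matI) (auto simp: char_poly_matrix_def)
  then show ?thesis
    using det_four_block_mat_upper_right_zero[of "char_poly_matrix M" n "0\<^sub>m n n" n "0\<^sub>m n n" "char_poly_matrix M"] M
    by (simp add: char_poly_def power2_eq_square)
qed

section \<open>The eigenbasis on the symmetric group\<close>

text \<open>Choosing the sign by the order of the last two contents treats the three cases of the theorem
uniformly.\<close>

definition ag_eigenvalue :: "nat \<Rightarrow> tableau \<Rightarrow> real" where
  "ag_eigenvalue n T =
     (if content_vector T (n - 1) < content_vector T n then 1 else - 1) *
     (content_vector T (n - 1) + content_vector T n) - 1"

definition tableau_pairs :: "nat \<Rightarrow> (tableau \<times> tableau) set" where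
  "tableau_pairs n = (\<Union>D\<in>{D. diagram D \<and> card D = n}. tableaux D \<times> tableaux D)"

lemma consecutive_contents_differ:
  assumes "diagram D" "T \<in> tableaux D" "1 \<le> i" "Suc i \<le> card D"
  shows "content_vector T i \<noteq> content_vector T (Suc i)"
  using consecutive_boxes[OF assms] unfolding content_vector_def box_content_def by linarith

lemma tableaux_disjoint: "T \<in> tableaux D \<Longrightarrow> T \<in> tableaux D' \<Longrightarrow> D = D'"
  using tableaux_support by blast

lemma prod_tableau_pairs:
  fixes F :: "tableau \<Rightarrow> 'a :: comm_monoid_mult"
  shows "(\<Prod>(S, T)\<in>tableau_pairs n. F T) =
    (\<Prod>D | diagram D \<and> card D = n. (\<Prod>T\<in>tableaux D. F T) ^ card (tableaux D))"
proof -
  have "(\<Prod>(S, T)\<in>tableau_pairs n. F T) =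
    (\<Prod>D | diagram D \<and> card D = n. \<Prod>(S, T)\<in>tableaux D \<times> tableaux D. F T)"
    unfolding tableau_pairs_def
    by (rule prod.UNION_disjoint)
      (auto simp: finite_diagrams finite_diagram finite_tableaux dest: tableaux_disjoint)
  also have "\<dots> = (\<Prod>D | diagram D \<and> card D = n. (\<Prod>T\<in>tableaux D. F T) ^ card (tableaux D))"
    by (rule prod.cong[OF refl]) (simp add: prod.cartesian_product[symmetric])
  finally show ?thesis .
qed

lemma finite_tableau_pairs: "finite (tableau_pairs n)"
  unfolding tableau_pairs_def by (auto simp: finite_diagrams finite_diagram finite_tableaux)

lemma card_tableau_pairs: "card (tableau_pairs n) = fact n"
proof -
  have "card (tableau_pairs n) = (\<Sum>D | diagram D \<and> card D = n. card (tableaux D \<times> tableaux D))"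
    unfolding tableau_pairs_def
    by (rule card_UN_disjoint)
      (auto simp: finite_diagrams finite_diagram finite_tableaux dest: tableaux_disjoint)
  then show ?thesis
    using sum_card_tableaux_squares[of n] by (simp add: card_cartesian_product power2_eq_square)
qed

text \<open>Only two boxes are left for the last two entries.\<close>

lemma agree_below_last_two:
  assumes D: "diagram D" and T: "T \<in> tableaux D" and T': "T' \<in> tableaux D" and n: "card D = Suc m" "1 \<le> m"
    and eq: "\<And>i. 1 \<le> i \<Longrightarrow> i < m \<Longrightarrow> box_of T i = box_of T' i"
  shows "T = T' \<or> box_of T m = box_of T' (Suc m) \<and> box_of T (Suc m) = box_of T' m"
proof -
  have last: "T (box_of T' i) \<in> {m, Suc m}" if i: "i \<in> {m, Suc m}" for i
  proof (rule ccontr)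
    assume "\<not> ?thesis"
    moreover have iD: "box_of T' i \<in> D" using box_of_entry(1)[OF T', of i] i n by auto
    ultimately have r: "1 \<le> T (box_of T' i)" "T (box_of T' i) < m"
      using tableaux_range[OF T iD] n by auto
    then have "box_of T' (T (box_of T' i)) = box_of T' i"
      using eq[OF r] box_of_eq[OF T iD] by simp
    then have "T (box_of T' i) = i"
      using box_of_inj[OF T', of "T (box_of T' i)" i] r i n by auto
    then show False using r i by auto
  qed
  have recover: "box_of T j = box_of T' i" if "T (box_of T' i) = j" "i \<in> {m, Suc m}" for i j
    using box_of_eq[OF T, of "box_of T' i"] box_of_entry(1)[OF T', of i] that n by auto
  have ne: "box_of T' m \<noteq> box_of T' (Suc m)" using box_of_inj[OF T', of m "Suc m"] n by auto
  show ?thesis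
  proof (cases "T (box_of T' m) = m")
    case True
    then have 1: "box_of T m = box_of T' m" using recover by blast
    have "T (box_of T' (Suc m)) = Suc m"
    proof (rule ccontr)
      assume "\<not> ?thesis"
      then have "T (box_of T' (Suc m)) = m" using last[of "Suc m"] by auto
      then have "box_of T m = box_of T' (Suc m)" using recover by blast
      then show False using 1 ne by simp
    qed
    then have 2: "box_of T (Suc m) = box_of T' (Suc m)" using recover by blast
    have "T = T'"
    proof (rule tableaux_eqI[OF T T' refl])
      fix i assume "1 \<le> i" "i \<le> card D"
      then consider "1 \<le> i" "i < m" | "i = m" | "i = Suc m" using n by linarith
      then show "box_of T i = box_of T' i" by cases (use 1 2 eq in auto)
    qed
    then show ?thesis ..
  next
    case False
    then have "T (box_of T' m) = Suc m" using last[of m] by auto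
    then have 1: "box_of T (Suc m) = box_of T' m" using recover by blast
    have "T (box_of T' (Suc m)) = m"
    proof (rule ccontr)
      assume "\<not> ?thesis"
      then have "T (box_of T' (Suc m)) = Suc m" using last[of "Suc m"] by auto
      then have "box_of T (Suc m) = box_of T' (Suc m)" using recover by blast
      then show False using 1 ne by simp
    qed
    then have "box_of T m = box_of T' (Suc m)" using recover by blast
    then show ?thesis using 1 by simp
  qed
qed

text \<open>The sum of the generators, with their labels reversed, acting on \<open>h\<close>.\<close>

definition ag_sum :: "nat \<Rightarrow> ((nat \<Rightarrow> nat) \<Rightarrow> real) \<Rightarrow> (nat \<Rightarrow> nat) \<Rightarrow> real" where
  "ag_sum m h g = (\<Sum>j\<in>{1..<m}.
     h (g \<circ> Transposition.transpose m (Suc m) \<circ> Transposition.transpose j (Suc m)) +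
     h (g \<circ> Transposition.transpose m (Suc m) \<circ> Transposition.transpose j m))"

text \<open>The functions of \<open>sign_eigenfunction\<close> are independent because the following joint eigenvalues separate
them: the contents of \<open>S\<close> determine \<open>S\<close> and so the shape; the contents of all but the last two
entries of \<open>T\<close> then leave at most two tableaux, obtained from each other by exchanging these
entries, and they have opposite eigenvalues under \<open>s\<close>.\<close>

lemma ag_eigenbasis:
  assumes n: "n = Suc m" "1 \<le> m"
  obtains h where
    "\<And>k g. k \<in> tableau_pairs n \<Longrightarrow> g permutes {1..n} \<Longrightarrow>
      ag_sum m (h k) g = ag_eigenvalue n (snd k) * h k g"
    "\<And>a k. (\<And>g. g permutes {1..n} \<Longrightarrow> (\<Sum>k\<in>tableau_pairs n. a k * h k g) = 0) \<Longrightarrow>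
      k \<in> tableau_pairs n \<Longrightarrow> a k = (0 :: real)"
proof -
  let ?A = "{1..Suc m}" and ?s = "Transposition.transpose m (Suc m)" and ?K = "tableau_pairs n"
  define sg where "sg T = (if content_vector T m < content_vector T (Suc m) then 1 else - 1 :: real)" for T
  define good where "good k h \<longleftrightarrow> (\<exists>g. g permutes ?A \<and> h g \<noteq> 0) \<and>
    (\<forall>g. g permutes ?A \<longrightarrow>
      (\<forall>i\<in>?A. (\<Sum>j\<in>{1..<i}. h (Transposition.transpose j i \<circ> g)) = content_vector (fst k) i * h g) \<and>
      (\<forall>i\<in>{1..<m}. (\<Sum>j\<in>{1..<i}. h (g \<circ> Transposition.transpose j i)) = content_vector (snd k) i * h g) \<and>
      h (g \<circ> ?s) = sg (snd k) * h g \<and> ag_sum m h g = ag_eigenvalue n (snd k) * h g)"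
    for k :: "tableau \<times> tableau" and h :: "(nat \<Rightarrow> nat) \<Rightarrow> real"
  have "\<exists>h. good k h" if k: "k \<in> ?K" for k
  proof -
    obtain D S T where D: "diagram D" "card D = Suc m" and ST: "S \<in> tableaux D" "T \<in> tableaux D"
      and kST: "k = (S, T)" using k n by (auto simp: tableau_pairs_def)
    obtain f where f: "jm_eigen (Suc m) f (content_vector S) (content_vector T)"
      using jm_eigen_exists[OF D(1) ST] D(2) by auto
    have ne: "content_vector T m \<noteq> content_vector T (Suc m)"
      using consecutive_contents_differ[OF D(1) ST(2) n(2)] D(2) by simp
    show ?thesis
    proof (rule sign_eigenfunction[OF f n(2) ne, folded sg_def], goal_cases)
      case h: (1 h)
      have "good k h" unfolding good_def
    proof (intro conjI allI impI ballI)
      fix g assume g: "g permutes ?A"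
      show "ag_sum m h g = ag_eigenvalue n (snd k) * h g"
        unfolding ag_sum_def h(5)[OF g] by (simp add: ag_eigenvalue_def kST n sg_def)
    qed (use h(1-4) kST in simp_all)
      then show ?case by blast
    qed
  qed
  then obtain h where h: "good k (h k)" if "k \<in> ?K" for k by metis
  show ?thesis
  proof (rule that[of h])
    fix k g assume "k \<in> ?K" "g permutes {1..n}"
    then show "ag_sum m (h k) g = ag_eigenvalue n (snd k) * h k g"
      using h[of k] unfolding good_def n(1) by blast
  next
    fix a :: "tableau \<times> tableau \<Rightarrow> real" and k
    assume z: "\<And>g. g permutes {1..n} \<Longrightarrow> (\<Sum>k\<in>?K. a k * h k g) = 0" and k: "k \<in> ?K"
    \<comment> \<open>The operators are indexed by a side (\<open>True\<close> for left) and an entry. Index \<open>(False, Suc m)\<close> has only the summand \<open>m\<close>, which makes it right multiplication by \<open>s\<close> instead of a Jucys-Murphy element.\<close>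
    define act :: "bool \<times> nat \<Rightarrow> nat \<Rightarrow> (nat \<Rightarrow> nat) \<Rightarrow> nat \<Rightarrow> nat" where
      "act = (\<lambda>(l, i) t g. if l then Transposition.transpose t i \<circ> g else g \<circ> Transposition.transpose t i)"
    define N :: "bool \<times> nat \<Rightarrow> nat set" where
      "N = (\<lambda>(l, i). if \<not> l \<and> i = Suc m then {m} else {1..<i})"
    define J where "J = (Pair True ` ?A) \<union> (Pair False ` {1..<m}) \<union> {(False, Suc m)}"
    define c :: "tableau \<times> tableau \<Rightarrow> bool \<times> nat \<Rightarrow> real" where
      "c = (\<lambda>(S, T) (l, i). if l then content_vector S i else if i = Suc m then sg T else content_vector T i)"
    show "a k = 0"
    proof (rule joint_eigenfunctions_independent[where K = ?K and J = J and N = N and c = c and f = h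
          and X = "{g. g permutes ?A}" and act = act])
      show "finite ?K" by (rule finite_tableau_pairs)
      show "act j t g \<in> {g. g permutes ?A}"
        if "j \<in> J" "t \<in> N j" "g \<in> {g. g permutes ?A}" for j t g
        using that n(2) by (auto simp: J_def N_def act_def intro!: permutes_transpose_comp)
      show "(\<Sum>t\<in>N j. h k (act j t g)) = c k j * h k g"
        if k: "k \<in> ?K" and j: "j \<in> J" and g: "g \<in> {g. g permutes ?A}" for k j g
      proof -
        have G: "good k (h k)" by (rule h[OF k])
        have g': "g permutes ?A" using g by simp
        from j consider i where "j = (True, i)" "i \<in> ?A" | i where "j = (False, i)" "i \<in> {1..<m}"
          | "j = (False, Suc m)" unfolding J_def by blast
        then show ?thesis
        proof cases
          case 1
          then show ?thesis using G g' by (simp add: good_def N_def act_def c_def split_beta)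
        next
          case 2
          then show ?thesis using G g' by (simp add: good_def N_def act_def c_def split_beta)
        next
          case 3
          then show ?thesis using G g' by (simp add: good_def N_def act_def c_def split_beta)
        qed
      qed
      show "\<exists>g\<in>{g. g permutes ?A}. h k g \<noteq> 0" if "k \<in> ?K" for k
        using h[OF that] by (auto simp: good_def)
      show "\<exists>j\<in>J. c k j \<noteq> c l j" if k: "k \<in> ?K" and l: "l \<in> ?K" and kl: "k \<noteq> l" for k l
      proof (rule ccontr)
        assume "\<not> ?thesis"
        then have eq: "c k j = c l j" if "j \<in> J" for j using that by blast
        obtain D S T where D: "diagram D" "card D = Suc m" and ST: "S \<in> tableaux D" "T \<in> tableaux D"
          and kST: "k = (S, T)" using k n by (auto simp: tableau_pairs_def)
        obtain D' S' T' where D': "diagram D'" "card D' = Suc m"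
          and ST': "S' \<in> tableaux D'" "T' \<in> tableaux D'"
          and lST: "l = (S', T')" using l n by (auto simp: tableau_pairs_def)
        have "content_vector S i = content_vector S' i" if "1 \<le> i" "i \<le> Suc m" for i
          using eq[of "(True, i)"] that by (simp add: J_def c_def kST lST)
        then have cS: "box_content (box_of S i) = box_content (box_of S' i)" if "1 \<le> i" "i \<le> Suc m" for i
          using that by (simp add: content_vector_def)
        have "box_of S i = box_of S' i" if "1 \<le> i" "i \<le> Suc m" for i
          using contents_determine_boxes[OF D(1) D'(1) ST(1) ST'(1) _ _ cS that] D(2) D'(2) by simp
        then have S: "S = S'" using tableaux_eqI[OF ST(1) ST'(1)] D(2) D'(2) by simp
        then have DD: "D = D'" using tableaux_disjoint ST(1) ST'(1) by blast
        have T': "T' \<in> tableaux D" using ST'(2) DD by simp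
        have "content_vector T i = content_vector T' i" if "1 \<le> i" "i < m" for i
          using eq[of "(False, i)"] that by (simp add: J_def c_def kST lST)
        then have cT: "box_content (box_of T i) = box_content (box_of T' i)" if "1 \<le> i" "i \<le> m - 1" for i
          using that by (simp add: content_vector_def)
        have "box_of T i = box_of T' i" if "1 \<le> i" "i < m" for i
          using contents_determine_boxes[OF D(1) D(1) ST(2) T' _ _ cT, of i] that D(2) by simp
        then have "T = T' \<or> box_of T m = box_of T' (Suc m) \<and> box_of T (Suc m) = box_of T' m"
          by (rule agree_below_last_two[OF D(1) ST(2) T' D(2) n(2)])
        moreover have "sg T = sg T'"
          using eq[of "(False, Suc m)"] by (simp add: J_def c_def kST lST)
        moreover have "content_vector T m \<noteq> content_vector T (Suc m)"
          using consecutive_contents_differ[OF D(1) ST(2) n(2)] D(2) by simp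
        ultimately have "T = T'"
          by (auto simp: sg_def content_vector_def split: if_splits)
        then show False using S kST lST kl by simp
      qed
      show "(\<Sum>k\<in>?K. a k * h k g) = 0" if "g \<in> {g. g permutes ?A}" for g
        using z[of g] that n(1) by simp
    qed (rule k)
  qed
qed

section \<open>From the symmetric to the alternating group\<close>

definition ag_generators :: "nat \<Rightarrow> (nat \<Rightarrow> nat) set" where
  "ag_generators n = {cycle_of_list [1, i, 2] | i. 3 \<le> i \<and> i \<le> n} \<union>
      {cycle_of_list [1, 2, i] | i. 3 \<le> i \<and> i \<le> n}"

lemma sum_ag_generators:
  fixes F :: "(nat \<Rightarrow> nat) \<Rightarrow> real"
  shows "(\<Sum>s\<in>ag_generators n. F s) =
    (\<Sum>i\<in>{3..n}. F (cycle_of_list [1, i, 2]) + F (cycle_of_list [1, 2, i]))"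
proof -
  have v: "cycle_of_list [1, i, 2] 1 = i" "cycle_of_list [1, i, 2] 2 = 1"
    "cycle_of_list [1, 2, i] 2 = i" "cycle_of_list [1, 2, i] 1 = 2" if "3 \<le> i" for i :: nat
    using that by (simp_all add: Transposition.transpose_def)
  have e: "ag_generators n = (\<lambda>i. cycle_of_list [1, i, 2]) ` {3..n} \<union> (\<lambda>i. cycle_of_list [1, 2, i]) ` {3..n}"
    by (auto simp: ag_generators_def)
  have i1: "inj_on (\<lambda>i::nat. cycle_of_list [1, i, 2]) {3..n}"
    by (rule inj_onI) (metis v(1) atLeastAtMost_iff)
  have i2: "inj_on (\<lambda>i::nat. cycle_of_list [1, 2, i]) {3..n}"
    by (rule inj_onI) (metis v(3) atLeastAtMost_iff)
  have d: "(\<lambda>i. cycle_of_list [1, i, 2]) ` {3..n} \<inter> (\<lambda>i. cycle_of_list [1, 2, i]) ` {3..n} = {}"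
  proof (rule equals0I)
    fix x assume "x \<in> (\<lambda>i. cycle_of_list [1, i, 2]) ` {3..n} \<inter> (\<lambda>i. cycle_of_list [1, 2, i]) ` {3..n}"
    then obtain i j :: nat where "3 \<le> i" "3 \<le> j" "cycle_of_list [1, i, 2] = cycle_of_list [1, 2, j]"
      by (auto simp del: cycle_of_list.simps)
    then show False using v(1)[of i] v(4)[of j] by (simp del: cycle_of_list.simps)
  qed
  show ?thesis
    unfolding e sum.distrib sum.union_disjoint[OF finite_imageI[OF finite_atLeastAtMost]
      finite_imageI[OF finite_atLeastAtMost] d]
    by (simp only: sum.reindex[OF i1] sum.reindex[OF i2] comp_def)
qed

text \<open>Reversing the labels turns \<open>1\<close> and \<open>2\<close> into \<open>m + 1\<close> and \<open>m\<close>; then the \<open>3\<close>-cycles are \<open>s (j, m + 1)\<close>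
and \<open>s (j, m)\<close>.\<close>

lemma reversal_conjugates_generators:
  fixes m :: nat
  assumes m: "1 \<le> m"
  defines "\<phi> \<equiv> (\<lambda>i. if i \<in> {1..Suc m} then Suc (Suc m) - i else i)"
  shows "(\<Sum>s\<in>ag_generators (Suc m). F (g \<circ> s \<circ> \<phi>)) = ag_sum m F (g \<circ> \<phi>)"
proof -
  have inv: "\<phi> \<circ> \<phi> = id" by (auto simp: \<phi>_def fun_eq_iff)
  then have inj: "inj \<phi>" by (metis inj_on_id inj_on_imageI2)
  have t: "Transposition.transpose (\<phi> a) (\<phi> b) \<circ> \<phi> = \<phi> \<circ> Transposition.transpose a b" for a b
    using comp_transpose[OF inj] by simp
  have v: "\<phi> (Suc m) = 1" "\<phi> m = 2" using m by (auto simp: \<phi>_def)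
  have c: "cycle_of_list [1, \<phi> j, 2] \<circ> \<phi> = \<phi> \<circ> Transposition.transpose m (Suc m) \<circ> Transposition.transpose j (Suc m)"
    "cycle_of_list [1, 2, \<phi> j] \<circ> \<phi> = \<phi> \<circ> Transposition.transpose m (Suc m) \<circ> Transposition.transpose j m"
    if j: "j \<in> {1..<m}" for j
  proof -
    have "cycle_of_list [1, \<phi> j, 2] \<circ> \<phi> = \<phi> \<circ> (Transposition.transpose (Suc m) j \<circ> Transposition.transpose j m)"
      using t[of "Suc m" j] t[of j m] unfolding v by (simp add: comp_assoc) (metis comp_assoc)
    also have "Transposition.transpose (Suc m) j \<circ> Transposition.transpose j m =
      Transposition.transpose m (Suc m) \<circ> Transposition.transpose j (Suc m)"
      using j by (auto simp: fun_eq_iff Transposition.transpose_def)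
    finally show "cycle_of_list [1, \<phi> j, 2] \<circ> \<phi> = \<phi> \<circ> Transposition.transpose m (Suc m) \<circ> Transposition.transpose j (Suc m)"
      by (simp only: comp_assoc)
    have "cycle_of_list [1, 2, \<phi> j] \<circ> \<phi> = \<phi> \<circ> (Transposition.transpose (Suc m) m \<circ> Transposition.transpose m j)"
      using t[of "Suc m" m] t[of m j] unfolding v by (simp add: comp_assoc) (metis comp_assoc)
    then show "cycle_of_list [1, 2, \<phi> j] \<circ> \<phi> = \<phi> \<circ> Transposition.transpose m (Suc m) \<circ> Transposition.transpose j m"
      by (simp only: comp_assoc transpose_commute)
  qed
  have "(\<Sum>s\<in>ag_generators (Suc m). F (g \<circ> s \<circ> \<phi>)) =
    (\<Sum>i\<in>{3..Suc m}. F (g \<circ> cycle_of_list [1, i, 2] \<circ> \<phi>) + F (g \<circ> cycle_of_list [1, 2, i] \<circ> \<phi>))"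
    by (rule sum_ag_generators)
  also have "\<dots> = (\<Sum>j\<in>{1..<m}. F (g \<circ> cycle_of_list [1, \<phi> j, 2] \<circ> \<phi>) + F (g \<circ> cycle_of_list [1, 2, \<phi> j] \<circ> \<phi>))"
    by (rule sum.reindex_bij_witness[of _ \<phi> \<phi>]) (auto simp: \<phi>_def simp del: cycle_of_list.simps)
  also have "\<dots> = ag_sum m F (g \<circ> \<phi>)"
    unfolding ag_sum_def
  proof (rule sum.cong[OF refl])
    fix j assume j: "j \<in> {1..<m}"
    show "F (g \<circ> cycle_of_list [1, \<phi> j, 2] \<circ> \<phi>) + F (g \<circ> cycle_of_list [1, 2, \<phi> j] \<circ> \<phi>) =
      F (g \<circ> \<phi> \<circ> Transposition.transpose m (Suc m) \<circ> Transposition.transpose j (Suc m)) +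
      F (g \<circ> \<phi> \<circ> Transposition.transpose m (Suc m) \<circ> Transposition.transpose j m)"
      unfolding comp_assoc[of g] c[OF j] by (simp add: comp_assoc)
  qed
  finally show ?thesis .
qed

lemma ag_generators_even:
  assumes "s \<in> ag_generators n"
  shows "s permutes {1..n}" "evenperm s"
proof -
  obtain i where i: "3 \<le> i" "i \<le> n" and s: "s = cycle_of_list [1, i, 2] \<or> s = cycle_of_list [1, 2, i]"
    using assms by (auto simp: ag_generators_def)
  have "set [1, i, 2] \<subseteq> {1..n}" "set [1, 2, i] \<subseteq> {1..n}" using i by auto
  then show "s permutes {1..n}"
    using s cycle_permutes[of "[1, i, 2]"] cycle_permutes[of "[1, 2, i]"] permutes_subset by blast
  show "evenperm s" using s i
    by (auto simp: evenperm_comp permutation_swap_id permutation_compose evenperm_swap)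
qed

text \<open>List the symmetric group as the even permutations followed by their products with \<open>(1, 2)\<close> from the
left. Right multiplication by an even permutation preserves the two halves and acts on both in the
same way, so the matrix of the sum of the generators consists of two diagonal blocks, both equal to
the adjacency matrix. Its characteristic polynomial is known from the eigenbasis.\<close>

theorem char_poly_AG_squared:
  assumes n: "n \<ge> 2" and vs: "distinct vs" "set vs = pverts (AG n)"
  shows "(char_poly (adjacency_matrix (AG n) vs))\<^sup>2 =
    (\<Prod>D | diagram D \<and> card D = n. (\<Prod>T\<in>tableaux D. [:- ag_eigenvalue n T, 1:]) ^ card (tableaux D))"
proof -
  obtain m where m: "n = Suc m" "1 \<le> m" using n by (metis Suc_le_D Suc_le_mono numeral_2_eq_2 One_nat_def)
  let ?G = "ag_generators n"
  have verts: "set vs = {p. p permutes {1..n} \<and> evenperm p}"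
    unfolding vs(2) by (simp add: AG_def cayley_graph_def alt_group_def)
  define \<alpha> :: "(nat \<Rightarrow> nat) \<Rightarrow> (nat \<Rightarrow> nat) \<Rightarrow> real" where "\<alpha> g g' = (if \<exists>s\<in>?G. g' = g \<circ> s then 1 else 0)" for g g'
  let ?t = "Transposition.transpose 1 (2::nat)"
  have tt: "?t \<circ> (?t \<circ> g) = g" for g :: "nat \<Rightarrow> nat" by (simp add: comp_assoc[symmetric])
  have t12: "1 \<in> {1..n}" "2 \<in> {1..n}" using n by auto
  have perm: "permutation p" if "p permutes {1..n}" for p
    using that permutation_permutes by blast
  have et: "evenperm (?t \<circ> g) \<longleftrightarrow> \<not> evenperm g" if "g permutes {1..n}" for g
    using evenperm_comp[OF permutation_swap_id perm[OF that], of 1 2] by (simp add: evenperm_swap)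
  have es: "evenperm (g \<circ> s) \<longleftrightarrow> evenperm g" if "g permutes {1..n}" "s \<in> ?G" for g s
    using evenperm_comp[OF perm[OF that(1)] perm[OF ag_generators_even(1)[OF that(2)]]]
      ag_generators_even(2)[OF that(2)] by simp
  have ps: "g \<circ> s permutes {1..n}" if "g permutes {1..n}" "s \<in> ?G" for g s
    using permutes_compose[OF ag_generators_even(1)[OF that(2)] that(1)] .
  define ws where "ws = vs @ map ((\<circ>) ?t) vs"
  have set_ws: "set ws = {p. p permutes {1..n}}"
  proof (intro equalityI subsetI)
    fix p assume "p \<in> set ws"
    then show "p \<in> {p. p permutes {1..n}}"
      using permutes_transpose_comp(1)[OF _ t12] by (auto simp: ws_def verts)
  next
    fix p assume "p \<in> {p. p permutes {1..n}}"
    then have p: "p permutes {1..n}" by simp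
    show "p \<in> set ws"
    proof (cases "evenperm p")
      case True then show ?thesis using p by (simp add: ws_def verts)
    next
      case False
      then have "?t \<circ> p \<in> set vs"
        using permutes_transpose_comp(1)[OF p t12] et[OF p] by (simp add: verts)
      then have "?t \<circ> (?t \<circ> p) \<in> set (map ((\<circ>) ?t) vs)" by (simp only: set_map) (rule imageI)
      then show ?thesis unfolding tt ws_def set_append by (rule UnI2)
    qed
  qed
  have dist: "distinct ws"
  proof -
    have "inj_on ((\<circ>) ?t) (set vs)" by (rule inj_onI) (metis tt)
    moreover have "set vs \<inter> (\<circ>) ?t ` set vs = {}" using et by (auto simp: verts)
    ultimately show ?thesis using vs(1) by (simp add: ws_def distinct_map)
  qed
  have len: "length ws = fact n"
    using distinct_card[OF dist] card_permutations[of "{1..n}" n] by (simp add: set_ws)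
  define N where "N = length vs"
  define M where "M = adjacency_matrix (AG n) vs"
  have M: "M \<in> carrier_mat N N" by (simp add: M_def adjacency_matrix_def N_def)
  have arcs: "(g, g') \<in> parcs (AG n) \<longleftrightarrow> g \<in> set vs \<and> (\<exists>s\<in>?G. g' = g \<circ> s)" for g g'
    unfolding verts AG_def cayley_graph_def ag_generators_def
    by (auto simp: alt_group_def sym_group_def simp del: cycle_of_list.simps)
  have Mij: "M $$ (i, j) = \<alpha> (vs ! i) (vs ! j)" if "i < N" "j < N" for i j
    using that by (simp add: M_def adjacency_matrix_def arcs \<alpha>_def N_def)
  have same: "\<alpha> (?t \<circ> g) (?t \<circ> g') = \<alpha> g g'" for g g'
  proof -
    have "?t \<circ> g' = ?t \<circ> g \<circ> s \<longleftrightarrow> g' = g \<circ> s" for s by (metis tt comp_assoc)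
    then show ?thesis by (simp add: \<alpha>_def)
  qed
  have diff: "\<alpha> (?t \<circ> g) g' = 0" "\<alpha> g (?t \<circ> g') = 0" if "g \<in> set vs" "g' \<in> set vs" for g g'
  proof -
    have g: "g permutes {1..n}" "evenperm g" "g' permutes {1..n}" "evenperm g'"
      using that by (auto simp: verts)
    have tg: "?t \<circ> g permutes {1..n}" by (rule permutes_transpose_comp(1)[OF g(1) t12])
    show "\<alpha> (?t \<circ> g) g' = 0" using es[OF tg] et[OF g(1)] g by (auto simp: \<alpha>_def)
    show "\<alpha> g (?t \<circ> g') = 0"
    proof -
      have "?t \<circ> g' \<noteq> g \<circ> s" if "s \<in> ?G" for s
        using es[OF g(1) that] et[OF g(3)] g by metis
      then show ?thesis by (simp add: \<alpha>_def)
    qed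
  qed
  have block: "mat (length ws) (length ws) (\<lambda>(i, j). \<alpha> (ws ! i) (ws ! j)) =
    four_block_mat M (0\<^sub>m N N) (0\<^sub>m N N) M"
  proof (rule eq_matI)
    fix i j assume "i < dim_row (four_block_mat M (0\<^sub>m N N) (0\<^sub>m N N) M)"
      "j < dim_col (four_block_mat M (0\<^sub>m N N) (0\<^sub>m N N) M)"
    then have ij: "i < N + N" "j < N + N" using M by auto
    have lws: "length ws = N + N" by (simp add: ws_def N_def)
    have nth: "ws ! i = (if i < N then vs ! i else ?t \<circ> vs ! (i - N))" if "i < N + N" for i
      using that by (simp add: ws_def N_def nth_append)
    have vin: "vs ! i \<in> set vs" if "i < N" for i using that by (simp add: N_def)
    show "mat (length ws) (length ws) (\<lambda>(i, j). \<alpha> (ws ! i) (ws ! j)) $$ (i, j) =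
      four_block_mat M (0\<^sub>m N N) (0\<^sub>m N N) M $$ (i, j)"
      using ij M lws by (simp add: nth Mij same diff vin del: One_nat_def)
  qed (use M in \<open>simp_all add: ws_def N_def\<close>)
  define \<phi> where "\<phi> = (\<lambda>i. if i \<in> {1..Suc m} then Suc (Suc m) - i else i)"
  have \<phi>\<phi>: "\<phi> \<circ> \<phi> = id" by (auto simp: \<phi>_def fun_eq_iff)
  have "bij_betw \<phi> {1..n} {1..n}"
    by (rule bij_betw_byWitness[of _ \<phi>]) (auto simp: \<phi>_def m)
  then have \<phi>p: "\<phi> permutes {1..n}" by (rule bij_imp_permutes) (auto simp: \<phi>_def m)
  show ?thesis
  proof (rule ag_eigenbasis[OF m], goal_cases)
    case h: (1 h)
    define f where "f k g = h k (g \<circ> \<phi>)" for k g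
    have "char_poly (mat (length ws) (length ws) (\<lambda>(i, j). \<alpha> (ws ! i) (ws ! j))) =
      (\<Prod>k\<in>tableau_pairs n. [:- ag_eigenvalue n (snd k), 1:])"
    proof (rule char_poly_eigenbasis[where f = f, OF dist finite_tableau_pairs])
      show "card (tableau_pairs n) = length ws" by (simp add: card_tableau_pairs len)
    next
      fix k g assume k: "k \<in> tableau_pairs n" and "g \<in> set ws"
      then have g: "g permutes {1..n}" by (simp add: set_ws)
      have finG: "finite ?G"
        by (rule finite_subset[OF _ finite_permutations[of "{1..n}"]]) (auto dest: ag_generators_even(1))
      have injg: "inj_on ((\<circ>) g) ?G"
        using permutes_inj[OF g] by (auto simp: inj_on_def fun_eq_iff)
      have "(\<Sum>y\<in>set ws. \<alpha> g y * f k y) = (\<Sum>y\<in>(\<circ>) g ` ?G. f k y)"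
      proof (rule sum.mono_neutral_cong_right)
        show "(\<circ>) g ` ?G \<subseteq> set ws" using ps[OF g] by (auto simp: set_ws)
      qed (auto simp: \<alpha>_def)
      also have "\<dots> = (\<Sum>s\<in>?G. f k (g \<circ> s))" by (simp add: sum.reindex[OF injg])
      also have "\<dots> = ag_sum m (h k) (g \<circ> \<phi>)"
        unfolding f_def m(1) \<phi>_def by (rule reversal_conjugates_generators[OF m(2)])
      also have "\<dots> = ag_eigenvalue n (snd k) * f k g"
        unfolding f_def by (rule h(1)[OF k permutes_compose[OF \<phi>p g]])
      finally show "(\<Sum>y\<in>set ws. \<alpha> g y * f k y) = ag_eigenvalue n (snd k) * f k g" .
    next
      fix a :: "tableau \<times> tableau \<Rightarrow> real" and k
      assume z: "\<And>g. g \<in> set ws \<Longrightarrow> (\<Sum>k\<in>tableau_pairs n. a k * f k g) = 0" and k: "k \<in> tableau_pairs n"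
      show "a k = 0"
      proof (rule h(2)[OF _ k])
        fix g assume g: "g permutes {1..n}"
        have "g \<circ> \<phi> \<in> set ws" using permutes_compose[OF \<phi>p g] by (simp add: set_ws)
        from z[OF this] show "(\<Sum>k\<in>tableau_pairs n. a k * h k g) = 0"
          by (simp add: f_def comp_assoc \<phi>\<phi>)
      qed
    qed
    also have "\<dots> = (\<Prod>(S, T)\<in>tableau_pairs n. [:- ag_eigenvalue n T, 1:])"
      by (simp add: split_beta)
    also have "\<dots> = (\<Prod>D | diagram D \<and> card D = n. (\<Prod>T\<in>tableaux D. [:- ag_eigenvalue n T, 1:]) ^ card (tableaux D))"
      by (rule prod_tableau_pairs)
    finally show ?case unfolding block char_poly_block_diag[OF M] by (simp add: M_def)
  qed
qed

section \<open>Partitions and their diagrams\<close>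

lemma young_diagram_part: "(u, v) \<in> young_diagram \<mu> \<longleftrightarrow> v < part \<mu> u"
  by (auto simp: young_diagram_def part_def)

lemma young_diagram_partition:
  assumes "\<mu> \<in> partitions n"
  shows "diagram (young_diagram \<mu>)" "card (young_diagram \<mu>) = n"
proof -
  have s: "sorted_wrt (\<ge>) \<mu>" "sum_list \<mu> = n" using assms by (auto simp: partitions_def)
  have e: "young_diagram \<mu> = (SIGMA u:{..<length \<mu>}. {..<\<mu> ! u})" by (auto simp: young_diagram_def)
  have le: "\<mu> ! u \<le> \<mu> ! u'" if "u' \<le> u" "u < length \<mu>" for u u'
    using sorted_wrt_nth_less[OF s(1), of u' u] that by (cases "u' = u") auto
  show "diagram (young_diagram \<mu>)"
    unfolding diagram_def
  proof (intro conjI allI impI)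
    show "finite (young_diagram \<mu>)" unfolding e by simp
    fix u v u' v' assume *: "(u, v) \<in> young_diagram \<mu> \<and> u' \<le> u \<and> v' \<le> v"
    then show "(u', v') \<in> young_diagram \<mu>"
      using le[of u' u] by (simp add: young_diagram_def)
  qed
  have "card (young_diagram \<mu>) = (\<Sum>u<length \<mu>. \<mu> ! u)" unfolding e by (subst card_SigmaI) auto
  also have "\<dots> = n" using s(2) by (simp add: sum_list_sum_nth atLeast0LessThan)
  finally show "card (young_diagram \<mu>) = n" .
qed

lemma SYT_tableaux: "\<mu> \<in> partitions n \<Longrightarrow> SYT \<mu> = tableaux (young_diagram \<mu>)"
  using young_diagram_partition(2)[of \<mu> n] by (simp add: SYT_def tableaux_def partitions_def)

lemma part_inj:
  assumes "\<mu> \<in> partitions n" "\<nu> \<in> partitions n'" "part \<mu> = part \<nu>"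
  shows "\<mu> = \<nu>"
proof -
  have pos: "part \<mu> i > 0 \<longleftrightarrow> i < length \<mu>" if "\<mu> \<in> partitions n" for \<mu> n i
  proof -
    have "0 \<notin> set \<mu>" using that by (simp add: partitions_def)
    then have "\<mu> ! i \<noteq> 0" if "i < length \<mu>" using nth_mem[OF that] by metis
    then show ?thesis by (simp add: part_def)
  qed
  have "i < length \<mu> \<longleftrightarrow> i < length \<nu>" for i
    using pos[OF assms(1), of i] pos[OF assms(2), of i] unfolding assms(3) by (rule trans[OF sym])
  from this[of "length \<mu>"] this[of "length \<nu>"] have len: "length \<mu> = length \<nu>" by linarith
  show ?thesis
  proof (rule nth_equalityI[OF len])
    fix i assume "i < length \<mu>"
    then show "\<mu> ! i = \<nu> ! i" using fun_cong[OF assms(3), of i] len by (simp add: part_def)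
  qed
qed

lemma young_diagram_inj:
  assumes "\<mu> \<in> partitions n" "\<nu> \<in> partitions n'" "young_diagram \<mu> = young_diagram \<nu>"
  shows "\<mu> = \<nu>"
proof (rule part_inj[OF assms(1,2)])
  show "part \<mu> = part \<nu>"
  proof
    fix u
    have "v < part \<mu> u \<longleftrightarrow> v < part \<nu> u" for v
      unfolding young_diagram_part[symmetric] assms(3) ..
    from this[of "part \<mu> u"] this[of "part \<nu> u"] show "part \<mu> u = part \<nu> u" by linarith
  qed
qed

definition row_lengths :: "(nat \<times> nat) set \<Rightarrow> nat list" where
  "row_lengths D = map (\<lambda>u. card {v. (u, v) \<in> D}) [0..<card {u. (u, 0) \<in> D}]"

lemma young_diagram_row_lengths:
  assumes D: "diagram D"
  shows "young_diagram (row_lengths D) = D" "row_lengths D \<in> partitions (card D)"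
proof -
  have fin: "finite D" by (rule finite_diagram[OF D])
  have row: "{v. (u, v) \<in> D} = {..<card {v. (u, v) \<in> D}}" for u
  proof (rule finite_initial_segment)
    show "finite {v. (u, v) \<in> D}" by (rule finite_subset[of _ "snd ` D"]) (use fin in force)+
    show "j \<in> {v. (u, v) \<in> D}" if "i \<in> {v. (u, v) \<in> D}" "j \<le> i" for i j
      using diagramD[OF D, of u i u j] that by simp
  qed
  have col: "{u. (u, 0) \<in> D} = {..<card {u. (u, 0) \<in> D}}"
  proof (rule finite_initial_segment)
    show "finite {u. (u, 0) \<in> D}" by (rule finite_subset[of _ "fst ` D"]) (use fin in force)+
    show "j \<in> {u. (u, 0) \<in> D}" if "i \<in> {u. (u, 0) \<in> D}" "j \<le> i" for i j
      using diagramD[OF D, of i 0 j 0] that by simp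
  qed
  define L where "L = card {u. (u, 0) \<in> D}"
  define r where "r u = card {v. (u, v) \<in> D}" for u
  have mem: "(u, v) \<in> D \<longleftrightarrow> v < r u" for u v using arg_cong[OF row[of u], of "\<lambda>S. v \<in> S", folded r_def] by simp
  have L: "0 < r u \<longleftrightarrow> u < L" for u
    using arg_cong[OF col, of "\<lambda>S. u \<in> S", folded L_def] by (simp add: mem)
  have rl: "row_lengths D = map r [0..<L]" by (simp add: row_lengths_def r_def L_def)
  have "(u, v) \<in> young_diagram (row_lengths D) \<longleftrightarrow> (u, v) \<in> D" for u v
    using L[of u] by (auto simp: young_diagram_def rl mem)
  then show yd: "young_diagram (row_lengths D) = D" by auto
  have "r u' \<le> r u" if "u \<le> u'" for u u'
    using diagramD[OF D, of u' "r u" u "r u"] mem[of u' "r u"] mem[of u "r u"] that by auto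
  then have "sorted_wrt (\<ge>) (row_lengths D)" by (simp add: rl sorted_wrt_iff_nth_less)
  moreover have "r u \<noteq> 0" if "u < L" for u using L[of u] that by simp
  then have "0 \<notin> set (row_lengths D)" by (force simp: rl)
  ultimately have "row_lengths D \<in> partitions (sum_list (row_lengths D))" by (simp add: partitions_def)
  moreover from young_diagram_partition(2)[OF this] have "sum_list (row_lengths D) = card D"
    by (simp add: yd)
  ultimately show "row_lengths D \<in> partitions (card D)" by simp
qed

lemma bij_young_diagram: "bij_betw young_diagram (partitions n) {D. diagram D \<and> card D = n}"
  unfolding bij_betw_def
proof
  show "inj_on young_diagram (partitions n)" by (rule inj_onI) (rule young_diagram_inj)
  show "young_diagram ` partitions n = {D. diagram D \<and> card D = n}"
  proof (intro equalityI subsetI)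
    fix D assume "D \<in> {D. diagram D \<and> card D = n}"
    then show "D \<in> young_diagram ` partitions n"
      using young_diagram_row_lengths[of D] by (intro image_eqI[of _ _ "row_lengths D"]) auto
  qed (use young_diagram_partition in auto)
qed

lemma finite_partitions: "finite (partitions n)"
  using bij_betw_finite[OF bij_young_diagram] finite_diagrams by blast

lemma diagram_swap: "diagram D \<Longrightarrow> diagram (prod.swap ` D)"
  by (auto simp: diagram_def)

lemma card_swap: "card (prod.swap ` D) = card D"
  by (rule card_image) simp

lemma conj_partition_row_lengths: "conj_partition \<mu> = row_lengths (prod.swap ` young_diagram \<mu>)"
proof -
  have "{u. (u, 0) \<in> prod.swap ` young_diagram \<mu>} = {..<part \<mu> 0}"
    using young_diagram_part[of 0 _ \<mu>] by force
  moreover have "{v. (u, v) \<in> prod.swap ` young_diagram \<mu>} = {v. (v, u) \<in> young_diagram \<mu>}" for u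
    by force
  ultimately show ?thesis by (simp add: conj_partition_def row_lengths_def)
qed

lemma conj_partition:
  assumes \<mu>: "\<mu> \<in> partitions n"
  shows "conj_partition \<mu> \<in> partitions n" "young_diagram (conj_partition \<mu>) = prod.swap ` young_diagram \<mu>"
  using young_diagram_row_lengths[OF diagram_swap[OF young_diagram_partition(1)[OF \<mu>]]] young_diagram_partition(2)[OF \<mu>]
  by (simp_all add: conj_partition_row_lengths card_swap)

lemma conj_conj_partition:
  assumes \<mu>: "\<mu> \<in> partitions n"
  shows "conj_partition (conj_partition \<mu>) = \<mu>"
  by (rule young_diagram_inj[OF conj_partition(1)[OF conj_partition(1)[OF \<mu>]] \<mu>])
    (simp add: conj_partition(2)[OF conj_partition(1)[OF \<mu>]] conj_partition(2)[OF \<mu>] image_comp)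

text \<open>The least index at which the two differ is the same seen from either side, and exactly one of them is
the larger there.\<close>

lemma NCPar_conj:
  assumes \<mu>: "\<mu> \<in> partitions n" "\<mu> \<noteq> conj_partition \<mu>"
  shows "conj_partition \<mu> \<in> NCPar n \<longleftrightarrow> \<mu> \<notin> NCPar n"
proof -
  define i where "i = (LEAST i. part \<mu> i \<noteq> part (conj_partition \<mu>) i)"
  have "\<exists>i. part \<mu> i \<noteq> part (conj_partition \<mu>) i"
    using part_inj[OF \<mu>(1) conj_partition(1)[OF \<mu>(1)]] \<mu>(2) by blast
  then have i: "part \<mu> i \<noteq> part (conj_partition \<mu>) i" unfolding i_def by (rule LeastI_ex)
  have i': "(LEAST i. part (conj_partition \<mu>) i \<noteq> part \<mu> i) = i"
    unfolding i_def by (rule arg_cong[of _ _ Least]) auto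
  show ?thesis
    using \<mu> conj_partition(1)[OF \<mu>(1)] conj_conj_partition[OF \<mu>(1)] i
    unfolding NCPar_def Let_def by (auto simp: i' i_def[symmetric])
qed

lemma partitions_split:
  "partitions n = CPar n \<union> (NCPar n \<union> conj_partition ` NCPar n)"
  "CPar n \<inter> (NCPar n \<union> conj_partition ` NCPar n) = {}"
  "NCPar n \<inter> conj_partition ` NCPar n = {}"
proof -
  have N: "\<mu> \<in> partitions n" "\<mu> \<noteq> conj_partition \<mu>" if "\<mu> \<in> NCPar n" for \<mu>
    using that by (auto simp: NCPar_def)
  have N': "conj_partition \<mu> \<notin> NCPar n" if "\<mu> \<in> NCPar n" for \<mu>
    using NCPar_conj[OF N[OF that]] that by simp
  show "NCPar n \<inter> conj_partition ` NCPar n = {}" using N' by blast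
  show "CPar n \<inter> (NCPar n \<union> conj_partition ` NCPar n) = {}"
  proof (rule equals0I)
    fix \<mu> assume \<mu>: "\<mu> \<in> CPar n \<inter> (NCPar n \<union> conj_partition ` NCPar n)"
    then have c: "\<mu> = conj_partition \<mu>" by (simp add: CPar_def)
    then have "\<mu> \<notin> NCPar n" using N(2) by blast
    then obtain \<nu> where \<nu>: "\<nu> \<in> NCPar n" "\<mu> = conj_partition \<nu>" using \<mu> by blast
    then show False using c conj_conj_partition[OF N(1)[OF \<nu>(1)]] N(2)[OF \<nu>(1)] by simp
  qed
  show "partitions n = CPar n \<union> (NCPar n \<union> conj_partition ` NCPar n)"
  proof (intro equalityI subsetI)
    fix \<mu> assume \<mu>: "\<mu> \<in> partitions n"
    show "\<mu> \<in> CPar n \<union> (NCPar n \<union> conj_partition ` NCPar n)"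
    proof (cases "\<mu> = conj_partition \<mu> \<or> \<mu> \<in> NCPar n")
      case True then show ?thesis using \<mu> unfolding CPar_def by blast
    next
      case False
      then have "conj_partition \<mu> \<in> NCPar n" using NCPar_conj[OF \<mu>] by blast
      then have "conj_partition (conj_partition \<mu>) \<in> conj_partition ` NCPar n" by (rule imageI)
      then show ?thesis by (simp add: conj_conj_partition[OF \<mu>])
    qed
  next
    fix \<mu> assume "\<mu> \<in> CPar n \<union> (NCPar n \<union> conj_partition ` NCPar n)"
    then show "\<mu> \<in> partitions n" using N(1) conj_partition(1) by (auto simp: CPar_def)
  qed
qed

section \<open>Transposed tableaux\<close>

lemma tableaux_swap:
  assumes T: "T \<in> tableaux D"
  shows "T \<circ> prod.swap \<in> tableaux (prod.swap ` D)"
proof -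
  have "bij_betw prod.swap (prod.swap ` D) D"
    by (rule bij_betw_byWitness[of _ prod.swap]) auto
  then have "bij_betw (T \<circ> prod.swap) (prod.swap ` D) {1..card (prod.swap ` D)}"
    unfolding card_swap by (rule bij_betw_trans[OF _ tableaux_bij[OF T]])
  moreover have "(u, v) \<in> prod.swap ` D \<longleftrightarrow> (v, u) \<in> D" for u v by force
  ultimately show ?thesis
    unfolding tableaux_def using tableaux_zero[OF T] tableaux_row[OF T] tableaux_col[OF T]
    by (intro CollectI conjI) auto
qed

lemma swap_swap_tableau: "T \<circ> prod.swap \<circ> prod.swap = T"
  by (auto simp: fun_eq_iff)

lemma swap_swap_set: "prod.swap ` prod.swap ` D = D"
  by (simp add: image_comp)

lemma box_of_swap:
  assumes T: "T \<in> tableaux D" and i: "1 \<le> i" "i \<le> card D"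
  shows "box_of (T \<circ> prod.swap) i = prod.swap (box_of T i)"
proof -
  note b = box_of_entry[OF T i]
  show ?thesis
    using box_of_eq[OF tableaux_swap[OF T], of "prod.swap (box_of T i)"] b by simp
qed

lemma box_content_swap: "box_content (prod.swap b) = - box_content b"
  by (simp add: box_content_def)

lemma content_vector_swap:
  assumes "T \<in> tableaux D" "1 \<le> i" "i \<le> card D"
  shows "content_vector (T \<circ> prod.swap) i = - content_vector T i"
  unfolding content_vector_def box_of_swap[OF assms] box_content_swap by simp

text \<open>Both the sign and the sum of the two contents change their signs. The two contents differ, so the
case distinction in the definition is symmetric.\<close>

lemma ag_eigenvalue_swap:
  assumes D: "diagram D" "card D = n" "2 \<le> n" and T: "T \<in> tableaux D"
  shows "ag_eigenvalue n (T \<circ> prod.swap) = ag_eigenvalue n T"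
proof -
  have "content_vector T (n - 1) \<noteq> content_vector T n"
    using consecutive_contents_differ[OF D(1) T, of "n - 1"] D by auto
  then show ?thesis
    using content_vector_swap[OF T, of n] content_vector_swap[OF T, of "n - 1"] D
    by (auto simp: ag_eigenvalue_def)
qed

text \<open>Entry \<open>1\<close> is in the corner, and entry \<open>2\<close> is adjacent to it.\<close>

lemma content_of_two:
  assumes D: "diagram D" "2 \<le> card D" and T: "T \<in> tableaux D"
  shows "box_content (box_of T 2) = 1 \<or> box_content (box_of T 2) = - 1"
proof -
  obtain u v where uv: "box_of T 2 = (u, v)" by force
  have b2: "(u, v) \<in> D" "T (u, v) = 2" using box_of_entry[OF T, of 2] D uv by auto
  obtain x y where xy: "box_of T 1 = (x, y)" by force
  have b1: "(x, y) \<in> D" "T (x, y) = 1" using box_of_entry[OF T, of 1] D xy by auto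
  have z: "(0, 0) \<in> D" by (rule diagramD[OF D(1) b1(1)]) auto
  have "T (0, 0) = 1" using tableaux_mono[OF D(1) T b1(1), of 0 0] tableaux_range[OF T z] b1(2) by simp
  then have b10: "box_of T 1 = (0, 0)" using box_of_eq[OF T z] by simp
  have gap: "T b \<noteq> 1 \<or> b = (0, 0)" if "b \<in> D" for b using box_of_eq[OF T that] b10 by auto
  have "u = 0 \<and> 0 < v \<or> v = 0 \<and> 0 < u"
    using consecutive_boxes[OF D(1) T, of 1] D(2) b10 uv by (auto simp: numeral_2_eq_2)
  then show ?thesis
  proof
    assume *: "u = 0 \<and> 0 < v"
    have "\<not> 1 < v"
    proof
      assume v: "1 < v"
      have i: "(0, 1) \<in> D" using diagramD[OF D(1) b2(1), of 0 1] v by simp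
      have "T (0, 1) < 2" using tableaux_row[OF T v, of 0] b2 * by simp
      then show False using gap[OF i] tableaux_range[OF T i] by simp
    qed
    then show ?thesis using * by (simp add: uv box_content_def)
  next
    assume *: "v = 0 \<and> 0 < u"
    have "\<not> 1 < u"
    proof
      assume u: "1 < u"
      have i: "(1, 0) \<in> D" using diagramD[OF D(1) b2(1), of 1 0] u by simp
      have "T (1, 0) < 2" using tableaux_col[OF T u, of 0] b2 * by simp
      then show False using gap[OF i] tableaux_range[OF T i] by simp
    qed
    then show ?thesis using * by (simp add: uv box_content_def)
  qed
qed

text \<open>Transposing negates the content of the entry \<open>2\<close>, which is \<open>1\<close> or \<open>- 1\<close>.\<close>

lemma bij_betw_UStd_conj:
  assumes \<mu>: "\<mu> \<in> partitions n" and n: "2 \<le> n"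
  shows "bij_betw (\<lambda>T. T \<circ> prod.swap) (UStd (conj_partition \<mu>)) (SYT \<mu> - UStd \<mu>)"
proof -
  let ?D = "young_diagram \<mu>"
  note D = young_diagram_partition[OF \<mu>]
  have S: "SYT \<mu> = tableaux ?D" "SYT (conj_partition \<mu>) = tableaux (prod.swap ` ?D)"
    using SYT_tableaux[OF \<mu>] SYT_tableaux[OF conj_partition(1)[OF \<mu>]] conj_partition(2)[OF \<mu>] by auto
  have flip: "T \<circ> prod.swap \<in> tableaux ?D"
    "box_content (box_of (T \<circ> prod.swap) 2) = - box_content (box_of T 2)"
    if T: "T \<in> tableaux (prod.swap ` ?D)" for T
    using tableaux_swap[OF T] box_of_swap[OF T, of 2] D n
    by (simp_all add: swap_swap_set card_swap box_content_swap)
  have flip': "T \<circ> prod.swap \<in> tableaux (prod.swap ` ?D)"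
    "box_content (box_of (T \<circ> prod.swap) 2) = - box_content (box_of T 2)"
    if T: "T \<in> tableaux ?D" for T
    using tableaux_swap[OF T] box_of_swap[OF T, of 2] D n by (simp_all add: box_content_swap)
  show ?thesis
  proof (rule bij_betw_byWitness[of _ "\<lambda>T. T \<circ> prod.swap"])
    show "(\<lambda>T. T \<circ> prod.swap) ` UStd (conj_partition \<mu>) \<subseteq> SYT \<mu> - UStd \<mu>"
      using flip by (auto simp: UStd_def S)
    show "(\<lambda>T. T \<circ> prod.swap) ` (SYT \<mu> - UStd \<mu>) \<subseteq> UStd (conj_partition \<mu>)"
    proof (rule image_subsetI)
      fix T assume "T \<in> SYT \<mu> - UStd \<mu>"
      then have T: "T \<in> tableaux ?D" "box_content (box_of T 2) \<noteq> 1" by (auto simp: UStd_def S)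
      then have "box_content (box_of T 2) = - 1" using content_of_two[OF D(1) _ T(1)] D(2) n by simp
      then show "T \<circ> prod.swap \<in> UStd (conj_partition \<mu>)" using flip'[OF T(1)] by (simp add: UStd_def S)
    qed
  qed (simp_all add: swap_swap_tableau)
qed

lemma finite_SYT: "\<mu> \<in> partitions n \<Longrightarrow> finite (SYT \<mu>)"
  using SYT_tableaux finite_tableaux finite_diagram young_diagram_partition(1) by metis

lemma UStd_subset: "UStd \<mu> \<subseteq> SYT \<mu>"
  by (auto simp: UStd_def)

section \<open>The spectrum of the alternating group graph\<close>

definition shape_poly :: "nat \<Rightarrow> nat list \<Rightarrow> real poly" where
  "shape_poly n \<mu> = (\<Prod>T\<in>SYT \<mu>. [:- ag_eigenvalue n T, 1:])"

lemma prod_upper_standard: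
  assumes \<mu>: "\<mu> \<in> partitions n" and n: "2 \<le> n"
  shows "(\<Prod>x\<in>UStd \<mu> <+> UStd (conj_partition \<mu>).
      [:- ag_eigenvalue n (case x of Inl T \<Rightarrow> T | Inr T \<Rightarrow> T), 1:] ^ k) = shape_poly n \<mu> ^ k"
proof -
  let ?F = "\<lambda>T. [:- ag_eigenvalue n T, 1:]"
  note D = young_diagram_partition[OF \<mu>] and c = conj_partition[OF \<mu>]
  note D' = young_diagram_partition[OF c(1)]
  have fin: "finite (UStd \<mu>)" "finite (UStd (conj_partition \<mu>))"
    using finite_subset[OF UStd_subset finite_SYT] \<mu> c(1) by blast+
  have "prod ?F (SYT \<mu> - UStd \<mu>) = (\<Prod>T\<in>UStd (conj_partition \<mu>). ?F (T \<circ> prod.swap))"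
    by (rule prod.reindex_bij_betw[OF bij_betw_UStd_conj[OF \<mu> n], symmetric])
  also have "\<dots> = prod ?F (UStd (conj_partition \<mu>))"
  proof (rule prod.cong[OF refl])
    fix T assume "T \<in> UStd (conj_partition \<mu>)"
    then have "T \<in> tableaux (young_diagram (conj_partition \<mu>))"
      using SYT_tableaux[OF c(1)] UStd_subset by blast
    then show "?F (T \<circ> prod.swap) = ?F T" using ag_eigenvalue_swap[OF D'(1,2) n] by simp
  qed
  finally have "shape_poly n \<mu> = prod ?F (UStd \<mu>) * prod ?F (UStd (conj_partition \<mu>))"
    unfolding shape_poly_def prod.subset_diff[OF UStd_subset finite_SYT[OF \<mu>]] by (simp add: mult.commute)
  then show ?thesis by (simp add: prod.Plus[OF fin] comp_def prod_power_distrib power_mult_distrib)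
qed

lemma shape_poly_conj:
  assumes \<mu>: "\<mu> \<in> partitions n" and n: "2 \<le> n"
  shows "shape_poly n (conj_partition \<mu>) = shape_poly n \<mu>" "card (SYT (conj_partition \<mu>)) = card (SYT \<mu>)"
proof -
  note D = young_diagram_partition[OF \<mu>] and c = conj_partition[OF \<mu>]
  have S: "SYT \<mu> = tableaux (young_diagram \<mu>)" "SYT (conj_partition \<mu>) = tableaux (prod.swap ` young_diagram \<mu>)"
    using SYT_tableaux[OF \<mu>] SYT_tableaux[OF c(1)] c(2) by auto
  have bij: "bij_betw (\<lambda>T. T \<circ> prod.swap) (SYT \<mu>) (SYT (conj_partition \<mu>))"
  proof (rule bij_betw_byWitness[of _ "\<lambda>T. T \<circ> prod.swap"])
    show "(\<lambda>T. T \<circ> prod.swap) ` SYT \<mu> \<subseteq> SYT (conj_partition \<mu>)"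
      using tableaux_swap by (auto simp: S)
    show "(\<lambda>T. T \<circ> prod.swap) ` SYT (conj_partition \<mu>) \<subseteq> SYT \<mu>"
      using tableaux_swap[of _ "prod.swap ` young_diagram \<mu>"] by (auto simp: S swap_swap_set)
  qed (simp_all add: swap_swap_tableau)
  then show "card (SYT (conj_partition \<mu>)) = card (SYT \<mu>)" by (rule bij_betw_same_card[symmetric])
  show "shape_poly n (conj_partition \<mu>) = shape_poly n \<mu>"
    unfolding shape_poly_def prod.reindex_bij_betw[OF bij, symmetric]
    by (rule prod.cong[OF refl]) (use ag_eigenvalue_swap[OF D n] S(1) in auto)
qed

text \<open>Transposition pairs the tableaux that are upper standard with those that are not.\<close>

lemma even_self_conjugate:
  assumes \<mu>: "\<mu> \<in> CPar n" and n: "2 \<le> n"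
  shows "even (card (SYT \<mu>))"
proof -
  have p: "\<mu> \<in> partitions n" and c: "conj_partition \<mu> = \<mu>" using \<mu> by (auto simp: CPar_def)
  have "card (UStd \<mu>) = card (SYT \<mu> - UStd \<mu>)"
    using bij_betw_same_card[OF bij_betw_UStd_conj[OF p n]] unfolding c .
  also have "\<dots> = card (SYT \<mu>) - card (UStd \<mu>)"
    by (rule card_Diff_subset[OF finite_subset[OF UStd_subset finite_SYT[OF p]] UStd_subset])
  finally have "card (SYT \<mu>) = 2 * card (UStd \<mu>)"
    using card_mono[OF finite_SYT[OF p] UStd_subset] by linarith
  then show ?thesis by simp
qed

text \<open>Both sides are monic, so it suffices to compare their squares. In the square of the right hand side,
the factor of a non-self-conjugate shape appears twice, once for the shape and once for its
conjugate, and the halved multiplicity of a self-conjugate shape is doubled.\<close>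

theorem char_poly_AG:
  assumes n: "2 \<le> n" and vs: "distinct vs" "set vs = pverts (AG n)"
  shows "char_poly (adjacency_matrix (AG n) vs) =
    (\<Prod>\<mu>\<in>NCPar n \<union> CPar n. shape_poly n \<mu> ^ eigenvalue_multiplicity \<mu>)" (is "?c = ?R")
proof -
  let ?d = "\<lambda>\<mu>. card (SYT \<mu>)"
  note split = partitions_split[of n]
  have sub: "CPar n \<subseteq> partitions n" "NCPar n \<subseteq> partitions n" by (auto simp: CPar_def NCPar_def)
  have fin: "finite (CPar n)" "finite (NCPar n)" using finite_subset[OF _ finite_partitions] sub by blast+
  have inj: "inj_on conj_partition (NCPar n)"
    by (rule inj_onI) (metis conj_conj_partition sub(2) subsetD)
  have "?c\<^sup>2 = (\<Prod>D | diagram D \<and> card D = n. (\<Prod>T\<in>tableaux D. [:- ag_eigenvalue n T, 1:]) ^ card (tableaux D))"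
    by (rule char_poly_AG_squared[OF n vs])
  also have "\<dots> = (\<Prod>\<mu>\<in>partitions n. (\<Prod>T\<in>tableaux (young_diagram \<mu>). [:- ag_eigenvalue n T, 1:]) ^ card (tableaux (young_diagram \<mu>)))"
    by (rule prod.reindex_bij_betw[OF bij_young_diagram, symmetric])
  also have "\<dots> = (\<Prod>\<mu>\<in>partitions n. shape_poly n \<mu> ^ ?d \<mu>)"
    by (rule prod.cong[OF refl]) (simp add: shape_poly_def SYT_tableaux)
  also have "\<dots> = (\<Prod>\<mu>\<in>CPar n. shape_poly n \<mu> ^ ?d \<mu>) *
    ((\<Prod>\<mu>\<in>NCPar n. shape_poly n \<mu> ^ ?d \<mu>) * (\<Prod>\<mu>\<in>conj_partition ` NCPar n. shape_poly n \<mu> ^ ?d \<mu>))"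
    unfolding split(1)
      prod.union_disjoint[OF fin(1) finite_UnI[OF fin(2) finite_imageI[OF fin(2)]] split(2)]
      prod.union_disjoint[OF fin(2) finite_imageI[OF fin(2)] split(3)] ..
  also have "(\<Prod>\<mu>\<in>conj_partition ` NCPar n. shape_poly n \<mu> ^ ?d \<mu>) = (\<Prod>\<mu>\<in>NCPar n. shape_poly n \<mu> ^ ?d \<mu>)"
    unfolding prod.reindex[OF inj] comp_def
  proof (rule prod.cong[OF refl])
    fix \<mu> assume "\<mu> \<in> NCPar n"
    then have "\<mu> \<in> partitions n" using sub(2) by blast
    then show "shape_poly n (conj_partition \<mu>) ^ ?d (conj_partition \<mu>) = shape_poly n \<mu> ^ ?d \<mu>"
      by (simp add: shape_poly_conj n)
  qed
  also have "(\<Prod>\<mu>\<in>CPar n. shape_poly n \<mu> ^ ?d \<mu>) * ((\<Prod>\<mu>\<in>NCPar n. shape_poly n \<mu> ^ ?d \<mu>) * (\<Prod>\<mu>\<in>NCPar n. shape_poly n \<mu> ^ ?d \<mu>)) =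
    (\<Prod>\<mu>\<in>CPar n. (shape_poly n \<mu> ^ eigenvalue_multiplicity \<mu>)\<^sup>2) *
    (\<Prod>\<mu>\<in>NCPar n. (shape_poly n \<mu> ^ eigenvalue_multiplicity \<mu>)\<^sup>2)"
  proof (rule arg_cong2[where f = "(*)"])
    show "(\<Prod>\<mu>\<in>CPar n. shape_poly n \<mu> ^ ?d \<mu>) = (\<Prod>\<mu>\<in>CPar n. (shape_poly n \<mu> ^ eigenvalue_multiplicity \<mu>)\<^sup>2)"
    proof (rule prod.cong[OF refl])
      fix \<mu> assume \<mu>: "\<mu> \<in> CPar n"
      then have "eigenvalue_multiplicity \<mu> * 2 = ?d \<mu>"
        using even_self_conjugate[OF \<mu> n] by (simp add: eigenvalue_multiplicity_def CPar_def)
      then show "shape_poly n \<mu> ^ ?d \<mu> = (shape_poly n \<mu> ^ eigenvalue_multiplicity \<mu>)\<^sup>2"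
        by (simp only: power_mult[symmetric])
    qed
    show "(\<Prod>\<mu>\<in>NCPar n. shape_poly n \<mu> ^ ?d \<mu>) * (\<Prod>\<mu>\<in>NCPar n. shape_poly n \<mu> ^ ?d \<mu>) =
      (\<Prod>\<mu>\<in>NCPar n. (shape_poly n \<mu> ^ eigenvalue_multiplicity \<mu>)\<^sup>2)"
      unfolding prod.distrib[symmetric] power2_eq_square
      by (rule prod.cong[OF refl]) (auto simp: NCPar_def eigenvalue_multiplicity_def)
  qed
  also have "\<dots> = ?R\<^sup>2"
  proof -
    have disj: "NCPar n \<inter> CPar n = {}" using split(2) by blast
    show ?thesis
      unfolding prod_power_distrib prod.union_disjoint[OF fin(2,1) disj] power_mult_distrib
      by (rule mult.commute)
  qed
  finally have sq: "?c\<^sup>2 = ?R\<^sup>2" .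
  have "lead_coeff ?R = 1"
    by (simp add: lead_coeff_prod lead_coeff_power shape_poly_def)
  moreover have "lead_coeff ?c = 1"
    using degree_monic_char_poly[of "adjacency_matrix (AG n) vs" "length vs"]
    by (simp add: adjacency_matrix_def)
  ultimately have "?c \<noteq> - ?R" by (metis lead_coeff_minus one_neq_neg_one)
  then show ?thesis using sq by (simp add: power2_eq_iff)
qed

lemma ag_eigenvalue_cases:
  assumes D: "diagram D" "card D = n" "2 \<le> n" and T: "T \<in> tableaux D"
  defines "c \<equiv> content_vector T"
  shows "same_row T (n - 1) n \<Longrightarrow> ag_eigenvalue n T = c n + c (n - 1) - 1"
    "same_column T (n - 1) n \<Longrightarrow> ag_eigenvalue n T = - c n - c (n - 1) - 1"
    "ag_eigenvalue n T = c n + c (n - 1) - 1 \<and> ag_eigenvalue n (swap_entries (n - 1) n T) = - c n - c (n - 1) - 1 \<or>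
     ag_eigenvalue n (swap_entries (n - 1) n T) = c n + c (n - 1) - 1 \<and> ag_eigenvalue n T = - c n - c (n - 1) - 1"
proof -
  have n: "1 \<le> n - 1" "Suc (n - 1) = n" using D by auto
  note b = consecutive_boxes[OF D(1) T n(1), unfolded n(2) D(2), OF order_refl]
  have c: "c i = real_of_int (box_content (box_of T i))" for i by (simp add: c_def content_vector_def)
  have "c (n - 1) < c n" if "same_row T (n - 1) n"
    using that b unfolding c same_row_def box_content_def by linarith
  then show "same_row T (n - 1) n \<Longrightarrow> ag_eigenvalue n T = c n + c (n - 1) - 1"
    by (simp add: ag_eigenvalue_def c_def)
  have "\<not> c (n - 1) < c n" if "same_column T (n - 1) n"
    using that b unfolding c same_column_def box_content_def by linarith
  then show "same_column T (n - 1) n \<Longrightarrow> ag_eigenvalue n T = - c n - c (n - 1) - 1"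
    by (simp add: ag_eigenvalue_def c_def)
  have "content_vector (swap_entries (n - 1) n T) n = c (n - 1)"
    "content_vector (swap_entries (n - 1) n T) (n - 1) = c n"
    by (simp_all add: content_vector_def box_of_swap_entries c)
  moreover have "c (n - 1) \<noteq> c n"
    using consecutive_contents_differ[OF D(1) T n(1)] n D(2) by (simp add: c_def)
  ultimately show "ag_eigenvalue n T = c n + c (n - 1) - 1 \<and> ag_eigenvalue n (swap_entries (n - 1) n T) = - c n - c (n - 1) - 1 \<or>
     ag_eigenvalue n (swap_entries (n - 1) n T) = c n + c (n - 1) - 1 \<and> ag_eigenvalue n T = - c n - c (n - 1) - 1"
    by (auto simp: ag_eigenvalue_def c_def[symmetric])
qed

theorem theorem5p1:
  fixes n :: nat and vs :: "(nat \<Rightarrow> nat) list"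
  assumes "n \<ge> 2"
    and "distinct vs" and "set vs = pverts (AG n)"
  shows "\<exists>E :: tableau \<Rightarrow> real.
    char_poly (adjacency_matrix (AG n) vs) =
      (\<Prod>\<mu> \<in> NCPar n \<union> CPar n. \<Prod>x \<in> UStd \<mu> <+> UStd (conj_partition \<mu>).
         [:- E (case x of Inl T \<Rightarrow> T | Inr T \<Rightarrow> T), 1:] ^ eigenvalue_multiplicity \<mu>) \<and>
    (\<forall>\<mu> \<in> NCPar n \<union> CPar n. \<forall>T \<in> UStd \<mu> \<union> UStd (conj_partition \<mu>).
       let c = (\<lambda>i. real_of_int (box_content (box_of T i))); S = swap_entries (n - 1) n T in
       (same_row T (n - 1) n \<longrightarrow> E T = c n + c (n - 1) - 1) \<and>
       (same_column T (n - 1) n \<longrightarrow> E T = - c n - c (n - 1) - 1) \<and>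
       (\<not> same_row T (n - 1) n \<and> \<not> same_column T (n - 1) n \<longrightarrow>
          (E T = c n + c (n - 1) - 1 \<and> E S = - c n - c (n - 1) - 1) \<or>
          (E S = c n + c (n - 1) - 1 \<and> E T = - c n - c (n - 1) - 1)))"
proof (intro exI[of _ "ag_eigenvalue n"] conjI ballI)
  have sub: "\<mu> \<in> partitions n" if "\<mu> \<in> NCPar n \<union> CPar n" for \<mu>
    using that by (auto simp: NCPar_def CPar_def)
  show "char_poly (adjacency_matrix (AG n) vs) =
      (\<Prod>\<mu> \<in> NCPar n \<union> CPar n. \<Prod>x \<in> UStd \<mu> <+> UStd (conj_partition \<mu>).
         [:- ag_eigenvalue n (case x of Inl T \<Rightarrow> T | Inr T \<Rightarrow> T), 1:] ^ eigenvalue_multiplicity \<mu>)"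
    unfolding char_poly_AG[OF assms]
    by (rule prod.cong[OF refl]) (simp add: prod_upper_standard[OF sub assms(1)])
  fix \<mu> T assume \<mu>: "\<mu> \<in> NCPar n \<union> CPar n" and T: "T \<in> UStd \<mu> \<union> UStd (conj_partition \<mu>)"
  have p: "\<mu> \<in> partitions n" "conj_partition \<mu> \<in> partitions n"
    using sub[OF \<mu>] conj_partition(1) by auto
  obtain \<nu> where \<nu>: "\<nu> \<in> partitions n" "T \<in> SYT \<nu>" using T p UStd_subset by blast
  then have T': "T \<in> tableaux (young_diagram \<nu>)" using SYT_tableaux by blast
  note e = ag_eigenvalue_cases[OF young_diagram_partition[OF \<nu>(1)] assms(1) T', unfolded content_vector_def]
  show "let c = (\<lambda>i. real_of_int (box_content (box_of T i))); S = swap_entries (n - 1) n T in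
       (same_row T (n - 1) n \<longrightarrow> ag_eigenvalue n T = c n + c (n - 1) - 1) \<and>
       (same_column T (n - 1) n \<longrightarrow> ag_eigenvalue n T = - c n - c (n - 1) - 1) \<and>
       (\<not> same_row T (n - 1) n \<and> \<not> same_column T (n - 1) n \<longrightarrow>
          (ag_eigenvalue n T = c n + c (n - 1) - 1 \<and> ag_eigenvalue n S = - c n - c (n - 1) - 1) \<or>
          (ag_eigenvalue n S = c n + c (n - 1) - 1 \<and> ag_eigenvalue n T = - c n - c (n - 1) - 1))"
    unfolding Let_def using e by blast
qed

end
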